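(* Let $\pi(\theta)=\mathcal{N}(\theta;\mu,Q^{-1})$ be Gaussian on $\mathbb{R}^p$ with positive definite $Q$, $\theta=(\theta_0,\dots,\theta_K)$ divided into $K+1$ blocks, $(\mathcal{C},\mathcal{U})$ a partition of $\{0,\dots,K\}$ with $\mathcal{U}\ne\emptyset$, and let $\mathcal{Q}$, $V(q\Vert\pi)$ and $q^*=\arg\max_{q\in\mathcal{Q}}V(q\Vert\pi)$ be as defined in the context. Consider the random-scan partially factorized coordinate ascent algorithm: starting from densities $q_0(\theta_k)$, $k\in\mathcal{U}$, at each update an index $k$ is drawn uniformly at random from $\mathcal{U}$, independently of the past, and the factor $q(\theta_k)$ is replaced by $q^{\mathrm{new}}(\theta_k)\propto\exp\{\mathbb{E}_{q(\theta_{\mathcal{U}\setminus k})}[\log\pi(\theta_{\mathcal{U}})]\}$ (where $\pi(\theta_{\mathcal{U}})$ is the marginal of $\pi$ and $q(\theta_{\mathcal{U}\setminus k})=\prod_{m\in\mathcal{U},m\ne k}q(\theta_m)$ are the current factors), all other factors being unchanged. After $s$ updates, set $q_s(\theta)=\pi(\theta_{\mathcal{C}}\mid\theta_{\mathcal{U}})\prod_{k\in\mathcal{U}}q_s(\theta_k)$. Write $u=|\mathcal{U}|$. Then for every starting point with $V(q_0\Vert\pi)>-\infty$ and every integer $s\ge0$, $$\mathbb{E}\big[V(q^*\Vert\pi)-V(q_s\Vert\pi)\big]\le\Big(1-\frac{UQF(q^*\Vert\pi)}{u}\Big)^{s}\big(V(q^*\Vert\pi)-V(q_0\Vert\pi)\big).$$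 Moreover, there exists a starting point $q_0^\dagger$ such that for every integer $s\ge0$, $$\mathbb{E}\big[V(q^*\Vert\pi)-V(q_s\Vert\pi)\big]\ge\Big(1-\frac{UQF(q^*\Vert\pi)}{u}\Big)^{2s}\big(V(q^*\Vert\pi)-V(q^\dagger_0\Vert\pi)\big).$$ Expectations are with respect to the random choice of coordinates. (In particular, after $t$ full "iterations" consisting of $s=ut$ updates, the rate is $(1-UQF(q^*\Vert\pi)/u)^{ut}$ for the upper bound and $(1-UQF(q^*\Vert\pi)/u)^{2ut}$ for the lower bound.)
   Context: $\theta_{\mathcal{C}}=(\theta_k)_{k\in\mathcal{C}}$, $\theta_{\mathcal{U}}=(\theta_k)_{k\in\mathcal{U}}$; $\mathcal{Q}=\{q: q(\theta)=q(\theta_{\mathcal{C}}\mid\theta_{\mathcal{U}})\prod_{k\in\mathcal{U}}q(\theta_k)\}$; $V(q\Vert\pi)=\mathbb{E}_{q(\theta)}[\log\pi(\theta)-\log q(\theta)]$ (the maximizer $q^*$ over $\mathcal{Q}$ exists and is unique). The uncertainty quantification fraction is $UQF(q\Vert\pi)=\inf_{v\in\mathbb{R}^p\setminus\{0\}}\frac{\mathrm{var}_{q}(\theta^Tv)}{\mathrm{var}_{\pi}(\theta^Tv)}$. *)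

theory Defs
  imports "HOL-Analysis.Analysis"
begin

text \<open>Parameters are a finite coordinate type 'n (so theta lives in R^p with p = CARD('n)),
  and a block map blk assigning to each coordinate its block index in {0..K}.
  Vectors are functions 'n => real; Lebesgue measure on R^S (S a set of coordinates)
  is the product measure LB S.\<close>

definition LB :: "'n set \<Rightarrow> ('n \<Rightarrow> real) measure" where
  "LB S = PiM S (\<lambda>_. lborel)"

abbreviation Lp :: "('n::finite \<Rightarrow> real) measure" where
  "Lp \<equiv> LB UNIV"

definition is_density :: "'a measure \<Rightarrow> ('a \<Rightarrow> real) \<Rightarrow> bool" where
  "is_density M f \<longleftrightarrow> f \<in> borel_measurable M \<and> (\<forall>x\<in>space M. 0 \<le> f x)
     \<and> (\<integral>\<^sup>+ x. ennreal (f x) \<partial>M) = 1"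

definition quadform :: "('n::finite \<Rightarrow> 'n \<Rightarrow> real) \<Rightarrow> ('n \<Rightarrow> real) \<Rightarrow> real" where
  "quadform Q x = (\<Sum>i\<in>UNIV. \<Sum>j\<in>UNIV. x i * Q i j * x j)"

definition pos_def_mat :: "('n::finite \<Rightarrow> 'n \<Rightarrow> real) \<Rightarrow> bool" where
  "pos_def_mat Q \<longleftrightarrow> (\<forall>i j. Q i j = Q j i) \<and> (\<forall>x. (\<exists>i. x i \<noteq> 0) \<longrightarrow> quadform Q x > 0)"

text \<open>Gaussian density N(theta; mu, Q^{-1}) w.r.t. Lebesgue measure on R^p;
  the normalising constant (2 pi)^{-p/2} det(Q)^{1/2} is written as the integral it equals.\<close>
definition gauss :: "('n::finite \<Rightarrow> 'n \<Rightarrow> real) \<Rightarrow> ('n \<Rightarrow> real) \<Rightarrow> ('n \<Rightarrow> real) \<Rightarrow> real" where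
  "gauss Q mu \<theta> = exp (- quadform Q (\<lambda>i. \<theta> i - mu i) / 2)
      / (\<integral>x. exp (- quadform Q (\<lambda>i. x i - mu i) / 2) \<partial>Lp)"

definition blockset :: "('n \<Rightarrow> nat) \<Rightarrow> nat set \<Rightarrow> 'n set" where
  "blockset blk A = {i. blk i \<in> A}"

abbreviation blk1 :: "('n \<Rightarrow> nat) \<Rightarrow> nat \<Rightarrow> 'n set" where
  "blk1 blk k \<equiv> blockset blk {k}"

text \<open>ELBO V(q||pi) = E_q[log pi - log q], with value -infinity when the integral diverges
  (its positive part is always integrable, bounded by pi).\<close>
definition Vfun :: "(('n::finite \<Rightarrow> real) \<Rightarrow> real) \<Rightarrow> (('n \<Rightarrow> real) \<Rightarrow> real) \<Rightarrow> ereal" where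
  "Vfun pd q = (if integrable Lp (\<lambda>\<theta>. q \<theta> * (ln (pd \<theta>) - ln (q \<theta>)))
                then ereal (\<integral>\<theta>. q \<theta> * (ln (pd \<theta>) - ln (q \<theta>)) \<partial>Lp) else -\<infinity>)"

definition margU :: "('n::finite \<Rightarrow> nat) \<Rightarrow> nat set \<Rightarrow> (('n \<Rightarrow> real) \<Rightarrow> real) \<Rightarrow> ('n \<Rightarrow> real) \<Rightarrow> real" where
  "margU blk U pd y = (\<integral>x. pd (merge (- blockset blk U) (blockset blk U) (x, y)) \<partial>LB (- blockset blk U))"

definition condC :: "('n::finite \<Rightarrow> nat) \<Rightarrow> nat set \<Rightarrow> (('n \<Rightarrow> real) \<Rightarrow> real) \<Rightarrow> ('n \<Rightarrow> real) \<Rightarrow> real" where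
  "condC blk U pd \<theta> = pd \<theta> / margU blk U pd (restrict \<theta> (blockset blk U))"

definition prodf :: "('n \<Rightarrow> nat) \<Rightarrow> nat set \<Rightarrow> (nat \<Rightarrow> ('n \<Rightarrow> real) \<Rightarrow> real) \<Rightarrow> ('n \<Rightarrow> real) \<Rightarrow> real" where
  "prodf blk A qf \<theta> = (\<Prod>k\<in>A. qf k (restrict \<theta> (blk1 blk k)))"

definition qjoint :: "('n::finite \<Rightarrow> nat) \<Rightarrow> nat set \<Rightarrow> (('n \<Rightarrow> real) \<Rightarrow> real)
     \<Rightarrow> (nat \<Rightarrow> ('n \<Rightarrow> real) \<Rightarrow> real) \<Rightarrow> ('n \<Rightarrow> real) \<Rightarrow> real" where
  "qjoint blk U pd qf \<theta> = condC blk U pd \<theta> * prodf blk U qf \<theta>"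

definition valid_factors :: "('n \<Rightarrow> nat) \<Rightarrow> nat set \<Rightarrow> (nat \<Rightarrow> ('n \<Rightarrow> real) \<Rightarrow> real) \<Rightarrow> bool" where
  "valid_factors blk U qf \<longleftrightarrow> (\<forall>k\<in>U. is_density (LB (blk1 blk k)) (qf k))"

definition famQ :: "('n::finite \<Rightarrow> nat) \<Rightarrow> nat set \<Rightarrow> (('n \<Rightarrow> real) \<Rightarrow> real) set" where
  "famQ blk U = {q. \<exists>g qf. valid_factors blk U qf \<and> g \<in> borel_measurable Lp
      \<and> (\<forall>y\<in>space (LB (blockset blk U)).
            is_density (LB (- blockset blk U)) (\<lambda>x. g (merge (- blockset blk U) (blockset blk U) (x, y))))
      \<and> (\<forall>\<theta>. q \<theta> = g \<theta> * prodf blk U qf \<theta>)}"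

definition cavi_exponent :: "('n::finite \<Rightarrow> nat) \<Rightarrow> nat set \<Rightarrow> (('n \<Rightarrow> real) \<Rightarrow> real)
     \<Rightarrow> (nat \<Rightarrow> ('n \<Rightarrow> real) \<Rightarrow> real) \<Rightarrow> nat \<Rightarrow> ('n \<Rightarrow> real) \<Rightarrow> real" where
  "cavi_exponent blk U pd qf k x =
     (\<integral>y. prodf blk (U - {k}) qf y
          * ln (margU blk U pd (merge (blk1 blk k) (blockset blk (U - {k})) (x, y)))
       \<partial>LB (blockset blk (U - {k})))"

definition cavi_upd :: "('n::finite \<Rightarrow> nat) \<Rightarrow> nat set \<Rightarrow> (('n \<Rightarrow> real) \<Rightarrow> real)
     \<Rightarrow> (nat \<Rightarrow> ('n \<Rightarrow> real) \<Rightarrow> real) \<Rightarrow> nat \<Rightarrow> (nat \<Rightarrow> ('n \<Rightarrow> real) \<Rightarrow> real)" where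
  "cavi_upd blk U pd qf k = qf(k := (\<lambda>x. exp (cavi_exponent blk U pd qf k x)
       / (\<integral>z. exp (cavi_exponent blk U pd qf k z) \<partial>LB (blk1 blk k))))"

definition cavi_run :: "('n::finite \<Rightarrow> nat) \<Rightarrow> nat set \<Rightarrow> (('n \<Rightarrow> real) \<Rightarrow> real)
     \<Rightarrow> (nat \<Rightarrow> ('n \<Rightarrow> real) \<Rightarrow> real) \<Rightarrow> nat list \<Rightarrow> (nat \<Rightarrow> ('n \<Rightarrow> real) \<Rightarrow> real)" where
  "cavi_run blk U pd qf0 ks = foldl (cavi_upd blk U pd) qf0 ks"

text \<open>Expected suboptimality after s random-scan updates: the s indices are i.i.d. uniform on U,
  so the expectation is the average over all sequences in U^s.\<close>
definition exp_gap :: "('n::finite \<Rightarrow> nat) \<Rightarrow> nat set \<Rightarrow> (('n \<Rightarrow> real) \<Rightarrow> real)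
     \<Rightarrow> (('n \<Rightarrow> real) \<Rightarrow> real) \<Rightarrow> (nat \<Rightarrow> ('n \<Rightarrow> real) \<Rightarrow> real) \<Rightarrow> nat \<Rightarrow> ereal" where
  "exp_gap blk U pd qstar qf0 s =
     (\<Sum>ks\<in>{ks. set ks \<subseteq> U \<and> length ks = s}.
        ereal (1 / real (card U) ^ s) * (Vfun pd qstar - Vfun pd (qjoint blk U pd (cavi_run blk U pd qf0 ks))))"

definition dvar :: "(('n::finite \<Rightarrow> real) \<Rightarrow> real) \<Rightarrow> (('n \<Rightarrow> real) \<Rightarrow> real) \<Rightarrow> real" where
  "dvar q f = (\<integral>\<theta>. q \<theta> * (f \<theta>)\<^sup>2 \<partial>Lp) - (\<integral>\<theta>. q \<theta> * f \<theta> \<partial>Lp)\<^sup>2"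

definition UQF :: "(('n::finite \<Rightarrow> real) \<Rightarrow> real) \<Rightarrow> (('n \<Rightarrow> real) \<Rightarrow> real) \<Rightarrow> real" where
  "UQF q pd = Inf {dvar q (\<lambda>\<theta>. \<Sum>i\<in>UNIV. \<theta> i * v i) / dvar pd (\<lambda>\<theta>. \<Sum>i\<in>UNIV. \<theta> i * v i)
                  | v :: 'n \<Rightarrow> real. \<exists>i. v i \<noteq> 0}"

end

theory Submission
  imports Defs "HOL-Probability.Distributions"
begin

text \<open>
  Maximising over the conditional of \<open>\<theta>\<^sub>C\<close> reduces everything to the marginal on the blocks in \<open>U\<close>, a
  Gaussian with precision \<open>T\<close>. If the factors \<open>q\<^sub>k\<close> have means \<open>m\<^sub>k\<close>, independence of the blocks gives
  \<open>V(q\<^sup>*) - V(q) = (\<Sum>k. KL(q\<^sub>k || N(m\<^sub>k, T\<^sub>k\<^sub>k\<^sup>-\<^sup>1))) + (m - \<mu>)\<^sup>t T (m - \<mu>) / 2\<close>.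
  An update of block \<open>k\<close> annihilates the \<open>k\<close>-th divergence and minimises the quadratic term exactly over
  \<open>m\<^sub>k\<close>. With \<open>D\<close> the block diagonal of \<open>T\<close>, UQF is the least eigenvalue \<open>lam\<close> of \<open>D\<^sup>-\<^sup>1 T\<close>, it is at most 1, and
  summing the decrease over \<open>k\<close> yields at least \<open>lam\<close> times the gap. Starting from the optimum translated
  by an eigenvector for \<open>lam\<close>, the expected mean error contracts by exactly \<open>1 - lam / u\<close>, and Jensen's
  inequality gives the lower bound.
\<close>

section \<open>Quadratic forms\<close>

text \<open>The starting factors are arbitrary densities, so the decomposition of V makes sense only
  after finiteness of V(q0) has been turned into finite second moments and a finite divergence of
  each factor separately. Each divergence is taken against a normal law centred at the factor's own
  mean. This moving reference decouples the blocks: an update of block \<open>k\<close> alters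
  neither means nor divergences elsewhere, and all interaction sits in the quadratic term. The
  maximiser is equally unspecified: its conditional for the remaining blocks may be any kernel, and
  it is determined only almost everywhere, which suffices because UQF sees it through integrals. UQF
  ranges over directions in all coordinates, while the means live on the blocks in \<open>U\<close>.
  On the conditional part the two precision forms agree, so \<open>lam\<close> <= 1 serves twice:
  for that part, and to let the divergences shrink at the common rate. Inverse matrices enter as
  solutions of linear systems, and spectral facts come from minimising a quotient of quadratic forms
  and from Cauchy-Schwarz.\<close>

definition bil :: "('n::finite \<Rightarrow> 'n \<Rightarrow> real) \<Rightarrow> ('n \<Rightarrow> real) \<Rightarrow> ('n \<Rightarrow> real) \<Rightarrow> real" where
  "bil M x y = (\<Sum>i\<in>UNIV. \<Sum>j\<in>UNIV. x i * M i j * y j)"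

definition coord_proj :: "'n set \<Rightarrow> ('n \<Rightarrow> real) \<Rightarrow> 'n \<Rightarrow> real" where
  "coord_proj S x = (\<lambda>i. if i \<in> S then x i else 0)"

definition supp_on :: "'n set \<Rightarrow> ('n \<Rightarrow> real) \<Rightarrow> bool" where
  "supp_on S x \<longleftrightarrow> (\<forall>i. i \<notin> S \<longrightarrow> x i = 0)"

definition sym_mat :: "('n \<Rightarrow> 'n \<Rightarrow> real) \<Rightarrow> bool" where
  "sym_mat M \<longleftrightarrow> (\<forall>i j. M i j = M j i)"

text \<open>Definiteness is relative to a coordinate set because the matrix \<open>T\<close> below
  is padded by zeros: semidefinite on the whole space, definite on vectors supported on
  \<open>B\<close>. Shrinking \<open>S\<close> covers the diagonal blocks.\<close>

definition pd_on :: "'n::finite set \<Rightarrow> ('n \<Rightarrow> 'n \<Rightarrow> real) \<Rightarrow> bool" where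
  "pd_on S M \<longleftrightarrow> sym_mat M \<and> (\<forall>x. supp_on S x \<longrightarrow> (\<exists>i. x i \<noteq> 0) \<longrightarrow> quadform M x > 0)"

lemma quadform_bil: "quadform M x = bil M x x"
  by (simp add: quadform_def bil_def)

lemma bil_add_left: "bil M (\<lambda>i. x i + y i) z = bil M x z + bil M y z"
  by (simp add: bil_def sum.distrib algebra_simps)

lemma bil_add_right: "bil M z (\<lambda>i. x i + y i) = bil M z x + bil M z y"
  by (simp add: bil_def sum.distrib algebra_simps)

lemma bil_diff_left: "bil M (\<lambda>i. x i - y i) z = bil M x z - bil M y z"
  by (simp add: bil_def sum_subtractf algebra_simps)

lemma bil_diff_right: "bil M z (\<lambda>i. x i - y i) = bil M z x - bil M z y"
  by (simp add: bil_def sum_subtractf algebra_simps)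

lemma bil_scale_left: "bil M (\<lambda>i. c * x i) y = c * bil M x y"
  by (simp add: bil_def sum_distrib_left algebra_simps)

lemma bil_scale_right: "bil M x (\<lambda>i. c * y i) = c * bil M x y"
  by (simp add: bil_def sum_distrib_left algebra_simps)

lemma bil_sum_left: "bil M (\<lambda>i. \<Sum>k\<in>A. x k i) y = (\<Sum>k\<in>A. bil M (x k) y)"
  by (induction A rule: infinite_finite_induct)
    (simp_all add: bil_add_left, simp_all add: bil_def)

lemma bil_commute: "sym_mat M \<Longrightarrow> bil M x y = bil M y x"
  unfolding bil_def sym_mat_def by (subst sum.swap) (simp add: mult.commute mult.left_commute)

lemma bil_rows: "bil M x y = (\<Sum>i\<in>UNIV. x i * (\<Sum>j\<in>UNIV. M i j * y j))"
  by (simp add: bil_def sum_distrib_left mult.assoc)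

lemma bil_cong_rows:
  assumes "supp_on S x" "\<And>i. i \<in> S \<Longrightarrow> (\<Sum>j\<in>UNIV. M i j * y j) = (\<Sum>j\<in>UNIV. N i j * z j)"
  shows "bil M x y = bil N x z"
proof -
  have "x i * (\<Sum>j\<in>UNIV. M i j * y j) = x i * (\<Sum>j\<in>UNIV. N i j * z j)" for i
    using assms by (cases "i \<in> S") (auto simp: supp_on_def)
  then show ?thesis unfolding bil_rows by (intro sum.cong refl)
qed

lemma quadform_add: "sym_mat M \<Longrightarrow>
    quadform M (\<lambda>i. x i + y i) = quadform M x + 2 * bil M x y + quadform M y"
  using bil_commute[of M x y] by (simp add: quadform_bil bil_add_left bil_add_right)

lemma quadform_diff: "sym_mat M \<Longrightarrow>
    quadform M (\<lambda>i. x i - y i) = quadform M x - 2 * bil M x y + quadform M y"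
  using bil_commute[of M x y] by (simp add: quadform_bil bil_diff_left bil_diff_right)

lemma quadform_scale: "quadform M (\<lambda>i. c * x i) = c\<^sup>2 * quadform M x"
  by (simp add: quadform_bil bil_scale_left bil_scale_right power2_eq_square)

lemma quadform_eq_0: "(\<And>i. x i = 0) \<Longrightarrow> quadform M x = 0"
  by (simp add: quadform_def)

lemma pd_on_nonneg: "pd_on S M \<Longrightarrow> supp_on S x \<Longrightarrow> 0 \<le> quadform M x"
  by (cases "\<exists>i. x i \<noteq> 0") (auto simp: pd_on_def quadform_eq_0 intro: less_imp_le)

lemma pd_on_UNIV_pos: "pd_on UNIV M \<Longrightarrow> \<exists>i. x i \<noteq> 0 \<Longrightarrow> quadform M x > 0"
  by (simp add: pd_on_def supp_on_def)

lemma pd_on_sym: "pd_on S M \<Longrightarrow> sym_mat M"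
  by (simp add: pd_on_def)

lemma pd_on_subset: "pd_on S M \<Longrightarrow> S' \<subseteq> S \<Longrightarrow> pd_on S' M"
  by (auto simp: pd_on_def supp_on_def)

lemma supp_on_coord_proj [simp]: "supp_on S (coord_proj S x)"
  by (simp add: supp_on_def coord_proj_def)

lemma supp_on_add: "supp_on S x \<Longrightarrow> supp_on S y \<Longrightarrow> supp_on S (\<lambda>i. x i + c * y i)"
  by (simp add: supp_on_def)

text \<open>The form is nonnegative along the line \<open>x + t y\<close>. Semidefiniteness has to
  suffice, since \<open>eigen\<close> applies the inequality to \<open>T - lam D\<close>, which is
  degenerate by construction.\<close>

lemma bil_cauchy_schwarz:
  assumes "sym_mat M" and psd: "\<And>z. supp_on S z \<Longrightarrow> 0 \<le> quadform M z"
    and x: "supp_on S x" and y: "supp_on S y"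
  shows "(bil M x y)\<^sup>2 \<le> quadform M x * quadform M y"
proof -
  have *: "0 \<le> quadform M x + 2 * t * bil M x y + t\<^sup>2 * quadform M y" for t
  proof -
    have "0 \<le> quadform M (\<lambda>i. x i + t * y i)"
      by (intro psd supp_on_add x y)
    then show ?thesis
      using quadform_add[OF assms(1), of x "\<lambda>i. t * y i"]
      by (simp add: bil_scale_right quadform_scale mult.assoc)
  qed
  let ?a = "quadform M x" and ?b = "bil M x y" and ?c = "quadform M y"
  have "0 \<le> ?c" by (rule psd[OF y])
  show ?thesis
  proof (cases "?c = 0")
    case True
    have "?b = 0"
    proof (rule ccontr)
      assume "?b \<noteq> 0"
      \<comment> \<open>Without its square term the polynomial is affine in \<open>t\<close>; at
        this point it equals -1.\<close>
      then show False using *[of "- (?a + 1) / (2 * ?b)"] True by (simp add: field_simps)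
    qed
    with True show ?thesis by simp
  next
    case False
    then have "?c > 0" using \<open>0 \<le> ?c\<close> by simp
    have "0 \<le> ?a - ?b\<^sup>2 / ?c"
      using *[of "- ?b / ?c"] \<open>?c > 0\<close> by (simp add: field_simps power2_eq_square)
    then show ?thesis using \<open>?c > 0\<close> by (simp add: field_simps)
  qed
qed

text \<open>The \<open>S\<close>-block is completed by the identity off \<open>S\<close> to an
  endomorphism of the whole space. Definiteness makes it injective, hence surjective by dimension.
  In later uses \<open>a\<close> stands for the inverse of the block applied to
  \<open>w\<close>.\<close>

lemma pd_on_solve:
  assumes "pd_on S M"
  shows "\<exists>a. supp_on S a \<and> (\<forall>i\<in>S. (\<Sum>j\<in>UNIV. M i j * a j) = w i)"
proof -
  define f :: "real^'a \<Rightarrow> real^'a" where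
    "f z = (\<chi> i. if i \<in> S then \<Sum>j\<in>UNIV. M i j * coord_proj S (vec_nth z) j else z $ i)" for z
  have lin: "linear f"
    by (rule linearI)
      (auto simp: f_def vec_eq_iff coord_proj_def sum.distrib[symmetric] sum_distrib_left algebra_simps
        intro!: sum.cong)
  have "z = 0" if "f z = 0" for z
  proof -
    have off: "z $ i = 0" if "i \<notin> S" for i
      using arg_cong[OF \<open>f z = 0\<close>, of "\<lambda>v. v $ i"] that by (simp add: f_def)
    have "quadform M (coord_proj S (vec_nth z)) = bil M (coord_proj S (vec_nth z)) (\<lambda>_. 0)"
      unfolding quadform_bil
    proof (rule bil_cong_rows[OF supp_on_coord_proj])
      fix i assume "i \<in> S"
      then show "(\<Sum>j\<in>UNIV. M i j * coord_proj S (vec_nth z) j) = (\<Sum>j\<in>UNIV. M i j * 0)"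
        using arg_cong[OF \<open>f z = 0\<close>, of "\<lambda>v. v $ i"] by (simp add: f_def)
    qed
    then have "quadform M (coord_proj S (vec_nth z)) = 0" by (simp add: bil_def)
    then have "coord_proj S (vec_nth z) i = 0" for i
      using assms supp_on_coord_proj[of S "vec_nth z"] unfolding pd_on_def by (metis less_irrefl)
    then show ?thesis using off by (auto simp: vec_eq_iff coord_proj_def) metis
  qed
  then have "inj f" using lin linear_injective_0 by blast
  then have "surj f" using lin linear_injective_imp_surjective by blast
  then obtain z where z: "f z = (\<chi> i. if i \<in> S then w i else 0)" by (metis surjD)
  have "(\<Sum>j\<in>UNIV. M i j * coord_proj S (vec_nth z) j) = w i" if "i \<in> S" for i
    using arg_cong[OF z, of "\<lambda>v. v $ i"] that by (simp add: f_def)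
  then show ?thesis using supp_on_coord_proj by blast
qed

text \<open>A minimiser exists on the compact set of unit vectors supported on \<open>S\<close>, and
  homogeneity extends the bound to all vectors supported there. The minimum is the least eigenvalue
  of \<open>M\<close> relative to \<open>N\<close>; with \<open>N\<close> the identity it gives
  coercivity, with \<open>N = D\<close> the rate.\<close>

lemma min_ratio_exists:
  assumes N: "pd_on S N" and "S \<noteq> {}"
  shows "\<exists>x. supp_on S x \<and> (\<exists>i. x i \<noteq> 0) \<and>
           (\<forall>z. supp_on S z \<longrightarrow> quadform M x / quadform N x * quadform N z \<le> quadform M z)"
proof -
  define K where "K = {z :: real^'a. norm z = 1 \<and> (\<forall>i\<in>-S. z $ i = 0)}"
  have "K = sphere 0 1 \<inter> (\<Inter>i\<in>-S. {z. z $ i = 0})" by (auto simp: K_def)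
  moreover have "closed (\<Inter>i\<in>-S. {z :: real^'a. z $ i = 0})"
    by (intro closed_INT ballI closed_Collect_eq continuous_intros)
  ultimately have "compact K" using compact_Int_closed[OF compact_sphere] by simp
  obtain s where "s \<in> S" using assms by auto
  then have "axis s 1 \<in> K" by (auto simp: K_def) (auto simp: axis_def)
  then have "K \<noteq> {}" by auto
  have pos: "quadform N (vec_nth z) > 0" if "z \<in> K" for z
  proof -
    have "z \<noteq> 0" using that by (auto simp: K_def)
    then have "\<exists>i. z $ i \<noteq> 0" by (auto simp: vec_eq_iff)
    then show ?thesis using N that by (auto simp: pd_on_def supp_on_def K_def)
  qed
  have cont: "continuous_on K (\<lambda>z. quadform M' (vec_nth z))" for M'
    unfolding quadform_def by (intro continuous_intros)
  have "continuous_on K (\<lambda>z. quadform M (vec_nth z) / quadform N (vec_nth z))"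
    using pos by (intro continuous_on_divide cont) force
  then obtain x where x: "x \<in> K" and xmin: "\<And>z. z \<in> K \<Longrightarrow>
      quadform M (vec_nth x) / quadform N (vec_nth x) \<le> quadform M (vec_nth z) / quadform N (vec_nth z)"
    using continuous_attains_inf[OF \<open>compact K\<close> \<open>K \<noteq> {}\<close>] by blast
  let ?r = "quadform M (vec_nth x) / quadform N (vec_nth x)"
  have "?r * quadform N z \<le> quadform M z" if z: "supp_on S z" for z
  proof (cases "\<exists>i. z i \<noteq> 0")
    case False
    then show ?thesis by (simp add: quadform_eq_0)
  next
    case True
    define n where "n = norm (\<chi> i. z i)"
    have "(\<chi> i. z i) \<noteq> 0" using True by (auto simp: vec_eq_iff)
    then have "n > 0" by (simp add: n_def)
    define y :: "real^'a" where "y = (1 / n) *\<^sub>R (\<chi> i. z i)"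
    have "y \<in> K" using z \<open>n > 0\<close> by (auto simp: K_def y_def n_def supp_on_def)
    have "?r * quadform N (vec_nth y) \<le> quadform M (vec_nth y)"
      using xmin[OF \<open>y \<in> K\<close>] pos[OF \<open>y \<in> K\<close>] by (simp add: pos_le_divide_eq)
    moreover have "vec_nth y = (\<lambda>i. (1 / n) * z i)" by (auto simp: y_def)
    ultimately have "?r * ((1 / n)\<^sup>2 * quadform N z) \<le> (1 / n)\<^sup>2 * quadform M z"
      by (simp only: quadform_scale)
    then have "(1 / n)\<^sup>2 * (?r * quadform N z) \<le> (1 / n)\<^sup>2 * quadform M z"
      by (simp only: mult.left_commute)
    then show ?thesis using \<open>n > 0\<close> by (subst (asm) mult_le_cancel_left_pos) simp_all
  qed
  moreover have "supp_on S (vec_nth x)" "\<exists>i. x $ i \<noteq> 0"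
    using x by (auto simp: K_def supp_on_def vec_eq_iff intro: ccontr) (metis norm_zero vec_eq_iff zero_index zero_neq_one)
  ultimately show ?thesis by blast
qed

definition id_mat :: "'n \<Rightarrow> 'n \<Rightarrow> real" where
  "id_mat i j = (if i = j then 1 else 0)"

lemma quadform_id_mat: "quadform id_mat x = (\<Sum>i\<in>UNIV. (x i)\<^sup>2)"
  by (simp add: quadform_def id_mat_def if_distrib if_distribR sum.delta power2_eq_square cong: if_cong)

text \<open>The constant is the minimum of the form on unit vectors supported on \<open>S\<close>;
  for empty \<open>S\<close> there are none and any positive constant serves.\<close>

lemma pd_on_coercive:
  assumes "pd_on S M"
  obtains c where "c > 0" "\<And>z. supp_on S z \<Longrightarrow> c * (\<Sum>i\<in>UNIV. (z i)\<^sup>2) \<le> quadform M z"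
proof (cases "S = {}")
  case True
  then have "1 * (\<Sum>i\<in>UNIV. (z i)\<^sup>2) \<le> quadform M z" if "supp_on S z" for z :: "'a \<Rightarrow> real"
    using that by (simp add: supp_on_def quadform_eq_0)
  then show ?thesis using that[of 1] by auto
next
  case False
  have id: "pd_on S id_mat"
    unfolding pd_on_def sym_mat_def quadform_id_mat
    by (auto simp: id_mat_def intro!: sum_pos2)
  obtain x where x: "supp_on S x" "\<exists>i. x i \<noteq> 0"
    "\<And>z. supp_on S z \<Longrightarrow> quadform M x / quadform id_mat x * quadform id_mat z \<le> quadform M z"
    using min_ratio_exists[OF id False, of M] by blast
  have "quadform M x / quadform id_mat x > 0"
    using x(1,2) assms id by (auto simp: pd_on_def)
  then show ?thesis using that x(3) unfolding quadform_id_mat by blast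
qed

section \<open>Gaussian integrals on product Lebesgue measure\<close>

interpretation lb: product_sigma_finite "\<lambda>_. lborel :: real measure"
  by standard

lemma space_LB: "space (LB S) = PiE S (\<lambda>_. UNIV)"
  by (simp add: LB_def space_PiM)

lemma measurable_LB_component: "i \<in> S \<Longrightarrow> (\<lambda>x. x i) \<in> borel_measurable (LB S)"
  unfolding LB_def using measurable_component_singleton[of i S "\<lambda>_. lborel"] by simp

lemma measurable_LB_restrict: "S \<subseteq> S' \<Longrightarrow> (\<lambda>x. restrict x S) \<in> measurable (LB S') (LB S)"
  unfolding LB_def by (rule measurable_restrict_subset)

lemma measurable_LB_intro:
  assumes "\<And>i. i \<in> S \<Longrightarrow> (\<lambda>x. f x i) \<in> borel_measurable M" "\<And>x. x \<in> space M \<Longrightarrow> f x \<in> extensional S"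
  shows "f \<in> measurable M (LB S)"
  unfolding LB_def using assms by (intro measurable_PiM_single') (auto simp: PiE_def)

lemma emeasure_space_LB: "finite S \<Longrightarrow> emeasure (LB S) (space (LB S)) \<noteq> 0"
  unfolding LB_def space_PiM by (subst lb.emeasure_PiM) auto

text \<open>A product measure is determined by its values on boxes, where the claim reduces to
  translation invariance on the line.\<close>

lemma distr_LB_translate:
  fixes a :: "'n \<Rightarrow> real"
  assumes "finite S"
  shows "distr (LB S) (LB S) (\<lambda>x. \<lambda>i\<in>S. a i + x i) = LB S"
proof -
  have m[measurable]: "(\<lambda>x. \<lambda>i\<in>S. a i + x i) \<in> measurable (LB S) (LB S)"
    by (rule measurable_LB_intro) (auto intro!: borel_measurable_add measurable_LB_component)
  have "distr (LB S) (LB S) (\<lambda>x. \<lambda>i\<in>S. a i + x i) = PiM S (\<lambda>_. lborel)"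
  proof (rule lb.PiM_eqI[OF assms])
    fix A :: "'n \<Rightarrow> real set" assume A: "\<And>i. i \<in> S \<Longrightarrow> A i \<in> sets lborel"
    have "(\<lambda>x. \<lambda>i\<in>S. a i + x i) -` PiE S A \<inter> space (LB S) = PiE S (\<lambda>i. (\<lambda>y. a i + y) -` A i)"
      by (auto simp: space_LB PiE_def extensional_def Pi_iff)
    moreover have "PiE S A \<in> sets (LB S)"
      unfolding LB_def using A assms by (intro sets_PiM_I_finite) auto
    ultimately have "emeasure (distr (LB S) (LB S) (\<lambda>x. \<lambda>i\<in>S. a i + x i)) (PiE S A)
        = emeasure (LB S) (PiE S (\<lambda>i. (\<lambda>y. a i + y) -` A i))"
      by (simp add: emeasure_distr)
    also have "\<dots> = (\<Prod>i\<in>S. emeasure lborel ((\<lambda>y. a i + y) -` A i))"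
      unfolding LB_def
      by (rule lb.emeasure_PiM) (use assms A in \<open>auto intro!: measurable_sets_borel[of _ borel]\<close>)
    also have "\<dots> = (\<Prod>i\<in>S. emeasure lborel (A i))"
    proof (rule prod.cong[OF refl])
      fix i assume "i \<in> S"
      then show "emeasure lborel ((\<lambda>y. a i + y) -` A i) = emeasure lborel (A i)"
        using A[of i] by (subst (2) lborel_distr_plus[of "a i", symmetric]) (simp add: emeasure_distr)
    qed
    finally show "emeasure (distr (LB S) (LB S) (\<lambda>x. \<lambda>i\<in>S. a i + x i)) (PiE S A)
        = (\<Prod>i\<in>S. emeasure lborel (A i))" .
  qed (simp add: LB_def)
  then show ?thesis by (simp add: LB_def)
qed

lemma LB_translate:
  fixes f :: "('n \<Rightarrow> real) \<Rightarrow> real"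
  assumes "finite S" "f \<in> borel_measurable (LB S)"
  shows integral_LB_translate: "(\<integral>x. f (\<lambda>i\<in>S. a i + x i) \<partial>LB S) = (\<integral>x. f x \<partial>LB S)"
    and integrable_LB_translate: "integrable (LB S) (\<lambda>x. f (\<lambda>i\<in>S. a i + x i)) \<longleftrightarrow> integrable (LB S) f"
proof -
  have m[measurable]: "(\<lambda>x. \<lambda>i\<in>S. a i + x i) \<in> measurable (LB S) (LB S)"
    by (rule measurable_LB_intro) (auto intro!: borel_measurable_add measurable_LB_component)
  show "(\<integral>x. f (\<lambda>i\<in>S. a i + x i) \<partial>LB S) = (\<integral>x. f x \<partial>LB S)"
    using integral_distr[OF m assms(2)] distr_LB_translate[OF assms(1), of a] by simp
  show "integrable (LB S) (\<lambda>x. f (\<lambda>i\<in>S. a i + x i)) \<longleftrightarrow> integrable (LB S) f"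
    using integrable_distr_eq[OF m assms(2)] distr_LB_translate[OF assms(1), of a] by simp
qed

text \<open>The quadratic form of \<open>x - m\<close> restricted to the coordinates in \<open>S\<close>; elements of
  \<open>space (LB S)\<close> are \<open>undefined\<close> outside \<open>S\<close>, hence the projection.\<close>
definition cquad :: "('n::finite \<Rightarrow> 'n \<Rightarrow> real) \<Rightarrow> 'n set \<Rightarrow> ('n \<Rightarrow> real) \<Rightarrow> ('n \<Rightarrow> real) \<Rightarrow> real" where
  "cquad M S m x = quadform M (coord_proj S (\<lambda>i. x i - m i))"

definition gker :: "('n::finite \<Rightarrow> 'n \<Rightarrow> real) \<Rightarrow> 'n set \<Rightarrow> ('n \<Rightarrow> real) \<Rightarrow> ('n \<Rightarrow> real) \<Rightarrow> real" where
  "gker M S m x = exp (- cquad M S m x / 2)"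

lemma gker_pos: "gker M S m x > 0" by (simp add: gker_def)

lemma cquad_cong: "(\<And>i. i \<in> S \<Longrightarrow> x i - m i = y i - n i) \<Longrightarrow> cquad M S m x = cquad M S n y"
  unfolding cquad_def by (rule arg_cong[where f="quadform M"]) (auto simp: coord_proj_def)

lemma gker_cong: "(\<And>i. i \<in> S \<Longrightarrow> x i - m i = y i - n i) \<Longrightarrow> gker M S m x = gker M S n y"
  unfolding gker_def by (simp cong: cquad_cong)

lemma measurable_coord_proj:
  "S \<subseteq> S' \<Longrightarrow> (\<lambda>x. coord_proj S (\<lambda>i. x i - m i) j) \<in> borel_measurable (LB S')"
  by (cases "j \<in> S") (auto simp: coord_proj_def intro!: borel_measurable_diff measurable_LB_component)

lemma measurable_cquad: "S \<subseteq> S' \<Longrightarrow> cquad M S m \<in> borel_measurable (LB S')"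
  unfolding cquad_def[abs_def] quadform_def
  by (intro borel_measurable_sum borel_measurable_times borel_measurable_const measurable_coord_proj)

lemma measurable_gker: "S \<subseteq> S' \<Longrightarrow> gker M S m \<in> borel_measurable (LB S')"
  unfolding gker_def[abs_def] using measurable_cquad[of S S' M m] by measurable

section \<open>Integrability and normalising constants of Gaussian kernels\<close>

lemma integrable_exp_neg_square:
  assumes "c > 0"
  shows "integrable lborel (\<lambda>x::real. exp (- c * x\<^sup>2))"
proof -
  \<comment> \<open>With variance 1/(2c) the normal density is a multiple of the given
    exponential.\<close>
  define s where "s = sqrt (1 / (2 * c))"
  have "s > 0" using assms by (simp add: s_def)
  have s2: "s\<^sup>2 = 1 / (2 * c)" using assms by (simp add: s_def)
  have "integrable lborel (\<lambda>x. sqrt (2 * pi * s\<^sup>2) * normal_density 0 s x)"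
    using \<open>s > 0\<close> by (intro integrable_mult_right) simp
  moreover have "sqrt (2 * pi * s\<^sup>2) * normal_density 0 s x = exp (- c * x\<^sup>2)" for x
    using \<open>s > 0\<close> assms by (simp add: normal_density_def s2)
  ultimately show ?thesis by simp
qed

lemma integrable_exp_neg_sum_squares:
  assumes "c > 0" "finite S"
  shows "integrable (LB S) (\<lambda>x. exp (- c * (\<Sum>i\<in>S. (x i)\<^sup>2)))"
proof -
  have "integrable (PiM S (\<lambda>_. lborel)) (\<lambda>x. \<Prod>i\<in>S. exp (- c * (x i)\<^sup>2))"
    by (rule lb.product_integrable_prod[OF assms(2)]) (rule integrable_exp_neg_square[OF assms(1)])
  then show ?thesis using assms by (simp add: LB_def sum_distrib_left exp_sum flip: sum_negf)
qed

lemma coord_proj_sum_squares: "(\<Sum>i\<in>UNIV. (coord_proj S x i)\<^sup>2) = (\<Sum>i\<in>S. (x i)\<^sup>2)" for S :: "'n::finite set"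
  by (rule sum.mono_neutral_cong_right) (auto simp: coord_proj_def)

text \<open>Coercivity bounds the centred kernel by a product of one-dimensional Gaussian kernels;
  other centres follow by translation.\<close>

lemma integrable_gker:
  assumes "pd_on S M"
  shows "integrable (LB S) (gker M S m)"
proof -
  obtain c where c: "c > 0" "\<And>z. supp_on S z \<Longrightarrow> c * (\<Sum>i\<in>UNIV. (z i)\<^sup>2) \<le> quadform M z"
    using pd_on_coercive[OF assms] by blast
  have "integrable (LB S) (gker M S (\<lambda>_. 0))"
  proof (rule Bochner_Integration.integrable_bound)
    show "integrable (LB S) (\<lambda>x. exp (- (c / 2) * (\<Sum>i\<in>S. (x i)\<^sup>2)))"
      using c by (intro integrable_exp_neg_sum_squares) auto
    show "AE x in LB S. norm (gker M S (\<lambda>_. 0) x) \<le> norm (exp (- (c / 2) * (\<Sum>i\<in>S. (x i)\<^sup>2)))"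
    proof (rule AE_I2)
      fix x
      show "norm (gker M S (\<lambda>_. 0) x) \<le> norm (exp (- (c / 2) * (\<Sum>i\<in>S. (x i)\<^sup>2)))"
        using c(2)[of "coord_proj S x"] by (simp add: gker_def cquad_def coord_proj_sum_squares)
    qed
  qed (rule measurable_gker, simp)
  then have "integrable (LB S) (\<lambda>x. gker M S (\<lambda>_. 0) (\<lambda>i\<in>S. - m i + x i))"
    by (subst integrable_LB_translate) (auto intro: measurable_gker)
  moreover have "gker M S (\<lambda>_. 0) (\<lambda>i\<in>S. - m i + x i) = gker M S m x" for x
    by (rule gker_cong) auto
  ultimately show ?thesis by simp
qed

definition gZ :: "('n::finite \<Rightarrow> 'n \<Rightarrow> real) \<Rightarrow> 'n set \<Rightarrow> real" where
  "gZ M S = (\<integral>x. gker M S (\<lambda>_. 0) x \<partial>LB S)"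

lemma integral_gker: "(\<integral>x. gker M S m x \<partial>LB S) = gZ M S"
proof -
  have "gker M S (\<lambda>_. 0) (\<lambda>i\<in>S. - m i + x i) = gker M S m x" for x
    by (rule gker_cong) auto
  then show ?thesis
    using integral_LB_translate[of S "gker M S (\<lambda>_. 0)" "\<lambda>i. - m i"] by (simp add: gZ_def measurable_gker)
qed

text \<open>The kernel is strictly positive, so a vanishing integral would make the underlying
  measure null.\<close>

lemma gZ_pos: assumes "pd_on S M" shows "gZ M S > 0"
proof -
  have "gZ M S \<noteq> 0"
  proof
    assume "gZ M S = 0"
    then have "AE x in LB S. gker M S (\<lambda>_. 0) x = 0"
      using integral_nonneg_eq_0_iff_AE[OF integrable_gker[OF assms, of "\<lambda>_. 0"]]
      by (simp add: gZ_def gker_pos less_imp_le)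
    then have "AE x in LB S. False"
      by (rule AE_mp) (simp add: gker_pos less_imp_neq[THEN not_sym])
    then show False using emeasure_space_LB[of S] by (auto simp: AE_iff_measurable[OF _ refl])
  qed
  moreover have "gZ M S \<ge> 0" unfolding gZ_def by (simp add: gker_pos less_imp_le)
  ultimately show ?thesis by simp
qed

text \<open>Translating by \<open>t a\<close> and completing the square.\<close>
lemma gker_mgf:
  fixes m :: "'n::finite \<Rightarrow> real"
  assumes "pd_on S M" "supp_on S a"
  defines "Y \<equiv> \<lambda>x. bil M a (coord_proj S (\<lambda>i. x i - m i))"
  shows "has_bochner_integral (LB S) (\<lambda>x. exp (t * Y x) * gker M S m x) (exp (t\<^sup>2 * quadform M a / 2) * gZ M S)"
proof -
  have sym: "sym_mat M" using assms(1) by (rule pd_on_sym)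
  have eq: "exp (t * Y x) * gker M S m x = exp (t\<^sup>2 * quadform M a / 2) * gker M S (\<lambda>i. m i + t * a i) x" for x
  proof -
    have "coord_proj S (\<lambda>i. x i - (m i + t * a i)) = (\<lambda>i. coord_proj S (\<lambda>i. x i - m i) i - t * a i)"
      using assms(2) by (auto simp: coord_proj_def supp_on_def)
    then have "cquad M S (\<lambda>i. m i + t * a i) x = cquad M S m x - 2 * t * Y x + t\<^sup>2 * quadform M a"
      by (simp add: cquad_def Y_def quadform_diff[OF sym] quadform_scale bil_scale_right bil_commute[OF sym])
    then show ?thesis by (simp add: gker_def flip: exp_add) (simp add: field_simps)
  qed
  show ?thesis unfolding eq
    using integrable_gker[OF assms(1), of "\<lambda>i. m i + t * a i"] integral_gker[of S M "\<lambda>i. m i + t * a i"]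
    by (intro has_bochner_integral_mult_right) (simp add: has_bochner_integral_iff)
qed

section \<open>Moments from the moment generating function\<close>

lemma sinh_nat_mult_ge:
  fixes v :: real assumes "v \<ge> 0" shows "real n * sinh v \<le> sinh (real n * v)"
proof (induction n)
  case (Suc n)
  have "real n * sinh v * 1 \<le> sinh (real n * v) * cosh v"
    using Suc assms by (intro mult_mono) (auto simp: cosh_real_ge_1)
  moreover have "1 * sinh v \<le> cosh (real n * v) * sinh v"
    using assms by (intro mult_right_mono) (auto simp: cosh_real_ge_1)
  ultimately show ?case by (simp add: algebra_simps sinh_add)
qed simp

text \<open>Among the difference quotients of \<open>sinh\<close> at 0 with steps 1/n, step 1 is the
  worst. This supplies a dominating function independent of n when the moment generating function is
  differentiated under the integral.\<close>

lemma abs_mult_sinh_divide_le: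
  fixes w :: real assumes "n > 0" shows "\<bar>real n * sinh (w / real n)\<bar> \<le> \<bar>sinh w\<bar>"
proof -
  have *: "real n * sinh (v / real n) \<le> sinh v" if "v \<ge> 0" for v
    using sinh_nat_mult_ge[of "v / real n" n] that assms by simp
  show ?thesis
  proof (cases "w \<ge> 0")
    case True then show ?thesis using *[of w] by (simp add: abs_mult)
  next
    case False
    then have "sinh (w / real n) \<le> 0" "sinh w \<le> 0" using assms by (auto simp: divide_nonpos_nonneg)
    then show ?thesis using *[of "- w"] False by (simp add: abs_mult)
  qed
qed

lemma DERIV_0_tendsto_sequentially:
  fixes f :: "real \<Rightarrow> real"
  assumes "DERIV f 0 :> d" "f 0 = 0" "r \<longlonglongrightarrow> 0" "\<And>n. r n \<noteq> 0"
  shows "(\<lambda>n. f (w * r n) / r n) \<longlonglongrightarrow> d * w"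
proof -
  have "DERIV (\<lambda>h. f (w * h)) 0 :> d * w"
    using DERIV_chain2[of f d "\<lambda>h. w * h" 0 w] assms(1) by (auto intro!: derivative_eq_intros)
  then have lim: "((\<lambda>h. f (w * h) / h) \<longlongrightarrow> d * w) (at 0)"
    using assms(2) by (simp add: DERIV_def)
  have "filterlim r (at 0) sequentially"
    using assms(3,4) by (simp add: filterlim_at)
  then show ?thesis by (rule filterlim_compose[OF lim])
qed

text \<open>The moments are, up to the normalising constant, the first two derivatives at 0 of the
  function in \<open>gker_mgf\<close>. Symmetric differences turn into \<open>sinh\<close> and are
  all dominated by the integrable \<open>E 1 + E (-1)\<close>. The first ones integrate to 0 because
  the generating function is even in \<open>t\<close>.\<close>

lemma gker_moments:
  fixes m :: "'n::finite \<Rightarrow> real"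
  assumes "pd_on S M" "supp_on S a"
  defines "Y \<equiv> \<lambda>x. bil M a (coord_proj S (\<lambda>i. x i - m i))"
  shows "has_bochner_integral (LB S) (\<lambda>x. Y x * gker M S m x) 0"
    and "has_bochner_integral (LB S) (\<lambda>x. (Y x)\<^sup>2 * gker M S m x) (quadform M a * gZ M S)"
proof -
  let ?g = "gker M S m" and ?Z = "gZ M S" and ?v = "quadform M a"
  define E where "E t x = exp (t * Y x) * ?g x" for t x
  have mgf: "has_bochner_integral (LB S) (E t) (exp (t\<^sup>2 * ?v / 2) * ?Z)" for t
    unfolding E_def Y_def by (rule gker_mgf[OF assms(1,2)])
  have intE: "integrable (LB S) (E t)" and valE: "(\<integral>x. E t x \<partial>LB S) = exp (t\<^sup>2 * ?v / 2) * ?Z" for t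
    using mgf[of t] by (auto simp: has_bochner_integral_iff)
  have Ym[measurable]: "Y \<in> borel_measurable (LB S)"
    unfolding Y_def bil_def
    by (intro borel_measurable_sum borel_measurable_times borel_measurable_const measurable_coord_proj) simp
  have gm[measurable]: "?g \<in> borel_measurable (LB S)" by (rule measurable_gker) simp
  have g0: "?g x \<ge> 0" for x by (simp add: gker_pos less_imp_le)
  \<comment> \<open>Reciprocals of positive integers, the form in which
    \<open>abs_mult_sinh_divide_le\<close> bounds the quotients.\<close>
  define r where "r n = 1 / real (Suc n)" for n
  have r: "r \<longlonglongrightarrow> 0" "\<And>n. r n \<noteq> 0" "\<And>n. r n > 0"
    unfolding r_def by (rule LIMSEQ_Suc[OF lim_1_over_n]) auto
  have sinh_bound: "\<bar>sinh (w * r n) / r n\<bar> \<le> \<bar>sinh w\<bar>" for w n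
    using abs_mult_sinh_divide_le[of "Suc n" w] by (simp add: r_def mult.commute)
  have sinh_lim: "(\<lambda>n. sinh (w * r n) / r n) \<longlonglongrightarrow> w" for w
    using DERIV_0_tendsto_sequentially[of sinh 1 r w] r has_field_derivative_sinh[OF DERIV_ident, of "0::real"] by simp

  define s1 where "s1 n x = sinh (Y x * r n) / r n * ?g x" for n x
  have s1_eq: "s1 n x = (E (r n) x - E (- r n) x) / (2 * r n)" for n x
    by (simp add: s1_def E_def sinh_field_def field_simps)
  have s1_lim: "AE x in LB S. (\<lambda>n. s1 n x) \<longlonglongrightarrow> Y x * ?g x"
    unfolding s1_def by (intro AE_I2 tendsto_mult sinh_lim tendsto_const)
  have s1_bd: "AE x in LB S. norm (s1 n x) \<le> E 1 x + E (-1) x" for n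
  proof (rule AE_I2)
    fix x
    have "norm (s1 n x) \<le> \<bar>sinh (Y x)\<bar> * ?g x"
      unfolding s1_def real_norm_def abs_mult[of _ "?g x"] abs_of_nonneg[OF g0]
      by (intro mult_right_mono sinh_bound g0)
    also have "\<bar>sinh (Y x)\<bar> \<le> exp (Y x) + exp (- Y x)"
      using exp_gt_zero[of "Y x"] exp_gt_zero[of "- Y x"]
      unfolding sinh_field_def by (simp only: abs_le_iff) (auto simp: field_simps simp del: exp_gt_zero)
    finally show "norm (s1 n x) \<le> E 1 x + E (-1) x"
      using g0 by (simp add: E_def algebra_simps mult_right_mono)
  qed
  have s1_m: "s1 n \<in> borel_measurable (LB S)" for n unfolding s1_def sinh_field_def by measurable
  have w_int: "integrable (LB S) (\<lambda>x. E 1 x + E (-1) x)" by (intro Bochner_Integration.integrable_add intE)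
  have "(\<lambda>n. integral\<^sup>L (LB S) (s1 n)) \<longlonglongrightarrow> (\<integral>x. Y x * ?g x \<partial>LB S)"
    by (rule integral_dominated_convergence[OF _ s1_m w_int s1_lim s1_bd]) simp
  moreover have "integral\<^sup>L (LB S) (s1 n) = 0" for n
    unfolding s1_eq using intE by (simp add: valE)
  ultimately have "(\<integral>x. Y x * ?g x \<partial>LB S) = 0" by (simp add: LIMSEQ_const_iff)
  moreover have "integrable (LB S) (\<lambda>x. Y x * ?g x)"
    by (rule integrable_dominated_convergence[OF _ s1_m w_int s1_lim s1_bd]) simp
  ultimately show "has_bochner_integral (LB S) (\<lambda>x. Y x * ?g x) 0"
    by (simp add: has_bochner_integral_iff)

  \<comment> \<open>The second symmetric difference is the square of a first one at half the
    argument. This gives its sign and lets the same \<open>sinh\<close> bound apply.\<close>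
  define s2 where "s2 n x = (2 * (sinh (Y x / 2 * r n) / r n))\<^sup>2 * ?g x" for n x
  have sinh_sq: "(2 * sinh (w / 2))\<^sup>2 = exp w + exp (- w) - 2" for w :: real
  proof -
    have "exp w = (exp (w / 2))\<^sup>2" "exp (- w) = (exp (- (w / 2)))\<^sup>2" "exp (w / 2) * exp (- (w / 2)) = 1"
      by (simp_all flip: exp_double exp_add)
    then show ?thesis by (simp add: sinh_field_def power2_eq_square algebra_simps diff_divide_distrib add_divide_distrib)
  qed
  have s2_eq: "s2 n x = (E (r n) x + E (- r n) x - 2 * E 0 x) / (r n)\<^sup>2" for n x
  proof -
    have "(2 * (sinh (Y x / 2 * r n) / r n))\<^sup>2 = (2 * sinh ((r n * Y x) / 2))\<^sup>2 / (r n)\<^sup>2"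
      by (simp add: power_divide mult.commute)
    also have "\<dots> = (exp (r n * Y x) + exp (- (r n * Y x)) - 2) / (r n)\<^sup>2"
      by (simp only: sinh_sq)
    finally show ?thesis unfolding s2_def E_def by (simp add: algebra_simps)
  qed
  have s2_lim: "AE x in LB S. (\<lambda>n. s2 n x) \<longlonglongrightarrow> (Y x)\<^sup>2 * ?g x"
  proof (rule AE_I2)
    fix x
    have "(\<lambda>n. s2 n x) \<longlonglongrightarrow> (2 * (Y x / 2))\<^sup>2 * ?g x"
      unfolding s2_def by (intro tendsto_intros sinh_lim)
    then show "(\<lambda>n. s2 n x) \<longlonglongrightarrow> (Y x)\<^sup>2 * ?g x" by simp
  qed
  have s2_bd: "AE x in LB S. norm (s2 n x) \<le> E 1 x + E (-1) x" for n
  proof (rule AE_I2)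
    fix x
    have "(2 * (sinh (Y x / 2 * r n) / r n))\<^sup>2 \<le> (2 * sinh (Y x / 2))\<^sup>2"
      using sinh_bound[of "Y x / 2" n] unfolding power_mult_distrib abs_le_square_iff by simp
    also have "\<dots> \<le> exp (Y x) + exp (- Y x)" unfolding sinh_sq by simp
    finally have "s2 n x \<le> (exp (Y x) + exp (- Y x)) * ?g x"
      unfolding s2_def by (rule mult_right_mono) (rule g0)
    moreover have "0 \<le> s2 n x" using g0 by (simp add: s2_def)
    ultimately show "norm (s2 n x) \<le> E 1 x + E (-1) x" by (simp add: E_def algebra_simps)
  qed
  have s2_m: "s2 n \<in> borel_measurable (LB S)" for n unfolding s2_def sinh_field_def by measurable
  have "(\<lambda>n. integral\<^sup>L (LB S) (s2 n)) \<longlonglongrightarrow> (\<integral>x. (Y x)\<^sup>2 * ?g x \<partial>LB S)"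
    by (rule integral_dominated_convergence[OF _ s2_m w_int s2_lim s2_bd]) simp
  moreover have "integral\<^sup>L (LB S) (s2 n) = 2 * ((exp (?v / 2 * (r n)\<^sup>2) - 1) / (r n)\<^sup>2) * ?Z" for n
    unfolding s2_eq using intE valE[of 0] by (simp add: valE field_simps)
  moreover have "(\<lambda>n. 2 * ((exp (?v / 2 * (r n)\<^sup>2) - 1) / (r n)\<^sup>2) * ?Z) \<longlonglongrightarrow> 2 * (1 * (?v / 2)) * ?Z"
  proof (intro tendsto_mult tendsto_const)
    show "(\<lambda>n. (exp (?v / 2 * (r n)\<^sup>2) - 1) / (r n)\<^sup>2) \<longlonglongrightarrow> 1 * (?v / 2)"
    proof (rule DERIV_0_tendsto_sequentially[of "\<lambda>h. exp h - 1" 1 "\<lambda>n. (r n)\<^sup>2"])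
      show "((\<lambda>h::real. exp h - 1) has_real_derivative 1) (at 0)" by (auto intro!: derivative_eq_intros)
      show "(\<lambda>n. (r n)\<^sup>2) \<longlonglongrightarrow> 0" using tendsto_power[OF r(1), of 2] by simp
    qed (use r in auto)
  qed
  ultimately have "(\<integral>x. (Y x)\<^sup>2 * ?g x \<partial>LB S) = ?v * ?Z"
    by (simp add: LIMSEQ_unique)
  moreover have "integrable (LB S) (\<lambda>x. (Y x)\<^sup>2 * ?g x)"
    by (rule integrable_dominated_convergence[OF _ s2_m w_int s2_lim s2_bd]) simp
  ultimately show "has_bochner_integral (LB S) (\<lambda>x. (Y x)\<^sup>2 * ?g x) (?v * ?Z)"
    by (simp add: has_bochner_integral_iff)
qed

section \<open>Gaussian densities on the whole space\<close>

lemma gauss_eq_gker: "gauss Q mu x = gker Q UNIV mu x / gZ Q UNIV"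
  using integral_gker[of UNIV Q mu] by (simp add: gauss_def gker_def cquad_def coord_proj_def)

lemma pos_def_mat_pd_on: "pos_def_mat Q \<longleftrightarrow> pd_on UNIV Q"
  by (auto simp: pos_def_mat_def pd_on_def sym_mat_def supp_on_def)

text \<open>Here \<open>a\<close> is the inverse of \<open>M\<close> applied to \<open>v\<close>, so
  \<open>quadform M a\<close> is the familiar v^t M^-1 v. The linear function is \<open>Y\<close>
  plus the constant \<open>b\<close>, and the moments of \<open>Y\<close> are known.\<close>

lemma gauss_variance:
  assumes "pd_on UNIV M" and a: "\<And>i. (\<Sum>j\<in>UNIV. M i j * a j) = v i"
  shows "dvar (gauss M mu) (\<lambda>\<theta>. \<Sum>i\<in>UNIV. \<theta> i * v i) = quadform M a"
proof -
  let ?Z = "gZ M UNIV" and ?g = "gker M UNIV mu"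
  have Z: "?Z > 0" by (rule gZ_pos[OF assms(1)])
  define Y where "Y x = bil M a (coord_proj UNIV (\<lambda>i. x i - mu i))" for x
  define b where "b = (\<Sum>i\<in>UNIV. mu i * v i)"
  have Y: "Y x = (\<Sum>i\<in>UNIV. x i * v i) - b" for x
  proof -
    have "Y x = bil M (\<lambda>i. x i - mu i) a"
      unfolding Y_def by (subst bil_commute[OF pd_on_sym[OF assms(1)]]) (simp add: coord_proj_def)
    also have "\<dots> = (\<Sum>i\<in>UNIV. (x i - mu i) * v i)" by (simp add: bil_rows a)
    finally show ?thesis by (simp add: b_def algebra_simps sum_subtractf)
  qed
  have supp: "supp_on UNIV a" by (simp add: supp_on_def)
  have 1: "has_bochner_integral Lp (\<lambda>x. Y x * ?g x) 0"
    and 2: "has_bochner_integral Lp (\<lambda>x. (Y x)\<^sup>2 * ?g x) (quadform M a * ?Z)"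
    using gker_moments[OF assms(1) supp, of mu] by (simp_all add: Y_def)
  have 0: "has_bochner_integral Lp ?g ?Z"
    using integrable_gker[OF assms(1), of mu] integral_gker[of UNIV M mu] by (simp add: has_bochner_integral_iff)
  have "has_bochner_integral Lp (\<lambda>x. (Y x * ?g x + b * ?g x) / ?Z) ((0 + b * ?Z) / ?Z)"
    using Z by (intro has_bochner_integral_divide has_bochner_integral_add has_bochner_integral_mult_right 0 1)
  moreover have "(Y x * ?g x + b * ?g x) / ?Z = gauss M mu x * (\<Sum>i\<in>UNIV. x i * v i)" for x
    by (simp add: Y gauss_eq_gker algebra_simps)
  ultimately have m1: "(\<integral>x. gauss M mu x * (\<Sum>i\<in>UNIV. x i * v i) \<partial>Lp) = b"
    using Z by (simp add: has_bochner_integral_iff)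
  have "has_bochner_integral Lp (\<lambda>x. ((Y x)\<^sup>2 * ?g x + (2 * b) * (Y x * ?g x) + b\<^sup>2 * ?g x) / ?Z)
      ((quadform M a * ?Z + (2 * b) * 0 + b\<^sup>2 * ?Z) / ?Z)"
    using Z by (intro has_bochner_integral_divide has_bochner_integral_add has_bochner_integral_mult_right 0 1 2)
  moreover have "((Y x)\<^sup>2 * ?g x + (2 * b) * (Y x * ?g x) + b\<^sup>2 * ?g x) / ?Z
      = gauss M mu x * (\<Sum>i\<in>UNIV. x i * v i)\<^sup>2" for x
    by (simp add: Y gauss_eq_gker power2_eq_square algebra_simps add_divide_distrib)
  ultimately have m2: "(\<integral>x. gauss M mu x * (\<Sum>i\<in>UNIV. x i * v i)\<^sup>2 \<partial>Lp) = quadform M a + b\<^sup>2"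
    using Z by (simp add: has_bochner_integral_iff add_divide_distrib)
  show ?thesis unfolding dvar_def m1 m2 by simp
qed

section \<open>Block factorised densities\<close>

lemma blockset_insert: "blockset blk (insert k A) = blk1 blk k \<union> blockset blk A"
  by (auto simp: blockset_def)

lemma blk1_disjoint_blockset: "k \<notin> A \<Longrightarrow> blk1 blk k \<inter> blockset blk A = {}"
  by (auto simp: blockset_def)

lemma blk1_subset_blockset: "k \<in> A \<Longrightarrow> blk1 blk k \<subseteq> blockset blk A"
  by (auto simp: blockset_def)

lemma restrict_space_LB: "x \<in> space (LB S) \<Longrightarrow> restrict x S = x"
  by (auto simp: space_LB)

lemma measurable_LB_block:
  "k \<in> A \<Longrightarrow> f \<in> measurable (LB (blk1 blk k)) N \<Longrightarrow>
    (\<lambda>\<theta>. f (restrict \<theta> (blk1 blk k))) \<in> measurable (LB (blockset blk A)) N"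
  using measurable_compose[OF measurable_LB_restrict[OF blk1_subset_blockset, of k A blk], of f N] by blast

lemma restrict_merge_block:
  assumes "k \<notin> A" "j \<in> A"
  shows "restrict (merge (blk1 blk k) (blockset blk A) (x, y)) (blk1 blk j) = restrict y (blk1 blk j)"
  using assms by (auto simp: blockset_def merge_def restrict_def fun_eq_iff)

text \<open>Tonelli peels block \<open>k\<close> off the remaining coordinates, and restriction to a
  block sees only its own part of the merged point.\<close>

lemma nn_integral_block_prod:
  fixes blk :: "'n::finite \<Rightarrow> nat" and f :: "nat \<Rightarrow> ('n \<Rightarrow> real) \<Rightarrow> ennreal"
  assumes "finite A" "\<And>k. k \<in> A \<Longrightarrow> f k \<in> borel_measurable (LB (blk1 blk k))"
  shows "(\<integral>\<^sup>+\<theta>. (\<Prod>k\<in>A. f k (restrict \<theta> (blk1 blk k))) \<partial>LB (blockset blk A))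
      = (\<Prod>k\<in>A. \<integral>\<^sup>+x. f k x \<partial>LB (blk1 blk k))"
  using assms
proof (induction A)
  case empty
  then show ?case by (simp add: blockset_def LB_def PiM_empty)
next
  case (insert k A)
  let ?I = "blk1 blk k" and ?J = "blockset blk A"
  let ?p = "\<lambda>\<theta>. \<Prod>k\<in>A. f k (restrict \<theta> (blk1 blk k))"
  have meas: "(\<lambda>\<theta>. \<Prod>k\<in>insert k A. f k (restrict \<theta> (blk1 blk k))) \<in> borel_measurable (LB (?I \<union> ?J))"
    unfolding blockset_insert[symmetric]
  proof (rule borel_measurable_prod_ennreal)
    fix j assume "j \<in> insert k A"
    then show "(\<lambda>\<theta>. f j (restrict \<theta> (blk1 blk j))) \<in> borel_measurable (LB (blockset blk (insert k A)))"
      by (intro measurable_LB_block[of j "insert k A" "f j"] insert.prems)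
  qed
  have pm: "?p \<in> borel_measurable (LB ?J)"
  proof (rule borel_measurable_prod_ennreal)
    fix j assume "j \<in> A"
    then show "(\<lambda>\<theta>. f j (restrict \<theta> (blk1 blk j))) \<in> borel_measurable (LB (blockset blk A))"
      by (intro measurable_LB_block[of j A "f j"] insert.prems insertI2)
  qed
  have "(\<integral>\<^sup>+\<theta>. (\<Prod>k\<in>insert k A. f k (restrict \<theta> (blk1 blk k))) \<partial>LB (?I \<union> ?J))
     = (\<integral>\<^sup>+x. (\<integral>\<^sup>+y. (\<Prod>j\<in>insert k A. f j (restrict (merge ?I ?J (x, y)) (blk1 blk j))) \<partial>LB ?J) \<partial>LB ?I)"
    unfolding LB_def
    by (rule lb.product_nn_integral_fold) (use meas blk1_disjoint_blockset[OF insert.hyps(2), of blk] in \<open>auto simp: LB_def\<close>)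
  also have "\<dots> = (\<integral>\<^sup>+x. (\<integral>\<^sup>+y. f k x * ?p y \<partial>LB ?J) \<partial>LB ?I)"
  proof (intro nn_integral_cong)
    fix x y assume "x \<in> space (LB ?I)" "y \<in> space (LB ?J)"
    have "?p (merge ?I ?J (x, y)) = ?p y"
      using insert.hyps by (intro prod.cong refl) (simp add: restrict_merge_block)
    then show "(\<Prod>j\<in>insert k A. f j (restrict (merge ?I ?J (x, y)) (blk1 blk j))) = f k x * ?p y"
      using insert.hyps \<open>x \<in> space (LB ?I)\<close>
      by (simp add: blk1_disjoint_blockset restrict_space_LB)
  qed
  also have "\<dots> = (\<integral>\<^sup>+x. f k x * (\<integral>\<^sup>+y. ?p y \<partial>LB ?J) \<partial>LB ?I)"
    by (intro nn_integral_cong nn_integral_cmult pm)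
  also have "\<dots> = (\<integral>\<^sup>+x. f k x \<partial>LB ?I) * (\<integral>\<^sup>+y. ?p y \<partial>LB ?J)"
    using insert.prems by (intro nn_integral_multc) auto
  finally have step: "integral\<^sup>N (LB (?I \<union> ?J)) (\<lambda>\<theta>. \<Prod>j\<in>insert k A. f j (restrict \<theta> (blk1 blk j)))
      = (\<integral>\<^sup>+x. f k x \<partial>LB ?I) * (\<integral>\<^sup>+y. ?p y \<partial>LB ?J)" .
  have IH: "(\<integral>\<^sup>+y. ?p y \<partial>LB ?J) = (\<Prod>k\<in>A. \<integral>\<^sup>+x. f k x \<partial>LB (blk1 blk k))"
    by (rule insert.IH) (rule insert.prems, simp)
  show ?case
    unfolding blockset_insert[of blk k A] step IH
    by (rule prod.insert[OF insert.hyps, of "\<lambda>k. \<integral>\<^sup>+x. f k x \<partial>LB (blk1 blk k)", symmetric])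
qed

lemma integrable_block_prod:
  fixes blk :: "'n::finite \<Rightarrow> nat" and f :: "nat \<Rightarrow> ('n \<Rightarrow> real) \<Rightarrow> real"
  assumes "finite A" "\<And>k. k \<in> A \<Longrightarrow> integrable (LB (blk1 blk k)) (f k)"
  shows "integrable (LB (blockset blk A)) (\<lambda>\<theta>. \<Prod>k\<in>A. f k (restrict \<theta> (blk1 blk k)))"
proof (rule integrableI_bounded)
  show "(\<lambda>\<theta>. \<Prod>k\<in>A. f k (restrict \<theta> (blk1 blk k))) \<in> borel_measurable (LB (blockset blk A))"
  proof (rule borel_measurable_prod)
    fix k assume "k \<in> A"
    then show "(\<lambda>\<theta>. f k (restrict \<theta> (blk1 blk k))) \<in> borel_measurable (LB (blockset blk A))"
      using assms(2)[of k] by (intro measurable_LB_block[of k A "f k"]) auto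
  qed
  have "(\<integral>\<^sup>+\<theta>. norm (\<Prod>k\<in>A. f k (restrict \<theta> (blk1 blk k))) \<partial>LB (blockset blk A))
      = (\<integral>\<^sup>+\<theta>. (\<Prod>k\<in>A. ennreal (norm (f k (restrict \<theta> (blk1 blk k))))) \<partial>LB (blockset blk A))"
    by (simp add: abs_prod prod_ennreal)
  also have "\<dots> = (\<Prod>k\<in>A. \<integral>\<^sup>+x. ennreal (norm (f k x)) \<partial>LB (blk1 blk k))"
    using assms by (intro nn_integral_block_prod) auto
  also have "\<dots> < \<infinity>"
    using assms by (auto simp: less_top[symmetric] ennreal_prod_eq_top integrable_iff_bounded)
  finally show "(\<integral>\<^sup>+\<theta>. norm (\<Prod>k\<in>A. f k (restrict \<theta> (blk1 blk k))) \<partial>LB (blockset blk A)) < \<infinity>" .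
qed

lemma integral_block_prod:
  fixes blk :: "'n::finite \<Rightarrow> nat" and f :: "nat \<Rightarrow> ('n \<Rightarrow> real) \<Rightarrow> real"
  assumes "finite A" "\<And>k. k \<in> A \<Longrightarrow> integrable (LB (blk1 blk k)) (f k)"
  shows "(\<integral>\<theta>. (\<Prod>k\<in>A. f k (restrict \<theta> (blk1 blk k))) \<partial>LB (blockset blk A))
        = (\<Prod>k\<in>A. \<integral>x. f k x \<partial>LB (blk1 blk k))"
  using assms
proof (induction A)
  case empty
  interpret finite_measure "Pi\<^sub>M {} (\<lambda>_. lborel :: real measure)"
    by rule (simp add: space_PiM)
  show ?case by (simp add: blockset_def LB_def space_PiM measure_def)
next
  case (insert k A)
  let ?I = "blk1 blk k" and ?J = "blockset blk A"
  let ?p = "\<lambda>\<theta>. \<Prod>k\<in>A. f k (restrict \<theta> (blk1 blk k))"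
  let ?F = "\<lambda>\<theta>. \<Prod>j\<in>insert k A. f j (restrict \<theta> (blk1 blk j))"
  have int: "integrable (LB (?I \<union> ?J)) ?F"
    unfolding blockset_insert[symmetric]
    by (rule integrable_block_prod) (use insert.hyps insert.prems in auto)
  have "integral\<^sup>L (LB (?I \<union> ?J)) ?F = (\<integral>x. (\<integral>y. ?F (merge ?I ?J (x, y)) \<partial>LB ?J) \<partial>LB ?I)"
    unfolding LB_def
    by (rule lb.product_integral_fold[OF blk1_disjoint_blockset[OF insert.hyps(2)] finite finite int[unfolded LB_def]])
  also have "\<dots> = (\<integral>x. (\<integral>y. f k x * ?p y \<partial>LB ?J) \<partial>LB ?I)"
  proof (intro Bochner_Integration.integral_cong refl)
    fix x y assume "x \<in> space (LB ?I)" "y \<in> space (LB ?J)"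
    have "?p (merge ?I ?J (x, y)) = ?p y"
      using insert.hyps by (intro prod.cong refl) (simp add: restrict_merge_block)
    then show "?F (merge ?I ?J (x, y)) = f k x * ?p y"
      using insert.hyps \<open>x \<in> space (LB ?I)\<close>
      by (simp add: blk1_disjoint_blockset restrict_space_LB)
  qed
  also have "\<dots> = (\<integral>x. f k x \<partial>LB ?I) * (\<integral>y. ?p y \<partial>LB ?J)" by simp
  finally have step: "integral\<^sup>L (LB (?I \<union> ?J)) (\<lambda>\<theta>. \<Prod>j\<in>insert k A. f j (restrict \<theta> (blk1 blk j)))
      = (\<integral>x. f k x \<partial>LB ?I) * (\<integral>y. ?p y \<partial>LB ?J)" .
  have IH: "(\<integral>y. ?p y \<partial>LB ?J) = (\<Prod>k\<in>A. \<integral>x. f k x \<partial>LB (blk1 blk k))"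
    by (rule insert.IH) (rule insert.prems, simp)
  show ?case
    unfolding blockset_insert[of blk k A] step IH
    by (rule prod.insert[OF insert.hyps, of "\<lambda>k. \<integral>x. f k x \<partial>LB (blk1 blk k)", symmetric])
qed

text \<open>Hypothesis \<open>nn\<close> says that \<open>r\<close> pushes the density
  \<open>q\<close> forward to the density \<open>p\<close>; both claims are then changes of
  variables for signed integrands. The abstract form serves single blocks within a product as well
  as the marginal on \<open>B\<close> of a member of the family.\<close>

lemma
  fixes q :: "'a \<Rightarrow> real" and p h :: "'b \<Rightarrow> real"
  assumes r: "r \<in> measurable M N" and q: "q \<in> borel_measurable M" "\<And>x. x \<in> space M \<Longrightarrow> 0 \<le> q x"
    and p: "p \<in> borel_measurable N" "\<And>x. x \<in> space N \<Longrightarrow> 0 \<le> p x"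
    and nn: "\<And>F. F \<in> borel_measurable N \<Longrightarrow>
        (\<integral>\<^sup>+x. ennreal (q x) * F (r x) \<partial>M) = (\<integral>\<^sup>+y. ennreal (p y) * F y \<partial>N)"
    and h: "h \<in> borel_measurable N"
  shows marginal_integrable: "integrable M (\<lambda>x. q x * h (r x)) \<longleftrightarrow> integrable N (\<lambda>y. p y * h y)"
    and marginal_integral: "(\<integral>x. q x * h (r x) \<partial>M) = (\<integral>y. p y * h y \<partial>N)"
proof -
  have qae: "AE x in M. 0 \<le> q x" and pae: "AE x in N. 0 \<le> p x" using q p by auto
  have eq: "distr (density M (\<lambda>x. ennreal (q x))) N r = density N (\<lambda>x. ennreal (p x))"
  proof (rule measure_eqI)
    fix A assume "A \<in> sets (distr (density M (\<lambda>x. ennreal (q x))) N r)"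
    then have A: "A \<in> sets N" by simp
    have "emeasure (distr (density M (\<lambda>x. ennreal (q x))) N r) A
        = (\<integral>\<^sup>+x. ennreal (q x) * indicator (r -` A \<inter> space M) x \<partial>M)"
      using r q A by (subst emeasure_distr) (auto simp: emeasure_density measurable_sets)
    also have "\<dots> = (\<integral>\<^sup>+x. ennreal (q x) * indicator A (r x) \<partial>M)"
      by (intro nn_integral_cong) (auto split: split_indicator)
    also have "\<dots> = (\<integral>\<^sup>+y. ennreal (p y) * indicator A y \<partial>N)"
      using A by (intro nn) auto
    also have "\<dots> = emeasure (density N (\<lambda>x. ennreal (p x))) A"
      using p A by (simp add: emeasure_density)
    finally show "emeasure (distr (density M (\<lambda>x. ennreal (q x))) N r) A
        = emeasure (density N (\<lambda>x. ennreal (p x))) A" .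
  qed simp
  have r': "r \<in> measurable (density M (\<lambda>x. ennreal (q x))) N" using r by simp
  have hr: "(\<lambda>x. h (r x)) \<in> borel_measurable M" using h r by measurable
  show "integrable M (\<lambda>x. q x * h (r x)) \<longleftrightarrow> integrable N (\<lambda>y. p y * h y)"
    using integrable_distr_eq[OF r' h] integrable_density[OF hr q(1) qae] integrable_density[OF h p(1) pae]
    by (simp add: eq)
  show "(\<integral>x. q x * h (r x) \<partial>M) = (\<integral>y. p y * h y \<partial>N)"
    using integral_distr[OF r' h] integral_density[OF hr q(1) qae] integral_density[OF h p(1) pae]
    by (simp add: eq)
qed

section \<open>Marginals of products of block densities\<close>

lemma density_prodf:
  fixes blk :: "'n::finite \<Rightarrow> nat"
  assumes "finite A" "valid_factors blk A qf"
  shows measurable_prodf: "prodf blk A qf \<in> borel_measurable (LB (blockset blk A))"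
    and prodf_nonneg: "y \<in> space (LB (blockset blk A)) \<Longrightarrow> 0 \<le> prodf blk A qf y"
proof -
  show "prodf blk A qf \<in> borel_measurable (LB (blockset blk A))"
    unfolding prodf_def[abs_def]
  proof (rule borel_measurable_prod)
    fix k assume "k \<in> A"
    then show "(\<lambda>\<theta>. qf k (restrict \<theta> (blk1 blk k))) \<in> borel_measurable (LB (blockset blk A))"
      using assms(2) by (intro measurable_LB_block[of k A "qf k"]) (auto simp: valid_factors_def is_density_def)
  qed
  assume "y \<in> space (LB (blockset blk A))"
  then have "restrict y (blk1 blk k) \<in> space (LB (blk1 blk k))" if "k \<in> A" for k
    using measurable_space[OF measurable_LB_restrict[OF blk1_subset_blockset[OF that]]] by blast
  then show "0 \<le> prodf blk A qf y"
    unfolding prodf_def using assms by (intro prod_nonneg) (auto simp: valid_factors_def is_density_def)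
qed

lemma nn_integral_block_marginal:
  fixes blk :: "'n::finite \<Rightarrow> nat"
  assumes "finite A" "valid_factors blk A qf" "k \<in> A" "F \<in> borel_measurable (LB (blk1 blk k))"
  shows "(\<integral>\<^sup>+y. ennreal (prodf blk A qf y) * F (restrict y (blk1 blk k)) \<partial>LB (blockset blk A))
       = (\<integral>\<^sup>+x. ennreal (qf k x) * F x \<partial>LB (blk1 blk k))"
proof -
  \<comment> \<open>Only block \<open>k\<close> carries the test function; every other factor
    integrates to 1.\<close>
  let ?f = "\<lambda>j x. ennreal (qf j x) * (if j = k then F x else 1)"
  have dens: "qf j \<in> borel_measurable (LB (blk1 blk j))" "(\<integral>\<^sup>+x. ennreal (qf j x) \<partial>LB (blk1 blk j)) = 1"
      "\<And>x. x \<in> space (LB (blk1 blk j)) \<Longrightarrow> 0 \<le> qf j x" if "j \<in> A" for j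
    using assms that by (auto simp: valid_factors_def is_density_def)
  have "(\<integral>\<^sup>+y. ennreal (prodf blk A qf y) * F (restrict y (blk1 blk k)) \<partial>LB (blockset blk A))
      = (\<integral>\<^sup>+y. (\<Prod>j\<in>A. ?f j (restrict y (blk1 blk j))) \<partial>LB (blockset blk A))"
  proof (rule nn_integral_cong)
    fix y assume y: "y \<in> space (LB (blockset blk A))"
    have "restrict y (blk1 blk j) \<in> space (LB (blk1 blk j))" if "j \<in> A" for j
      using y measurable_space[OF measurable_LB_restrict[OF blk1_subset_blockset[OF that]]] by blast
    then have "ennreal (prodf blk A qf y) = (\<Prod>j\<in>A. ennreal (qf j (restrict y (blk1 blk j))))"
      unfolding prodf_def by (subst prod_ennreal) (auto simp: dens)
    then show "ennreal (prodf blk A qf y) * F (restrict y (blk1 blk k)) = (\<Prod>j\<in>A. ?f j (restrict y (blk1 blk j)))"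
      using assms by (simp add: prod.distrib)
  qed
  also have "\<dots> = (\<Prod>j\<in>A. \<integral>\<^sup>+x. ?f j x \<partial>LB (blk1 blk j))"
  proof (rule nn_integral_block_prod[OF assms(1)])
    fix j assume "j \<in> A"
    then show "?f j \<in> borel_measurable (LB (blk1 blk j))"
      using dens(1)[of j] assms(4) by (cases "j = k") auto
  qed
  also have "\<dots> = (\<Prod>j\<in>A. if j = k then \<integral>\<^sup>+x. ennreal (qf k x) * F x \<partial>LB (blk1 blk k) else 1)"
    using dens by (intro prod.cong) auto
  finally show ?thesis using assms by simp
qed

lemma
  fixes blk :: "'n::finite \<Rightarrow> nat" and h :: "('n \<Rightarrow> real) \<Rightarrow> real"
  assumes "finite A" "valid_factors blk A qf" "k \<in> A" "h \<in> borel_measurable (LB (blk1 blk k))"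
  shows block_marginal_integrable:
      "integrable (LB (blockset blk A)) (\<lambda>y. prodf blk A qf y * h (restrict y (blk1 blk k)))
        \<longleftrightarrow> integrable (LB (blk1 blk k)) (\<lambda>x. qf k x * h x)"
    and block_marginal_integral:
      "(\<integral>y. prodf blk A qf y * h (restrict y (blk1 blk k)) \<partial>LB (blockset blk A))
        = (\<integral>x. qf k x * h x \<partial>LB (blk1 blk k))"
proof -
  have q: "qf k \<in> borel_measurable (LB (blk1 blk k))" "\<And>x. x \<in> space (LB (blk1 blk k)) \<Longrightarrow> 0 \<le> qf k x"
    using assms by (auto simp: valid_factors_def is_density_def)
  note * = measurable_LB_restrict[OF blk1_subset_blockset[OF assms(3)]]
      measurable_prodf[OF assms(1,2)] prodf_nonneg[OF assms(1,2)] q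
      nn_integral_block_marginal[OF assms(1-3)] assms(4)
  show "integrable (LB (blockset blk A)) (\<lambda>y. prodf blk A qf y * h (restrict y (blk1 blk k)))
        \<longleftrightarrow> integrable (LB (blk1 blk k)) (\<lambda>x. qf k x * h x)"
    by (rule marginal_integrable[OF *])
  show "(\<integral>y. prodf blk A qf y * h (restrict y (blk1 blk k)) \<partial>LB (blockset blk A))
        = (\<integral>x. qf k x * h x \<partial>LB (blk1 blk k))"
    by (rule marginal_integral[OF *])
qed

section \<open>Members of the variational family\<close>

lemma prodf_cong: "(\<And>k. k \<in> U \<Longrightarrow> restrict x (blk1 blk k) = restrict y (blk1 blk k)) \<Longrightarrow>
    prodf blk U qf x = prodf blk U qf y"
  unfolding prodf_def by (rule prod.cong) simp_all

lemma prodf_merge: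
  "prodf blk U qf (merge (- blockset blk U) (blockset blk U) (x, y)) = prodf blk U qf y"
  by (rule prodf_cong) (auto simp: blockset_def merge_def restrict_def fun_eq_iff)

lemma prodf_restrict: "prodf blk U qf (restrict \<theta> (blockset blk U)) = prodf blk U qf \<theta>"
  by (rule prodf_cong) (auto simp: blockset_def restrict_def fun_eq_iff)

text \<open>The condition inside \<open>famQ\<close> with its witnesses exposed, so that conditional
  and factors can be named.\<close>

definition factorized :: "('n::finite \<Rightarrow> nat) \<Rightarrow> nat set \<Rightarrow> (('n \<Rightarrow> real) \<Rightarrow> real)
    \<Rightarrow> (nat \<Rightarrow> ('n \<Rightarrow> real) \<Rightarrow> real) \<Rightarrow> (('n \<Rightarrow> real) \<Rightarrow> real) \<Rightarrow> bool" where
  "factorized blk U g qf q \<longleftrightarrow> valid_factors blk U qf \<and> g \<in> borel_measurable Lp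
      \<and> (\<forall>y\<in>space (LB (blockset blk U)).
            is_density (LB (- blockset blk U)) (\<lambda>x. g (merge (- blockset blk U) (blockset blk U) (x, y))))
      \<and> (\<forall>\<theta>. q \<theta> = g \<theta> * prodf blk U qf \<theta>)"

lemma famQ_iff_factorized: "q \<in> famQ blk U \<longleftrightarrow> (\<exists>g qf. factorized blk U g qf q)"
  unfolding famQ_def factorized_def mem_Collect_eq by (rule refl)

text \<open>Integrating first over the coordinates off the blocks in \<open>U\<close> leaves 1,
  since \<open>g\<close> is a density there for every fixed \<open>y\<close>. So the marginal of
  \<open>q\<close> is \<open>prodf\<close>, whatever the conditional.\<close>

lemma
  fixes blk :: "'n::finite \<Rightarrow> nat"
  assumes "finite U" "factorized blk U g qf q"
  shows measurable_factorized: "q \<in> borel_measurable Lp"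
    and factorized_nonneg: "0 \<le> q \<theta>"
    and nn_integral_factorized: "F \<in> borel_measurable (LB (blockset blk U)) \<Longrightarrow>
        (\<integral>\<^sup>+\<theta>. ennreal (q \<theta>) * F (restrict \<theta> (blockset blk U)) \<partial>Lp)
         = (\<integral>\<^sup>+y. ennreal (prodf blk U qf y) * F y \<partial>LB (blockset blk U))"
proof -
  let ?B = "blockset blk U" and ?C = "- blockset blk U"
  note f = assms(2)[unfolded factorized_def]
  have qf: "valid_factors blk U qf" by (rule conjunct1[OF f])
  have g: "g \<in> borel_measurable Lp" by (rule conjunct1[OF conjunct2[OF f]])
  have gd: "is_density (LB ?C) (\<lambda>x. g (merge ?C ?B (x, y)))" if "y \<in> space (LB ?B)" for y
    by (rule bspec[OF conjunct1[OF conjunct2[OF conjunct2[OF f]]] that])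
  have q: "q \<theta> = g \<theta> * prodf blk U qf \<theta>" for \<theta>
    by (rule spec[OF conjunct2[OF conjunct2[OF conjunct2[OF f]]]])
  have rB: "(\<lambda>\<theta>. restrict \<theta> ?B) \<in> measurable Lp (LB ?B)" by (rule measurable_LB_restrict[OF subset_UNIV])
  have pm: "(\<lambda>\<theta>. prodf blk U qf \<theta>) \<in> borel_measurable Lp"
    using measurable_compose[OF rB measurable_prodf[OF assms(1) qf]] unfolding prodf_restrict .
  show qm: "q \<in> borel_measurable Lp"
    using borel_measurable_times[OF g pm] by (simp add: q[abs_def])
  have resB: "restrict \<theta> ?B \<in> space (LB ?B)" and resC: "restrict \<theta> ?C \<in> space (LB ?C)" for \<theta> :: "'n \<Rightarrow> real"
    by (auto simp: space_LB)
  have mrg: "merge ?C ?B (\<theta>, \<theta>) = \<theta>" for \<theta> :: "'n \<Rightarrow> real"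
    by (auto simp: merge_def fun_eq_iff)
  show "0 \<le> q \<theta>"
  proof -
    have "0 \<le> g (merge ?C ?B (restrict \<theta> ?C, restrict \<theta> ?B))"
      using gd[OF resB[of \<theta>]] resC[of \<theta>] unfolding is_density_def by blast
    then have "0 \<le> g \<theta>" unfolding merge_restrict mrg .
    then show ?thesis using prodf_nonneg[OF assms(1) qf resB[of \<theta>]] by (simp add: q prodf_restrict)
  qed
  assume F: "F \<in> borel_measurable (LB ?B)"
  let ?f = "\<lambda>\<theta>. ennreal (q \<theta>) * F (restrict \<theta> ?B)"
  have fm: "?f \<in> borel_measurable (LB (?B \<union> ?C))"
    using measurable_compose[OF rB F] qm by simp
  have "(\<integral>\<^sup>+\<theta>. ?f \<theta> \<partial>LB (?B \<union> ?C)) = (\<integral>\<^sup>+y. (\<integral>\<^sup>+x. ?f (merge ?B ?C (y, x)) \<partial>LB ?C) \<partial>LB ?B)"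
    unfolding LB_def by (rule lb.product_nn_integral_fold) (use fm in \<open>auto simp: LB_def\<close>)
  also have "\<dots> = (\<integral>\<^sup>+y. ennreal (prodf blk U qf y) * F y \<partial>LB ?B)"
  proof (rule nn_integral_cong)
    fix y assume y: "y \<in> space (LB ?B)"
    let ?g = "\<lambda>x. g (merge ?C ?B (x, y))"
    have gm: "?g \<in> borel_measurable (LB ?C)" and g0: "\<And>x. x \<in> space (LB ?C) \<Longrightarrow> 0 \<le> ?g x"
      and g1: "(\<integral>\<^sup>+x. ennreal (?g x) \<partial>LB ?C) = 1"
      using gd[OF y] by (auto simp: is_density_def)
    have "(\<integral>\<^sup>+x. ?f (merge ?B ?C (y, x)) \<partial>LB ?C) = (\<integral>\<^sup>+x. ennreal (?g x) * (ennreal (prodf blk U qf y) * F y) \<partial>LB ?C)"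
    proof (rule nn_integral_cong)
      fix x assume x: "x \<in> space (LB ?C)"
      have m: "merge ?B ?C (y, x) = merge ?C ?B (x, y)" by (rule merge_commute) auto
      have r: "restrict (merge ?C ?B (x, y)) ?B = y" using restrict_space_LB[OF y] by simp
      show "?f (merge ?B ?C (y, x)) = ennreal (?g x) * (ennreal (prodf blk U qf y) * F y)"
        unfolding m r q prodf_merge using g0[OF x] by (simp add: ennreal_mult' mult.assoc)
    qed
    also have "\<dots> = ennreal (prodf blk U qf y) * F y"
      using gm by (subst nn_integral_multc) (auto simp: g1)
    finally show "(\<integral>\<^sup>+x. ?f (merge ?B ?C (y, x)) \<partial>LB ?C) = ennreal (prodf blk U qf y) * F y" .
  qed
  finally show "(\<integral>\<^sup>+\<theta>. ?f \<theta> \<partial>Lp) = (\<integral>\<^sup>+y. ennreal (prodf blk U qf y) * F y \<partial>LB ?B)"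
    by simp
qed

lemma factorized_valid: "factorized blk U g qf q \<Longrightarrow> valid_factors blk U qf"
  unfolding factorized_def by (rule conjunct1)

lemma
  fixes blk :: "'n::finite \<Rightarrow> nat" and h :: "('n \<Rightarrow> real) \<Rightarrow> real"
  assumes "finite U" "factorized blk U g qf q" "h \<in> borel_measurable (LB (blockset blk U))"
  shows factorized_integrable:
      "integrable Lp (\<lambda>\<theta>. q \<theta> * h (restrict \<theta> (blockset blk U)))
        \<longleftrightarrow> integrable (LB (blockset blk U)) (\<lambda>y. prodf blk U qf y * h y)"
    and factorized_integral:
      "(\<integral>\<theta>. q \<theta> * h (restrict \<theta> (blockset blk U)) \<partial>Lp)
        = (\<integral>y. prodf blk U qf y * h y \<partial>LB (blockset blk U))"
proof -
  note v = factorized_valid[OF assms(2)]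
  have r: "(\<lambda>\<theta>. restrict \<theta> (blockset blk U)) \<in> measurable Lp (LB (blockset blk U))"
    by (rule measurable_LB_restrict[OF subset_UNIV])
  note * = r measurable_factorized[OF assms(1,2)] factorized_nonneg[OF assms(1,2)]
      measurable_prodf[OF assms(1) v] prodf_nonneg[OF assms(1) v] nn_integral_factorized[OF assms(1,2)] assms(3)
  show "integrable Lp (\<lambda>\<theta>. q \<theta> * h (restrict \<theta> (blockset blk U)))
        \<longleftrightarrow> integrable (LB (blockset blk U)) (\<lambda>y. prodf blk U qf y * h y)"
    by (rule marginal_integrable[OF *])
  show "(\<integral>\<theta>. q \<theta> * h (restrict \<theta> (blockset blk U)) \<partial>Lp)
        = (\<integral>y. prodf blk U qf y * h y \<partial>LB (blockset blk U))"
    by (rule marginal_integral[OF *])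
qed

lemma integral_is_density:
  assumes "is_density M f"
  shows "has_bochner_integral M f 1"
proof -
  have f: "f \<in> borel_measurable M" "\<And>x. x \<in> space M \<Longrightarrow> 0 \<le> f x" "(\<integral>\<^sup>+x. ennreal (f x) \<partial>M) = 1"
    using assms by (auto simp: is_density_def)
  show ?thesis
    using f by (intro has_bochner_integral_nn_integral) auto
qed

lemma is_density_prodf:
  fixes blk :: "'n::finite \<Rightarrow> nat"
  assumes "finite A" "valid_factors blk A qf"
  shows "is_density (LB (blockset blk A)) (prodf blk A qf)"
proof -
  have "(\<integral>\<^sup>+y. ennreal (prodf blk A qf y) \<partial>LB (blockset blk A)) = (\<integral>\<^sup>+y. (\<Prod>j\<in>A. ennreal (qf j (restrict y (blk1 blk j)))) \<partial>LB (blockset blk A))"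
  proof (rule nn_integral_cong)
    fix y assume y: "y \<in> space (LB (blockset blk A))"
    have "restrict y (blk1 blk j) \<in> space (LB (blk1 blk j))" if "j \<in> A" for j
      using y measurable_space[OF measurable_LB_restrict[OF blk1_subset_blockset[OF that]]] by blast
    then show "ennreal (prodf blk A qf y) = (\<Prod>j\<in>A. ennreal (qf j (restrict y (blk1 blk j))))"
      unfolding prodf_def using assms by (subst prod_ennreal) (auto simp: valid_factors_def is_density_def)
  qed
  also have "\<dots> = (\<Prod>j\<in>A. \<integral>\<^sup>+x. ennreal (qf j x) \<partial>LB (blk1 blk j))"
    using assms by (intro nn_integral_block_prod) (auto simp: valid_factors_def is_density_def)
  also have "\<dots> = 1" using assms by (intro prod.neutral) (auto simp: valid_factors_def is_density_def)
  finally show ?thesis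
    using measurable_prodf[OF assms] prodf_nonneg[OF assms] by (simp add: is_density_def)
qed

lemma is_density_factorized:
  fixes blk :: "'n::finite \<Rightarrow> nat"
  assumes "finite U" "factorized blk U g qf q"
  shows "is_density Lp q"
  unfolding is_density_def
proof (intro conjI ballI)
  have "(\<integral>\<^sup>+\<theta>. ennreal (q \<theta>) \<partial>Lp) = (\<integral>\<^sup>+y. ennreal (prodf blk U qf y) \<partial>LB (blockset blk U))"
    using nn_integral_factorized[OF assms borel_measurable_const[of 1]] by simp
  also have "\<dots> = 1"
    using is_density_prodf[OF assms(1) factorized_valid[OF assms(2)]] by (simp add: is_density_def)
  finally show "(\<integral>\<^sup>+\<theta>. ennreal (q \<theta>) \<partial>Lp) = 1" .
qed (rule measurable_factorized[OF assms] factorized_nonneg[OF assms])+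

section \<open>Linear algebra of the block updates\<close>

lemma bil_compose_left:
  "bil (\<lambda>i j. \<Sum>a\<in>UNIV. L a i * W a j) x y = bil W (\<lambda>a. \<Sum>i\<in>UNIV. L a i * x i) y"
proof -
  have "bil (\<lambda>i j. \<Sum>a\<in>UNIV. L a i * W a j) x y = (\<Sum>j\<in>UNIV. \<Sum>i\<in>UNIV. \<Sum>a\<in>UNIV. L a i * x i * W a j * y j)"
    unfolding bil_def by (subst sum.swap) (simp add: sum_distrib_left sum_distrib_right mult_ac)
  also have "\<dots> = (\<Sum>j\<in>UNIV. \<Sum>a\<in>UNIV. \<Sum>i\<in>UNIV. L a i * x i * W a j * y j)"
    by (intro sum.cong refl sum.swap)
  also have "\<dots> = bil W (\<lambda>a. \<Sum>i\<in>UNIV. L a i * x i) y"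
    unfolding bil_def by (subst sum.swap) (simp add: sum_distrib_left sum_distrib_right mult_ac)
  finally show ?thesis .
qed

lemma bil_compose_right:
  "bil (\<lambda>a j. \<Sum>b\<in>UNIV. Q a b * L b j) x y = bil Q x (\<lambda>b. \<Sum>j\<in>UNIV. L b j * y j)"
proof -
  have "bil (\<lambda>a j. \<Sum>b\<in>UNIV. Q a b * L b j) x y = (\<Sum>a\<in>UNIV. \<Sum>j\<in>UNIV. \<Sum>b\<in>UNIV. x a * Q a b * (L b j * y j))"
    unfolding bil_def by (simp add: sum_distrib_left sum_distrib_right mult_ac)
  also have "\<dots> = (\<Sum>a\<in>UNIV. \<Sum>b\<in>UNIV. \<Sum>j\<in>UNIV. x a * Q a b * (L b j * y j))"
    by (intro sum.cong refl sum.swap)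
  also have "\<dots> = bil Q x (\<lambda>b. \<Sum>j\<in>UNIV. L b j * y j)"
    unfolding bil_def by (simp add: sum_distrib_left)
  finally show ?thesis .
qed

text \<open>For \<open>j\<close> in \<open>B\<close>, column \<open>j\<close> of \<open>L\<close> is
  a unit vector corrected off \<open>B\<close> by the solution of the system whose matrix is the
  block of \<open>Q\<close> off \<open>B\<close> and whose right-hand side is column
  \<open>j\<close> of \<open>Q\<close>. This cancels the rows of \<open>Q L\<close> off
  \<open>B\<close>.\<close>

lemma pd_lift_exists:
  assumes "pd_on UNIV Q"
  shows "\<exists>L. (\<forall>i j. j \<notin> B \<longrightarrow> L i j = 0) \<and> (\<forall>i j. i \<in> B \<longrightarrow> L i j = (if i = j then 1 else 0))
     \<and> (\<forall>i j. i \<notin> B \<longrightarrow> (\<Sum>a\<in>UNIV. Q i a * L a j) = 0)"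
proof -
  have "\<forall>j. \<exists>a. supp_on (- B) a \<and> (\<forall>i\<in>-B. (\<Sum>l\<in>UNIV. Q i l * a l) = Q i j)"
    by (intro allI pd_on_solve pd_on_subset[OF assms]) simp
  then obtain A where A: "\<And>j. supp_on (- B) (A j)"
      "\<And>i j. i \<notin> B \<Longrightarrow> (\<Sum>l\<in>UNIV. Q i l * A j l) = Q i j"
    by (metis ComplI)
  define L where "L i j = (if j \<in> B then (if i = j then 1 else 0) - A j i else 0)" for i j
  have "(\<Sum>a\<in>UNIV. Q i a * L a j) = 0" if "i \<notin> B" for i j
  proof (cases "j \<in> B")
    case True
    then have "(\<Sum>a\<in>UNIV. Q i a * L a j) = (\<Sum>a\<in>UNIV. Q i a * (if a = j then 1 else 0)) - (\<Sum>a\<in>UNIV. Q i a * A j a)"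
      by (simp add: L_def right_diff_distrib sum_subtractf)
    then show ?thesis using A(2)[OF that] by (simp add: if_distrib cong: if_cong)
  qed (simp add: L_def)
  moreover have "L i j = (if i = j then 1 else 0)" if "i \<in> B" for i j
    using that A(1)[of j] by (auto simp: L_def supp_on_def)
  ultimately show ?thesis by (intro exI[of _ L]) (simp add: L_def)
qed

text \<open>\<open>L\<close> sends \<open>x\<close> to \<open>(x\<^sub>B, - Q\<^sub>C\<^sub>C\<^sup>-\<^sup>1 Q\<^sub>C\<^sub>B x\<^sub>B)\<close>, where \<open>B\<close> are the coordinates of the blocks in \<open>U\<close> and
  \<open>C\<close> the remaining ones. Hence \<open>T = L\<^sup>t Q L\<close> is the Schur complement, i.e. the precision matrix of the
  marginal on \<open>B\<close> (padded by zeros), \<open>D\<close> is its block diagonal, and \<open>Qh\<close> is the precision of the optimum.\<close>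
locale gauss_cavi =
  fixes blk :: "'n::finite \<Rightarrow> nat" and U :: "nat set" and Q :: "'n \<Rightarrow> 'n \<Rightarrow> real" and mu :: "'n \<Rightarrow> real"
    and L :: "'n \<Rightarrow> 'n \<Rightarrow> real"
  assumes finite_U: "finite U" and U_ne: "U \<noteq> {}" and block_ne: "k \<in> U \<Longrightarrow> \<exists>i. blk i = k"
    and Q_pd: "pd_on UNIV Q"
    and L_off: "j \<notin> blockset blk U \<Longrightarrow> L i j = 0"
    and L_id: "i \<in> blockset blk U \<Longrightarrow> L i j = (if i = j then 1 else 0)"
    and L_orth: "i \<notin> blockset blk U \<Longrightarrow> (\<Sum>a\<in>UNIV. Q i a * L a j) = 0"
begin

abbreviation B :: "'n set" where "B \<equiv> blockset blk U"

definition lift :: "('n \<Rightarrow> real) \<Rightarrow> 'n \<Rightarrow> real" where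
  "lift x i = (\<Sum>j\<in>UNIV. L i j * x j)"

definition T :: "'n \<Rightarrow> 'n \<Rightarrow> real" where
  "T i j = (\<Sum>a\<in>UNIV. L a i * (\<Sum>b\<in>UNIV. Q a b * L b j))"

definition D :: "'n \<Rightarrow> 'n \<Rightarrow> real" where
  "D i j = (if blk i = blk j then T i j else 0)"

definition Qh :: "'n \<Rightarrow> 'n \<Rightarrow> real" where
  "Qh i j = Q i j - T i j + D i j"

section \<open>Schur complement, block diagonal and precision of the optimum\<close>

lemma Q_sym: "sym_mat Q" by (rule pd_on_sym[OF Q_pd])

lemma bil_T: "bil T x y = bil Q (lift x) (lift y)"
proof -
  have "bil T x y = bil (\<lambda>a j. \<Sum>b\<in>UNIV. Q a b * L b j) (lift x) y"
    unfolding T_def[abs_def] lift_def[abs_def] by (rule bil_compose_left)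
  also have "\<dots> = bil Q (lift x) (lift y)"
    unfolding lift_def[of y, abs_def] by (rule bil_compose_right)
  finally show ?thesis .
qed

lemma lift_B: "i \<in> B \<Longrightarrow> lift x i = x i"
  by (simp add: lift_def L_id if_distribR if_distrib cong: if_cong)

lemma lift_cong: "(\<And>i. i \<in> B \<Longrightarrow> x i = y i) \<Longrightarrow> lift x = lift y"
  unfolding lift_def by (intro ext sum.cong refl) (metis L_off mult_zero_left)

lemma lift_proj: "lift (coord_proj B x) = lift x"
  by (rule lift_cong) (simp add: coord_proj_def)

lemma lift_lift: "lift (lift x) = lift x"
  by (rule lift_cong) (rule lift_B)

text \<open>The rows of \<open>Q L\<close> off \<open>B\<close> vanish. This is the stationarity
  condition for minimising \<open>quadform Q\<close> over the coordinates off \<open>B\<close> with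
  those in \<open>B\<close> held fixed.\<close>

lemma bil_lift_orth: "supp_on (- B) c \<Longrightarrow> bil Q c (lift x) = 0"
proof -
  assume c: "supp_on (- B) c"
  have "bil Q c (lift x) = bil (\<lambda>a j. \<Sum>b\<in>UNIV. Q a b * L b j) c x"
    unfolding lift_def[abs_def] by (rule bil_compose_right[symmetric])
  also have "\<dots> = bil (\<lambda>a j. \<Sum>b\<in>UNIV. Q a b * L b j) c (\<lambda>_. 0)"
    by (rule bil_cong_rows[OF c]) (simp add: L_orth)
  finally show ?thesis by (simp add: bil_def)
qed

lemma supp_on_diff_lift: "supp_on (- B) (\<lambda>i. z i - lift z i)"
  by (auto simp: supp_on_def lift_B)

lemma bil_Q_lift: "bil Q x (lift y) = bil T x y"
proof -
  have "bil Q (\<lambda>i. x i - lift x i) (lift y) = 0" by (rule bil_lift_orth[OF supp_on_diff_lift])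
  then show ?thesis by (simp add: bil_diff_left bil_T)
qed

lemma T_sym: "sym_mat T"
proof -
  have "T i j = bil Q (\<lambda>a. L a i) (\<lambda>b. L b j)" for i j by (simp add: T_def bil_rows)
  then show ?thesis using bil_commute[OF Q_sym] by (simp add: sym_mat_def)
qed

lemma T_off: "i \<notin> B \<or> j \<notin> B \<Longrightarrow> T i j = 0"
  using T_sym unfolding sym_mat_def by (auto simp: T_def L_off)

lemma D_sym: "sym_mat D"
  using T_sym by (simp add: sym_mat_def D_def)

lemma Qh_sym: "sym_mat Qh"
  using T_sym D_sym Q_sym unfolding sym_mat_def Qh_def by metis

lemma bil_T_proj: "bil T x (coord_proj B y) = bil T x y"
  by (simp add: bil_T lift_proj)

lemma quadform_T_proj: "quadform T (coord_proj B x) = quadform T x"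
  by (simp add: quadform_bil bil_T lift_proj)

text \<open>Pythagoras for the orthogonality in \<open>bil_lift_orth\<close>. In Gaussian terms the
  two summands belong to the marginal on \<open>B\<close> and to the conditional of the
  rest.\<close>

lemma quadform_Q_split: "quadform Q z = quadform T z + quadform Q (\<lambda>i. z i - lift z i)"
proof -
  have "quadform Q (\<lambda>i. z i - lift z i) = quadform Q z - 2 * bil Q z (lift z) + quadform Q (lift z)"
    by (rule quadform_diff[OF Q_sym])
  then show ?thesis by (simp add: bil_Q_lift) (simp add: quadform_bil bil_T)
qed

lemma T_pd: "pd_on B T"
  unfolding pd_on_def
proof (intro conjI allI impI T_sym)
  fix x assume x: "supp_on B x" "\<exists>i. x i \<noteq> 0"
  then obtain i where "x i \<noteq> 0" "i \<in> B" by (auto simp: supp_on_def)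
  then have "\<exists>i. lift x i \<noteq> 0" using lift_B by metis
  then have "quadform Q (lift x) > 0" using Q_pd by (auto simp: pd_on_def supp_on_def)
  then show "quadform T x > 0" by (simp add: quadform_bil bil_T)
qed

lemma blk1_sub: "k \<in> U \<Longrightarrow> blk1 blk k \<subseteq> B"
  by (rule blk1_subset_blockset)

lemma T_pd_block: "k \<in> U \<Longrightarrow> pd_on (blk1 blk k) T"
  using pd_on_subset[OF T_pd blk1_sub] .

lemma quadform_T_nonneg: "0 \<le> quadform T x"
  using pd_on_nonneg[OF T_pd supp_on_coord_proj, of x] by (simp add: quadform_T_proj)

lemma bil_D: "bil D x y = (\<Sum>k\<in>U. bil T (coord_proj (blk1 blk k) x) (coord_proj (blk1 blk k) y))"
proof -
  have "(\<Sum>k\<in>U. bil T (coord_proj (blk1 blk k) x) (coord_proj (blk1 blk k) y))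
     = (\<Sum>i\<in>UNIV. \<Sum>j\<in>UNIV. \<Sum>k\<in>U. coord_proj (blk1 blk k) x i * T i j * coord_proj (blk1 blk k) y j)"
    unfolding bil_def by (subst sum.swap, intro sum.cong refl, rule sum.swap)
  also have "\<dots> = (\<Sum>i\<in>UNIV. \<Sum>j\<in>UNIV. x i * D i j * y j)"
  proof (intro sum.cong refl)
    fix i j
    have "(\<Sum>k\<in>U. coord_proj (blk1 blk k) x i * T i j * coord_proj (blk1 blk k) y j)
        = (\<Sum>k\<in>U. if k = blk i then x i * D i j * y j else 0)"
      by (rule sum.cong) (auto simp: coord_proj_def blockset_def D_def)
    \<comment> \<open>If \<open>blk i\<close> lies outside \<open>U\<close> the sum is 0, and so is
      the right side because \<open>T\<close> vanishes there.\<close>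
    also have "\<dots> = x i * D i j * y j"
      using finite_U T_off[of i j] by (auto simp: D_def blockset_def)
    finally show "(\<Sum>k\<in>U. coord_proj (blk1 blk k) x i * T i j * coord_proj (blk1 blk k) y j) = x i * D i j * y j" .
  qed
  finally show ?thesis by (simp add: bil_def)
qed

lemma quadform_D: "quadform D x = (\<Sum>k\<in>U. quadform T (coord_proj (blk1 blk k) x))"
  by (simp add: quadform_bil bil_D)

lemma proj_proj: "S \<subseteq> S' \<Longrightarrow> coord_proj S (coord_proj S' x) = coord_proj S x"
  by (auto simp: coord_proj_def fun_eq_iff)

lemma quadform_D_proj: "quadform D (coord_proj B x) = quadform D x"
  using proj_proj[OF blk1_sub] by (simp add: quadform_D)

lemma quadform_D_nonneg: "0 \<le> quadform D x"
  unfolding quadform_D by (intro sum_nonneg quadform_T_nonneg)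

lemma D_pd: "pd_on B D"
  unfolding pd_on_def
proof (intro conjI allI impI D_sym)
  fix x assume x: "supp_on B x" "\<exists>i. x i \<noteq> 0"
  then obtain i where i: "x i \<noteq> 0" "i \<in> B" by (auto simp: supp_on_def)
  then have k: "blk i \<in> U" by (simp add: blockset_def)
  have "coord_proj (blk1 blk (blk i)) x i \<noteq> 0" using i by (simp add: coord_proj_def blockset_def)
  then have "quadform T (coord_proj (blk1 blk (blk i)) x) > 0"
    using T_pd_block[OF k] supp_on_coord_proj unfolding pd_on_def by blast
  then show "quadform D x > 0"
    unfolding quadform_D by (intro sum_pos2[OF finite_U k]) (auto intro: quadform_T_nonneg)
qed

text \<open>The conditional part of \<open>Q\<close> is kept and the marginal part \<open>T\<close>
  is replaced by its block diagonal.\<close>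

lemma quadform_Qh: "quadform Qh z = quadform Q (\<lambda>i. z i - lift z i) + quadform D z"
proof -
  have "quadform Qh z = quadform Q z - quadform T z + quadform D z"
    by (simp add: quadform_def Qh_def algebra_simps sum.distrib sum_subtractf)
  then show ?thesis using quadform_Q_split[of z] by simp
qed

lemma Qh_pd: "pd_on UNIV Qh"
  unfolding pd_on_def
proof (intro conjI allI impI Qh_sym)
  fix z :: "'n \<Rightarrow> real" assume z: "\<exists>i. z i \<noteq> 0"
  have Qnn: "quadform Q x \<ge> 0" for x
    by (rule pd_on_nonneg[OF Q_pd]) (simp add: supp_on_def)
  show "quadform Qh z > 0"
  proof (cases "\<exists>i\<in>B. z i \<noteq> 0")
    case True
    then have "\<exists>i. coord_proj B z i \<noteq> 0" by (auto simp: coord_proj_def)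
    then have "quadform D (coord_proj B z) > 0"
      using D_pd supp_on_coord_proj unfolding pd_on_def by blast
    then show ?thesis using Qnn by (simp add: quadform_Qh quadform_D_proj add_nonneg_pos)
  next
    case False
    then have "lift z = lift (\<lambda>_. 0)" by (intro lift_cong) auto
    then have "lift z = (\<lambda>_. 0)" by (simp add: lift_def[abs_def])
    then have "quadform Q (\<lambda>i. z i - lift z i) > 0"
      using Q_pd z by (auto simp: pd_on_def supp_on_def)
    then show ?thesis using quadform_D_nonneg by (simp add: quadform_Qh add_pos_nonneg)
  qed
qed

section \<open>The least eigenvalue of \<open>T\<close> relative to \<open>D\<close>\<close>

lemma B_ne: "B \<noteq> {}"
  using U_ne block_ne by (force simp: blockset_def)

definition x0 :: "'n \<Rightarrow> real" where
  "x0 = (SOME x. supp_on B x \<and> (\<exists>i. x i \<noteq> 0) \<and>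
      (\<forall>z. supp_on B z \<longrightarrow> quadform T x / quadform D x * quadform D z \<le> quadform T z))"

definition lam :: real where "lam = quadform T x0 / quadform D x0"

text \<open>Minimality, known on vectors supported on \<open>B\<close>, extends to every
  \<open>z\<close> because both forms ignore the other coordinates.\<close>

lemma x0: "supp_on B x0" "\<exists>i. x0 i \<noteq> 0" "lam * quadform D z \<le> quadform T z"
proof -
  have *: "supp_on B x0 \<and> (\<exists>i. x0 i \<noteq> 0) \<and>
      (\<forall>z. supp_on B z \<longrightarrow> quadform T x0 / quadform D x0 * quadform D z \<le> quadform T z)"
    unfolding x0_def by (rule someI_ex[OF min_ratio_exists[OF D_pd B_ne]])
  then show "supp_on B x0" "\<exists>i. x0 i \<noteq> 0" by blast+
  have "quadform T x0 / quadform D x0 * quadform D (coord_proj B z) \<le> quadform T (coord_proj B z)"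
    using * supp_on_coord_proj by blast
  then show "lam * quadform D z \<le> quadform T z"
    by (simp add: lam_def quadform_D_proj quadform_T_proj)
qed

lemma x0_pos: "quadform T x0 > 0" "quadform D x0 > 0"
  using x0(1,2) T_pd D_pd by (auto simp: pd_on_def)

lemma lam_pos: "lam > 0" by (simp add: lam_def x0_pos)

text \<open>A unit coordinate vector tests only a diagonal entry, where \<open>T\<close> and
  \<open>D\<close> agree.\<close>

lemma lam_le_1: "lam \<le> 1"
proof -
  obtain i where i: "i \<in> B" using B_ne by blast
  define e where "e j = (if j = i then 1 else 0 :: real)" for j
  have "supp_on B e" "\<exists>i. e i \<noteq> 0" using i by (auto simp: supp_on_def e_def)
  then have pos: "quadform D e > 0" using D_pd by (auto simp: pd_on_def)
  have "e a * D a b * e b = e a * T a b * e b" for a b by (simp add: e_def D_def)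
  then have "quadform D e = quadform T e" unfolding quadform_def by (intro sum.cong refl)
  then show ?thesis using x0(3)[of e] pos by simp
qed

text \<open>Minimality makes \<open>T - lam D\<close> semidefinite with \<open>x0\<close> a zero of
  its form; Cauchy-Schwarz then puts \<open>x0\<close> into the kernel.\<close>

lemma eigen: "bil T x0 y = lam * bil D x0 y"
proof -
  define M where "M i j = T i j - lam * D i j" for i j
  have bM: "bil M x y = bil T x y - lam * bil D x y" for x y
    by (simp add: bil_def M_def algebra_simps sum_subtractf sum_distrib_left)
  have "sym_mat M" using T_sym D_sym by (simp add: sym_mat_def M_def)
  moreover have "0 \<le> quadform M z" for z using x0(3)[of z] by (simp add: quadform_bil bM)
  ultimately have "(bil M x0 y)\<^sup>2 \<le> quadform M x0 * quadform M y"
    by (intro bil_cauchy_schwarz[where S=UNIV]) (auto simp: supp_on_def)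
  moreover have "quadform M x0 = 0"
    using x0_pos by (simp add: quadform_bil bM lam_def)
  ultimately show ?thesis by (simp add: bM)
qed

text \<open>\<open>x - newton k x\<close> minimises the form \<open>T\<close> over changes of \<open>x\<close> in block \<open>k\<close>; this is what a coordinate
  update does to the error of the means.\<close>
definition newton :: "nat \<Rightarrow> ('n \<Rightarrow> real) \<Rightarrow> 'n \<Rightarrow> real" where
  "newton k x = (SOME d. supp_on (blk1 blk k) d
      \<and> (\<forall>i\<in>blk1 blk k. (\<Sum>j\<in>UNIV. T i j * d j) = (\<Sum>j\<in>UNIV. T i j * x j)))"

lemma newton:
  assumes "k \<in> U"
  shows newton_supp: "supp_on (blk1 blk k) (newton k x)"
    and newton_eq: "supp_on (blk1 blk k) y \<Longrightarrow> bil T y (newton k x) = bil T y x"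
proof -
  have *: "supp_on (blk1 blk k) (newton k x)
      \<and> (\<forall>i\<in>blk1 blk k. (\<Sum>j\<in>UNIV. T i j * newton k x j) = (\<Sum>j\<in>UNIV. T i j * x j))"
    unfolding newton_def by (rule someI_ex[OF pd_on_solve[OF T_pd_block[OF assms]]])
  then show "supp_on (blk1 blk k) (newton k x)" by blast
  show "bil T y (newton k x) = bil T y x" if "supp_on (blk1 blk k) y"
    using * by (intro bil_cong_rows[OF that]) blast
qed

text \<open>\<open>newton k x\<close> is the orthogonal projection of \<open>x\<close>, in the form
  \<open>T\<close>, onto the vectors supported on block \<open>k\<close>; this is
  Pythagoras.\<close>

lemma newton_descent:
  assumes "k \<in> U"
  shows "quadform T (\<lambda>i. x i - newton k x i) = quadform T x - quadform T (newton k x)"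
  using newton_eq[OF assms newton_supp[OF assms], of x x] bil_commute[OF T_sym, of x "newton k x"]
  unfolding quadform_diff[OF T_sym] by (simp add: quadform_bil)

lemma sum_proj: "(\<lambda>i. \<Sum>k\<in>U. coord_proj (blk1 blk k) y i) = coord_proj B y"
  using finite_U by (auto simp: coord_proj_def blockset_def fun_eq_iff)

text \<open>The sum of the block corrections is D^-1 T x, the block Jacobi step, expressed through
  bilinear forms.\<close>

lemma bil_D_newton: "bil D (\<lambda>i. \<Sum>k\<in>U. newton k x i) y = bil T x y"
proof -
  have proj: "coord_proj (blk1 blk k) (\<lambda>i. \<Sum>l\<in>U. newton l x i) = newton k x" if "k \<in> U" for k
  proof
    fix i
    have "(\<Sum>l\<in>U. newton l x i) = newton k x i" if i: "i \<in> blk1 blk k"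
    proof -
      have "(\<Sum>l\<in>U. newton l x i) = (\<Sum>l\<in>U. if l = k then newton k x i else 0)"
        using newton_supp i by (intro sum.cong refl) (auto simp: supp_on_def blockset_def)
      then show ?thesis using finite_U \<open>k \<in> U\<close> by simp
    qed
    then show "coord_proj (blk1 blk k) (\<lambda>i. \<Sum>l\<in>U. newton l x i) i = newton k x i"
      using newton_supp[OF that, of x] by (auto simp: coord_proj_def supp_on_def)
  qed
  have "bil D (\<lambda>i. \<Sum>k\<in>U. newton k x i) y = (\<Sum>k\<in>U. bil T (newton k x) (coord_proj (blk1 blk k) y))"
    by (simp add: bil_D proj)
  also have "\<dots> = (\<Sum>k\<in>U. bil T (coord_proj (blk1 blk k) y) x)"
    by (intro sum.cong refl) (simp add: bil_commute[OF T_sym, of "newton _ x"] newton_eq)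
  also have "\<dots> = bil T (coord_proj B y) x"
    by (simp add: sum_proj flip: bil_sum_left)
  also have "\<dots> = bil T x y" by (subst bil_commute[OF T_sym]) (rule bil_T_proj)
  finally show ?thesis .
qed

text \<open>By \<open>eigen\<close>, pairing D^-1 T x with \<open>x0\<close> in \<open>T\<close> is
  \<open>lam\<close> times pairing it in \<open>D\<close>, where the inverse of \<open>D\<close>
  cancels.\<close>

lemma sum_newton_lin: "(\<Sum>k\<in>U. bil T x0 (newton k x)) = lam * bil T x0 x"
proof -
  have "(\<Sum>k\<in>U. bil T x0 (newton k x)) = bil T x0 (\<lambda>i. \<Sum>k\<in>U. newton k x i)"
    by (simp add: bil_commute[OF T_sym, of x0] bil_sum_left)
  also have "\<dots> = lam * bil D (\<lambda>i. \<Sum>k\<in>U. newton k x i) x0"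
    by (simp add: eigen bil_commute[OF D_sym, of x0])
  also have "\<dots> = lam * bil T x0 x" by (simp add: bil_D_newton bil_commute[OF T_sym, of x0])
  finally show ?thesis .
qed

text \<open>With a = D^-1 T x the right side is \<open>quadform D a\<close> and
  \<open>quadform T x\<close> is \<open>bil D a x\<close>. Cauchy-Schwarz for \<open>D\<close> and
  the eigenvalue bound on \<open>quadform D x\<close> leave one factor \<open>quadform T x\<close>
  to cancel.\<close>

lemma sum_newton_quad: "lam * quadform T x \<le> (\<Sum>k\<in>U. quadform T (newton k x))"
proof -
  define a where "a = (\<lambda>i. \<Sum>k\<in>U. newton k x i)"
  have Da: "quadform D a = (\<Sum>k\<in>U. quadform T (newton k x))"
  proof -
    have "quadform D a = bil T x a" by (simp add: quadform_bil a_def bil_D_newton)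
    also have "\<dots> = (\<Sum>k\<in>U. bil T (newton k x) x)"
      by (simp add: a_def bil_commute[OF T_sym, of x] bil_sum_left)
    also have "\<dots> = (\<Sum>k\<in>U. quadform T (newton k x))"
      by (intro sum.cong refl) (simp add: quadform_bil newton_eq newton_supp)
    finally show ?thesis .
  qed
  have "(quadform T x)\<^sup>2 = (bil D a x)\<^sup>2" by (simp add: a_def bil_D_newton quadform_bil)
  also have "\<dots> \<le> quadform D a * quadform D x"
    by (rule bil_cauchy_schwarz[where S=UNIV]) (auto simp: D_sym quadform_D_nonneg supp_on_def)
  finally have "lam * (quadform T x)\<^sup>2 \<le> lam * (quadform D a * quadform D x)"
    using lam_pos by (intro mult_left_mono) auto
  also have "\<dots> = quadform D a * (lam * quadform D x)" by simp
  also have "\<dots> \<le> quadform D a * quadform T x"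
    by (intro mult_left_mono x0 quadform_D_nonneg)
  finally have *: "(lam * quadform T x) * quadform T x \<le> quadform D a * quadform T x"
    by (simp add: power2_eq_square mult.assoc)
  show ?thesis
  proof (cases "quadform T x = 0")
    case True
    then show ?thesis by (simp add: sum_nonneg quadform_T_nonneg)
  next
    case False
    then have "quadform T x > 0" using quadform_T_nonneg[of x] by simp
    then show ?thesis using * unfolding Da[symmetric] by (rule mult_right_le_imp_le[rotated])
  qed
qed

section \<open>UQF of the optimum\<close>

lemma bil_Qh: "bil Qh z y = bil Q z y - bil T z y + bil D z y"
  by (simp add: bil_def Qh_def algebra_simps sum.distrib sum_subtractf)

text \<open>The lower bound is the form inequality lam Qh <= Q passed to the inverses. With
  \<open>z\<close> and \<open>a\<close> solving \<open>Q z = v\<close> and \<open>Qh a = v\<close>,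
  Cauchy-Schwarz for \<open>Qh\<close> does the inversion. The form inequality uses
  \<open>lam\<close> <= 1 on the conditional part and the eigenvalue bound on the marginal
  part.\<close>

lemma UQF_Qh: "UQF (gauss Qh mu) (gauss Q mu) = lam"
proof -
  let ?f = "\<lambda>v \<theta>. \<Sum>i\<in>UNIV. \<theta> i * v i"
  let ?r = "\<lambda>v. dvar (gauss Qh mu) (?f v) / dvar (gauss Q mu) (?f v)"
  have solve: "\<exists>a. \<forall>i. (\<Sum>j\<in>UNIV. M i j * a j) = v i" if "pd_on UNIV M" for M :: "'n \<Rightarrow> 'n \<Rightarrow> real" and v
    using pd_on_solve[OF that, of v] by auto
  have low: "lam \<le> ?r v" if v: "\<exists>i. v i \<noteq> 0" for v
  proof -
    obtain a where a: "\<And>i. (\<Sum>j\<in>UNIV. Qh i j * a j) = v i" using solve[OF Qh_pd] by blast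
    obtain z where z: "\<And>i. (\<Sum>j\<in>UNIV. Q i j * z j) = v i" using solve[OF Q_pd] by blast
    have z0: "\<exists>i. z i \<noteq> 0"
    proof (rule ccontr)
      assume "\<not> ?thesis"
      then have "v i = 0" for i using z[of i] by simp
      then show False using v by simp
    qed
    then have Qz: "quadform Q z > 0" by (rule pd_on_UNIV_pos[OF Q_pd])
    have qz: "quadform Q z = bil Qh z a"
      unfolding quadform_bil by (rule bil_cong_rows[of UNIV]) (auto simp: a z supp_on_def)
    have "lam * quadform Qh z = lam * quadform Q (\<lambda>i. z i - lift z i) + lam * quadform D z"
      by (simp add: quadform_Qh algebra_simps)
    also have "\<dots> \<le> 1 * quadform Q (\<lambda>i. z i - lift z i) + quadform T z"
      using lam_le_1 by (intro add_mono mult_right_mono x0(3) pd_on_nonneg[OF Q_pd]) (auto simp: supp_on_def)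
    also have "\<dots> = quadform Q z" using quadform_Q_split[of z] by simp
    finally have le: "lam * quadform Qh z \<le> quadform Q z" .
    have "(quadform Q z)\<^sup>2 \<le> quadform Qh z * quadform Qh a"
      unfolding qz by (rule bil_cauchy_schwarz[where S=UNIV])
        (auto simp: Qh_sym supp_on_def intro: pd_on_nonneg[OF Qh_pd])
    then have "lam * (quadform Q z)\<^sup>2 \<le> lam * (quadform Qh z * quadform Qh a)"
      using lam_pos by (intro mult_left_mono) auto
    also have "\<dots> = (lam * quadform Qh z) * quadform Qh a" by simp
    also have "\<dots> \<le> quadform Q z * quadform Qh a"
      by (intro mult_right_mono le pd_on_nonneg[OF Qh_pd]) (simp add: supp_on_def)
    finally have "(lam * quadform Q z) * quadform Q z \<le> quadform Qh a * quadform Q z"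
      by (simp add: power2_eq_square mult_ac)
    then have "lam * quadform Q z \<le> quadform Qh a" using Qz by (rule mult_right_le_imp_le)
    then show ?thesis
      unfolding gauss_variance[OF Qh_pd a] gauss_variance[OF Q_pd z] using Qz by (simp add: pos_le_divide_eq)
  qed
  \<comment> \<open>This direction attains the bound: by the eigenvector equation \<open>Qh\<close>
    maps \<open>lam * lift x0\<close> to the same \<open>?v\<close>, which makes both variances
    explicit.\<close>
  let ?z = "lift x0" and ?v = "\<lambda>i. \<Sum>j\<in>UNIV. Q i j * lift x0 j"
  have rowsT: "bil Q y ?z = bil T y x0" for y by (rule bil_Q_lift)
  have rows: "bil Qh y (\<lambda>j. lam * ?z j) = bil Q y ?z" for y
  proof -
    have "bil T y ?z = bil T y x0" by (simp add: bil_T lift_lift)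
    moreover have "bil D y ?z = bil D y x0"
    proof -
      have "coord_proj (blk1 blk k) ?z = coord_proj (blk1 blk k) x0" if "k \<in> U" for k
        using blk1_sub[OF that] by (auto simp: coord_proj_def lift_B fun_eq_iff)
      then show ?thesis by (simp add: bil_D)
    qed
    ultimately have "bil Qh y (\<lambda>j. lam * ?z j) = lam * bil D y x0"
      by (simp add: bil_scale_right bil_Qh rowsT)
    also have "\<dots> = bil T y x0" using eigen[of y] by (simp add: bil_commute[OF T_sym, of x0] bil_commute[OF D_sym, of x0])
    finally show ?thesis by (simp add: rowsT)
  qed
  have a: "(\<Sum>j\<in>UNIV. Qh i j * (lam * ?z j)) = ?v i" for i
  proof -
    have "bil M (\<lambda>l. if l = i then 1 else 0) y = (\<Sum>j\<in>UNIV. M i j * y j)" for M :: "'n \<Rightarrow> 'n \<Rightarrow> real" and y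
      by (simp add: bil_rows if_distrib if_distribR cong: if_cong)
    from this[of Qh "\<lambda>j. lam * ?z j"] this[of Q ?z] show ?thesis using rows by simp
  qed
  have "quadform Q ?z = quadform T x0" by (simp add: quadform_bil bil_T)
  then have Qz: "quadform Q ?z > 0" using x0_pos by simp
  have "quadform Qh (\<lambda>j. lam * ?z j) = lam * quadform Q ?z"
    unfolding quadform_bil rows bil_scale_left by simp
  then have rv: "?r ?v = lam"
    unfolding gauss_variance[OF Qh_pd a] gauss_variance[OF Q_pd refl] using Qz by simp
  have "\<exists>i. ?v i \<noteq> 0"
  proof (rule ccontr)
    assume "\<not> ?thesis"
    then have "quadform Q ?z = 0" by (simp add: quadform_bil bil_rows)
    then show False using Qz by simp
  qed
  then show ?thesis unfolding UQF_def
    by (intro cInf_eq_minimum) (auto intro!: low exI[of _ ?v] simp: rv)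
qed

end

section \<open>Gibbs' inequality and moments\<close>

text \<open>This is ln t <= t - 1 at t = h/f, multiplied by f. The right side is integrable for
  densities, so it controls one sign of the entropy integrand even before the divergence is known to
  be finite.\<close>

lemma gibbs_pointwise:
  fixes f h :: real assumes "f \<ge> 0" "h > 0"
  shows "f * (ln h - ln f) \<le> h - f"
proof (cases "f = 0")
  case False
  then have f: "f > 0" using assms by simp
  have "ln (h / f) \<le> h / f - 1" using f assms by (intro ln_le_minus_one) auto
  then have "f * ln (h / f) \<le> f * (h / f - 1)" using f by (intro mult_left_mono) auto
  moreover have "f * (h / f - 1) = h - f" using f by (simp add: field_simps)
  ultimately show ?thesis using f assms by (simp add: ln_div)
qed (use assms in simp)

lemma gibbs_pointwise_eq:
  fixes f h :: real assumes "f \<ge> 0" "h > 0" "f * (ln h - ln f) = h - f"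
  shows "f = h"
proof (cases "f = 0")
  case False
  then have f: "f > 0" using assms by simp
  have "f * (h / f - 1) = h - f" using f by (simp add: field_simps)
  then have "f * ln (h / f) = f * (h / f - 1)" using f assms by (simp add: ln_div)
  then have "ln (h / f) = h / f - 1" using f by simp
  then have "h / f = 1" using f assms by (intro ln_eq_minus_one) auto
  then show ?thesis using f by simp
qed (use assms in simp)

text \<open>The defect \<open>G\<close> of the pointwise inequality is nonnegative and, both
  densities having mass 1, its integral is the divergence. If that is 0 then \<open>G\<close>
  vanishes almost everywhere, which is the equality case.\<close>

lemma
  assumes f: "is_density M f" and h: "is_density M h" and pos: "\<And>x. x \<in> space M \<Longrightarrow> 0 < h x"
    and int: "integrable M (\<lambda>x. f x * (ln (h x) - ln (f x)))"
  shows gibbs_integral: "(\<integral>x. f x * (ln (h x) - ln (f x)) \<partial>M) \<le> 0"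
    and gibbs_integral_eq: "(\<integral>x. f x * (ln (h x) - ln (f x)) \<partial>M) = 0 \<Longrightarrow> AE x in M. f x = h x"
proof -
  have hf: "has_bochner_integral M f 1" and hh: "has_bochner_integral M h 1"
    using f h by (auto intro: integral_is_density)
  have f0: "x \<in> space M \<Longrightarrow> 0 \<le> f x" for x using f by (simp add: is_density_def)
  define G where "G x = h x - f x - f x * (ln (h x) - ln (f x))" for x
  have G0: "0 \<le> G x" if "x \<in> space M" for x
    using gibbs_pointwise[OF f0[OF that] pos[OF that]] by (simp add: G_def)
  have G: "has_bochner_integral M G (1 - 1 - (\<integral>x. f x * (ln (h x) - ln (f x)) \<partial>M))"
    unfolding G_def[abs_def]
    by (intro has_bochner_integral_diff hf hh) (simp add: has_bochner_integral_iff int)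
  have "0 \<le> (\<integral>x. G x \<partial>M)" using G0 by (rule Bochner_Integration.integral_nonneg)
  then show "(\<integral>x. f x * (ln (h x) - ln (f x)) \<partial>M) \<le> 0"
    using G by (simp add: has_bochner_integral_iff)
  assume "(\<integral>x. f x * (ln (h x) - ln (f x)) \<partial>M) = 0"
  then have "integrable M G" "integral\<^sup>L M G = 0" using G by (simp_all add: has_bochner_integral_iff)
  then have "AE x in M. G x = 0"
    using integral_nonneg_eq_0_iff_AE[of M G] G0 by auto
  then show "AE x in M. f x = h x"
  proof (rule AE_mp, intro AE_I2 impI)
    fix x assume "x \<in> space M" "G x = 0"
    then show "f x = h x" using gibbs_pointwise_eq[OF f0 pos, of x] by (simp add: G_def)
  qed
qed

text \<open>Comparing \<open>q\<close> with the wider Gaussian kernel \<open>exp (- Q / 4)\<close> by Gibbs' inequality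
  shows that a finite divergence from the Gaussian forces finite second moments.\<close>
lemma finite_second_moments:
  assumes pd: "pd_on UNIV Q" and q: "is_density Lp q"
    and int: "integrable Lp (\<lambda>\<theta>. q \<theta> * (ln (gauss Q mu \<theta>) - ln (q \<theta>)))"
  shows "integrable Lp (\<lambda>\<theta>. q \<theta> * (\<theta> i - mu i)\<^sup>2)"
proof -
  define Z where "Z = gZ Q UNIV"
  have Z: "Z > 0" unfolding Z_def by (rule gZ_pos[OF pd])
  have q0: "0 \<le> q \<theta>" for \<theta> using q by (simp add: is_density_def space_LB)
  have qm: "q \<in> borel_measurable Lp" using q by (simp add: is_density_def)
  have qint: "integrable Lp q" using integral_is_density[OF q] by (simp add: has_bochner_integral_iff)
  define H where "H i j = Q i j / 2" for i j
  have Hq: "quadform H x = quadform Q x / 2" for x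
    by (simp add: H_def quadform_def sum_divide_distrib)
  have Hpd: "pd_on UNIV H"
    using pd unfolding pd_on_def Hq by (simp add: H_def sym_mat_def)
  let ?w = "gker H UNIV mu"
  have wint: "integrable Lp ?w" by (rule integrable_gker[OF Hpd])
  obtain c where c: "c > 0" "\<And>z. c * (\<Sum>i\<in>UNIV. (z i)\<^sup>2) \<le> quadform Q z"
    using pd_on_coercive[OF pd] by (auto simp: supp_on_def)
  let ?I = "\<lambda>\<theta>. q \<theta> * (ln (gauss Q mu \<theta>) - ln (q \<theta>))"
  \<comment> \<open>The two log densities differ by \<open>cquad / 4\<close> up to a constant;
    coercivity with constant \<open>c\<close> converts this into the factor
    \<open>4 / c\<close>.\<close>
  have dom: "integrable Lp (\<lambda>\<theta>. 4 / c * (?w \<theta> - q \<theta> - ln Z * q \<theta> - ?I \<theta>))"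
    by (intro integrable_mult_right Bochner_Integration.integrable_diff int wint qint)
  have bound: "q \<theta> * (\<theta> i - mu i)\<^sup>2 \<le> 4 / c * (?w \<theta> - q \<theta> - ln Z * q \<theta> - ?I \<theta>)" for \<theta>
  proof -
    let ?s = "cquad Q UNIV mu \<theta>"
    have "ln (?w \<theta>) = - ?s / 4" by (simp add: gker_def cquad_def Hq)
    then have 1: "q \<theta> * (- ?s / 4 - ln (q \<theta>)) \<le> ?w \<theta> - q \<theta>"
      using gibbs_pointwise[OF q0[of \<theta>] gker_pos[of H UNIV mu \<theta>]] by simp
    have lnp: "ln (gauss Q mu \<theta>) = - ?s / 2 - ln Z"
      using Z by (simp add: gauss_eq_gker gker_def ln_div flip: Z_def)
    have "q \<theta> * ?s / 4 \<le> ?w \<theta> - q \<theta> - ln Z * q \<theta> - ?I \<theta>"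
      using 1 unfolding lnp by (simp add: algebra_simps)
    moreover have "c * (\<theta> i - mu i)\<^sup>2 \<le> ?s"
    proof -
      have "(\<theta> i - mu i)\<^sup>2 \<le> (\<Sum>j\<in>UNIV. (\<theta> j - mu j)\<^sup>2)"
        by (rule member_le_sum) auto
      then have "c * (\<theta> i - mu i)\<^sup>2 \<le> c * (\<Sum>j\<in>UNIV. (\<theta> j - mu j)\<^sup>2)"
        using c(1) by (intro mult_left_mono) auto
      also have "\<dots> \<le> ?s" using c(2)[of "\<lambda>j. \<theta> j - mu j"] by (simp add: cquad_def coord_proj_def)
      finally show ?thesis .
    qed
    then have "q \<theta> * (c * (\<theta> i - mu i)\<^sup>2) \<le> q \<theta> * ?s" by (rule mult_left_mono) (rule q0)
    ultimately have "c / 4 * (q \<theta> * (\<theta> i - mu i)\<^sup>2) \<le> ?w \<theta> - q \<theta> - ln Z * q \<theta> - ?I \<theta>"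
      by (simp add: field_simps)
    then show ?thesis using c(1) by (simp add: field_simps)
  qed
  show ?thesis
  proof (rule Bochner_Integration.integrable_bound[OF dom])
    have "(\<lambda>\<theta>. \<theta> i) \<in> borel_measurable Lp" by (rule measurable_LB_component) simp
    then show "(\<lambda>\<theta>. q \<theta> * (\<theta> i - mu i)\<^sup>2) \<in> borel_measurable Lp"
      using qm by measurable
    show "AE \<theta> in Lp. norm (q \<theta> * (\<theta> i - mu i)\<^sup>2) \<le> norm (4 / c * (?w \<theta> - q \<theta> - ln Z * q \<theta> - ?I \<theta>))"
    proof (rule AE_I2)
      fix \<theta>
      have "0 \<le> q \<theta> * (\<theta> i - mu i)\<^sup>2" using q0 by simp
      then show "norm (q \<theta> * (\<theta> i - mu i)\<^sup>2) \<le> norm (4 / c * (?w \<theta> - q \<theta> - ln Z * q \<theta> - ?I \<theta>))"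
        using bound[of \<theta>] unfolding real_norm_def by linarith
    qed
  qed
qed

section \<open>First and second moments of the factors\<close>

definition sq_moments :: "('n \<Rightarrow> nat) \<Rightarrow> nat set \<Rightarrow> (nat \<Rightarrow> ('n \<Rightarrow> real) \<Rightarrow> real) \<Rightarrow> bool" where
  "sq_moments blk A qf \<longleftrightarrow> (\<forall>k\<in>A. \<forall>i\<in>blk1 blk k. integrable (LB (blk1 blk k)) (\<lambda>x. qf k x * (x i)\<^sup>2))"

text \<open>A full vector, so also defined for coordinates whose block lies outside
  \<open>U\<close>. The value there carries no meaning and is ignored by \<open>T\<close>.\<close>

definition fmean :: "('n \<Rightarrow> nat) \<Rightarrow> (nat \<Rightarrow> ('n \<Rightarrow> real) \<Rightarrow> real) \<Rightarrow> 'n \<Rightarrow> real" where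
  "fmean blk qf i = (\<integral>x. qf (blk i) x * x i \<partial>LB (blk1 blk (blk i)))"

lemma shifted_square_le: "(x - a)\<^sup>2 \<le> 2 * x\<^sup>2 + 2 * a\<^sup>2" for x a :: real
  using sum_power2_ge_zero[of "x + a" 0] by (simp add: power2_eq_square algebra_simps)

lemma
  fixes blk :: "'n \<Rightarrow> nat"
  assumes "valid_factors blk A qf" "sq_moments blk A qf" "k \<in> A" "i \<in> blk1 blk k"
  shows integrable_factor_linear: "integrable (LB (blk1 blk k)) (\<lambda>x. qf k x * (x i - a))"
    and integrable_factor_product:
      "j \<in> blk1 blk k \<Longrightarrow> integrable (LB (blk1 blk k)) (\<lambda>x. qf k x * ((x i - a) * (x j - b)))"
proof -
  let ?M = "LB (blk1 blk k)"
  have d: "is_density ?M (qf k)" using assms by (simp add: valid_factors_def)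
  have q0: "x \<in> space ?M \<Longrightarrow> 0 \<le> qf k x" for x using d by (simp add: is_density_def)
  have qm: "qf k \<in> borel_measurable ?M" using d by (simp add: is_density_def)
  have qi: "integrable ?M (qf k)" using integral_is_density[OF d] by (simp add: has_bochner_integral_iff)
  have sq: "integrable ?M (\<lambda>x. qf k x * (x l)\<^sup>2)" if "l \<in> blk1 blk k" for l
    using assms that by (simp add: sq_moments_def)
  have xm: "(\<lambda>x. x l) \<in> borel_measurable ?M" if "l \<in> blk1 blk k" for l
    using that by (rule measurable_LB_component)
  show "integrable ?M (\<lambda>x. qf k x * (x i - a))"
  proof (rule Bochner_Integration.integrable_bound)
    show "integrable ?M (\<lambda>x. qf k x + 2 * (qf k x * (x i)\<^sup>2) + 2 * a\<^sup>2 * qf k x)"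
      by (intro Bochner_Integration.integrable_add integrable_mult_right qi sq assms)
    show "(\<lambda>x. qf k x * (x i - a)) \<in> borel_measurable ?M"
      using qm xm[OF assms(4)] by measurable
    show "AE x in ?M. norm (qf k x * (x i - a)) \<le> norm (qf k x + 2 * (qf k x * (x i)\<^sup>2) + 2 * a\<^sup>2 * qf k x)"
    proof (rule AE_I2)
      fix x assume x: "x \<in> space ?M"
      have "\<bar>x i - a\<bar> \<le> 1 + (x i - a)\<^sup>2"
        using sum_power2_ge_zero[of "\<bar>x i - a\<bar> - 1/2" 0] by (simp add: power2_eq_square algebra_simps)
      also have "\<dots> \<le> 1 + (2 * (x i)\<^sup>2 + 2 * a\<^sup>2)" using shifted_square_le[of "x i" a] by simp
      finally have "qf k x * \<bar>x i - a\<bar> \<le> qf k x * (1 + (2 * (x i)\<^sup>2 + 2 * a\<^sup>2))"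
        by (rule mult_left_mono) (rule q0[OF x])
      moreover have "norm (qf k x * (x i - a)) = qf k x * \<bar>x i - a\<bar>" using q0[OF x] by (simp add: abs_mult)
      moreover have "qf k x * (1 + (2 * (x i)\<^sup>2 + 2 * a\<^sup>2)) = qf k x + 2 * (qf k x * (x i)\<^sup>2) + 2 * a\<^sup>2 * qf k x"
        by (simp add: algebra_simps)
      ultimately show "norm (qf k x * (x i - a)) \<le> norm (qf k x + 2 * (qf k x * (x i)\<^sup>2) + 2 * a\<^sup>2 * qf k x)"
        unfolding real_norm_def by linarith
    qed
  qed
  show "integrable ?M (\<lambda>x. qf k x * ((x i - a) * (x j - b)))" if j: "j \<in> blk1 blk k"
  proof (rule Bochner_Integration.integrable_bound)
    show "integrable ?M (\<lambda>x. 2 * (qf k x * (x i)\<^sup>2) + 2 * (qf k x * (x j)\<^sup>2) + (2 * a\<^sup>2 + 2 * b\<^sup>2) * qf k x)"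
      by (intro Bochner_Integration.integrable_add integrable_mult_right qi sq assms j)
    show "(\<lambda>x. qf k x * ((x i - a) * (x j - b))) \<in> borel_measurable ?M"
      using qm xm[OF assms(4)] xm[OF j] by measurable
    show "AE x in ?M. norm (qf k x * ((x i - a) * (x j - b)))
        \<le> norm (2 * (qf k x * (x i)\<^sup>2) + 2 * (qf k x * (x j)\<^sup>2) + (2 * a\<^sup>2 + 2 * b\<^sup>2) * qf k x)"
    proof (rule AE_I2)
      fix x assume x: "x \<in> space ?M"
      have "2 * (\<bar>x i - a\<bar> * \<bar>x j - b\<bar>) \<le> (x i - a)\<^sup>2 + (x j - b)\<^sup>2"
        using sum_squares_bound[of "\<bar>x i - a\<bar>" "\<bar>x j - b\<bar>"] by (simp add: mult.assoc)
      then have "\<bar>x i - a\<bar> * \<bar>x j - b\<bar> \<le> (x i - a)\<^sup>2 + (x j - b)\<^sup>2"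
        using mult_nonneg_nonneg[of "\<bar>x i - a\<bar>" "\<bar>x j - b\<bar>"] by linarith
      also have "\<dots> \<le> (2 * (x i)\<^sup>2 + 2 * a\<^sup>2) + (2 * (x j)\<^sup>2 + 2 * b\<^sup>2)"
        by (intro add_mono shifted_square_le)
      finally have "qf k x * (\<bar>x i - a\<bar> * \<bar>x j - b\<bar>) \<le> qf k x * ((2 * (x i)\<^sup>2 + 2 * a\<^sup>2) + (2 * (x j)\<^sup>2 + 2 * b\<^sup>2))"
        by (rule mult_left_mono) (rule q0[OF x])
      moreover have "norm (qf k x * ((x i - a) * (x j - b))) = qf k x * (\<bar>x i - a\<bar> * \<bar>x j - b\<bar>)"
        using q0[OF x] by (simp add: abs_mult)
      moreover have "qf k x * ((2 * (x i)\<^sup>2 + 2 * a\<^sup>2) + (2 * (x j)\<^sup>2 + 2 * b\<^sup>2))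
          = 2 * (qf k x * (x i)\<^sup>2) + 2 * (qf k x * (x j)\<^sup>2) + (2 * a\<^sup>2 + 2 * b\<^sup>2) * qf k x"
        by (simp add: algebra_simps)
      ultimately show "norm (qf k x * ((x i - a) * (x j - b)))
        \<le> norm (2 * (qf k x * (x i)\<^sup>2) + 2 * (qf k x * (x j)\<^sup>2) + (2 * a\<^sup>2 + 2 * b\<^sup>2) * qf k x)"
        unfolding real_norm_def by linarith
    qed
  qed
qed

lemma integral_factor_linear:
  fixes blk :: "'n \<Rightarrow> nat"
  assumes "valid_factors blk A qf" "sq_moments blk A qf" "blk i \<in> A"
  shows "(\<integral>x. qf (blk i) x * (x i - a) \<partial>LB (blk1 blk (blk i))) = fmean blk qf i - a"
proof -
  have i: "i \<in> blk1 blk (blk i)" by (simp add: blockset_def)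
  have d: "has_bochner_integral (LB (blk1 blk (blk i))) (qf (blk i)) 1"
    using assms by (intro integral_is_density) (simp add: valid_factors_def)
  have l: "integrable (LB (blk1 blk (blk i))) (\<lambda>x. qf (blk i) x * (x i - 0))"
    by (rule integrable_factor_linear[OF assms i])
  have "(\<integral>x. qf (blk i) x * (x i - a) \<partial>LB (blk1 blk (blk i)))
      = (\<integral>x. qf (blk i) x * (x i - 0) - a * qf (blk i) x \<partial>LB (blk1 blk (blk i)))"
    by (simp add: algebra_simps)
  also have "\<dots> = fmean blk qf i - a"
    using d l by (subst Bochner_Integration.integral_diff) (auto simp: fmean_def has_bochner_integral_iff)
  finally show ?thesis .
qed

text \<open>Linear factors in different blocks integrate separately, each to its centred mean, so no
  covariance appears across blocks. Within one block only integrability is asserted, through the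
  marginal.\<close>

lemma
  fixes blk :: "'n::finite \<Rightarrow> nat"
  assumes A: "finite A" "valid_factors blk A qf" "sq_moments blk A qf" and i: "blk i \<in> A"
  shows expectation_linear:
      "has_bochner_integral (LB (blockset blk A)) (\<lambda>y. prodf blk A qf y * (y i - a)) (fmean blk qf i - a)"
    and expectation_cross: "blk j \<in> A \<Longrightarrow> blk i \<noteq> blk j \<Longrightarrow>
      has_bochner_integral (LB (blockset blk A)) (\<lambda>y. prodf blk A qf y * ((y i - a) * (y j - b)))
        ((fmean blk qf i - a) * (fmean blk qf j - b))"
    and integrable_product: "blk j \<in> A \<Longrightarrow>
      integrable (LB (blockset blk A)) (\<lambda>y. prodf blk A qf y * ((y i - a) * (y j - b)))"
proof -
  have mem: "l \<in> blk1 blk (blk l)" for l :: 'n by (simp add: blockset_def)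
  have meas: "(\<lambda>x. x l - c) \<in> borel_measurable (LB (blk1 blk (blk l)))" for l :: 'n and c
    by (intro borel_measurable_diff measurable_LB_component mem borel_measurable_const)
  show "has_bochner_integral (LB (blockset blk A)) (\<lambda>y. prodf blk A qf y * (y i - a)) (fmean blk qf i - a)"
    using block_marginal_integrable[OF A(1,2) i meas[of i a]] block_marginal_integral[OF A(1,2) i meas[of i a]]
      integrable_factor_linear[OF A(2,3) i mem] integral_factor_linear[OF A(2,3) i]
    by (simp add: has_bochner_integral_iff mem)
  show cross: "has_bochner_integral (LB (blockset blk A)) (\<lambda>y. prodf blk A qf y * ((y i - a) * (y j - b)))
        ((fmean blk qf i - a) * (fmean blk qf j - b))" if j: "blk j \<in> A" "blk i \<noteq> blk j"
  proof -
    define f where "f l x = qf l x * ((if l = blk i then x i - a else 1) * (if l = blk j then x j - b else 1))"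
      for l and x :: "'n \<Rightarrow> real"
    have fint: "integrable (LB (blk1 blk l)) (f l)" and fval: "(\<integral>x. f l x \<partial>LB (blk1 blk l))
        = (if l = blk i then fmean blk qf i - a else 1) * (if l = blk j then fmean blk qf j - b else 1)"
      if l: "l \<in> A" for l
    proof -
      have d: "has_bochner_integral (LB (blk1 blk l)) (qf l) 1"
        using A(2) l by (intro integral_is_density) (simp add: valid_factors_def)
      consider "l = blk i" | "l = blk j" "l \<noteq> blk i" | "l \<noteq> blk i" "l \<noteq> blk j" by blast
      then have "integrable (LB (blk1 blk l)) (f l) \<and> (\<integral>x. f l x \<partial>LB (blk1 blk l))
        = (if l = blk i then fmean blk qf i - a else 1) * (if l = blk j then fmean blk qf j - b else 1)"
      proof cases
        case 1
        then show ?thesis unfolding f_def[abs_def]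
          using j integrable_factor_linear[OF A(2,3) i mem] integral_factor_linear[OF A(2,3) i] by simp
      next
        case 2
        then show ?thesis unfolding f_def[abs_def]
          using j integrable_factor_linear[OF A(2,3) j(1) mem] integral_factor_linear[OF A(2,3) j(1)] by simp
      next
        case 3
        then show ?thesis unfolding f_def[abs_def] using d by (simp add: has_bochner_integral_iff)
      qed
      then show "integrable (LB (blk1 blk l)) (f l)" "(\<integral>x. f l x \<partial>LB (blk1 blk l))
        = (if l = blk i then fmean blk qf i - a else 1) * (if l = blk j then fmean blk qf j - b else 1)" by auto
    qed
    have prodif: "(\<Prod>l\<in>A. (if l = blk i then c else 1) * (if l = blk j then d else 1)) = c * d" for c d :: real
      using A(1) i j by (simp add: prod.distrib)
    have feq: "(\<Prod>l\<in>A. f l (restrict y (blk1 blk l))) = prodf blk A qf y * ((y i - a) * (y j - b))" for y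
    proof -
      have "(\<Prod>l\<in>A. f l (restrict y (blk1 blk l))) = (\<Prod>l\<in>A. qf l (restrict y (blk1 blk l))
          * ((if l = blk i then y i - a else 1) * (if l = blk j then y j - b else 1)))"
        using j(2) by (intro prod.cong refl) (auto simp: f_def mem)
      then show ?thesis by (simp only: prod.distrib[of "\<lambda>l. qf l (restrict y (blk1 blk l))"] prodif prodf_def)
    qed
    have "integrable (LB (blockset blk A)) (\<lambda>y. \<Prod>l\<in>A. f l (restrict y (blk1 blk l)))"
      by (rule integrable_block_prod[OF A(1) fint])
    moreover have "(\<integral>y. (\<Prod>l\<in>A. f l (restrict y (blk1 blk l))) \<partial>LB (blockset blk A))
        = (fmean blk qf i - a) * (fmean blk qf j - b)"
      by (simp only: integral_block_prod[OF A(1) fint] fval prodif cong: prod.cong)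
    ultimately show ?thesis unfolding feq by (simp add: has_bochner_integral_iff)
  qed
  show "integrable (LB (blockset blk A)) (\<lambda>y. prodf blk A qf y * ((y i - a) * (y j - b)))" if j: "blk j \<in> A"
  proof (cases "blk i = blk j")
    case True
    then have mj: "j \<in> blk1 blk (blk i)" using mem[of j] by simp
    have "(\<lambda>x. (x i - a) * (x j - b)) \<in> borel_measurable (LB (blk1 blk (blk i)))"
      using meas[of i a] meas[of j b] True by (intro borel_measurable_times) auto
    from block_marginal_integrable[OF A(1,2) i this] integrable_factor_product[OF A(2,3) i mem mj, of a b]
    show ?thesis using mj mem[of i] by simp
  next
    case False
    then show ?thesis using cross[OF j] by (simp add: has_bochner_integral_iff)
  qed
qed

section \<open>The evidence lower bound\<close>

lemma is_density_gker:
  assumes "pd_on S M"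
  shows "is_density (LB S) (\<lambda>x. gker M S m x / gZ M S)"
proof -
  have Z: "gZ M S > 0" by (rule gZ_pos[OF assms])
  have int: "integrable (LB S) (\<lambda>x. gker M S m x / gZ M S)"
    by (intro integrable_divide integrable_gker assms)
  have "(\<integral>\<^sup>+x. ennreal (gker M S m x / gZ M S) \<partial>LB S) = ennreal (\<integral>x. gker M S m x / gZ M S \<partial>LB S)"
    using Z by (intro nn_integral_eq_integral int) (auto simp: gker_pos less_imp_le)
  also have "\<dots> = 1" using Z integral_gker[of S M m] by simp
  finally show ?thesis
    using Z int by (auto simp: is_density_def gker_pos less_imp_le)
qed

context gauss_cavi
begin

section \<open>Marginal, conditional and block normal laws\<close>

abbreviation pd :: "('n \<Rightarrow> real) \<Rightarrow> real" where "pd \<equiv> gauss Q mu"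

text \<open>The normal law on block \<open>k\<close> whose precision is the diagonal block of
  \<open>T\<close>. Only the coordinates of \<open>m\<close> in that block matter.\<close>

definition nrm :: "nat \<Rightarrow> ('n \<Rightarrow> real) \<Rightarrow> ('n \<Rightarrow> real) \<Rightarrow> real" where
  "nrm k m x = gker T (blk1 blk k) m x / gZ T (blk1 blk k)"

definition center :: "('n \<Rightarrow> real) \<Rightarrow> 'n \<Rightarrow> real" where
  "center \<theta> i = mu i + lift (\<lambda>j. \<theta> j - mu j) i"

lemma gZ_block_pos: "k \<in> U \<Longrightarrow> gZ T (blk1 blk k) > 0"
  by (rule gZ_pos[OF T_pd_block])

lemma gZ_C_pos: "gZ Q (- B) > 0"
  by (rule gZ_pos[OF pd_on_subset[OF Q_pd]]) simp

lemma gZ_Q_pos: "gZ Q UNIV > 0"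
  by (rule gZ_pos[OF Q_pd])

lemma nrm_pos: "k \<in> U \<Longrightarrow> nrm k m x > 0"
  by (simp add: nrm_def gker_pos gZ_block_pos)

lemma is_density_nrm: "k \<in> U \<Longrightarrow> is_density (LB (blk1 blk k)) (nrm k m)"
  unfolding nrm_def[abs_def] by (rule is_density_gker[OF T_pd_block])

lemma nrm_cong: "(\<And>i. i \<in> blk1 blk k \<Longrightarrow> m i = n i) \<Longrightarrow> nrm k m = nrm k n"
proof
  fix x assume "\<And>i. i \<in> blk1 blk k \<Longrightarrow> m i = n i"
  then have "gker T (blk1 blk k) m x = gker T (blk1 blk k) n x" by (intro gker_cong) simp
  then show "nrm k m x = nrm k n x" by (simp add: nrm_def)
qed

lemma ln_nrm: "k \<in> U \<Longrightarrow> ln (nrm k m x) = - cquad T (blk1 blk k) m x / 2 - ln (gZ T (blk1 blk k))"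
  using gZ_block_pos[of k] by (simp add: nrm_def ln_div gker_pos) (simp add: gker_def)

lemma nrm_moments:
  assumes "k \<in> U" "i \<in> blk1 blk k"
  shows nrm_mean: "has_bochner_integral (LB (blk1 blk k)) (\<lambda>x. nrm k m x * x i) (m i)"
    and nrm_square: "integrable (LB (blk1 blk k)) (\<lambda>x. nrm k m x * (x i)\<^sup>2)"
proof -
  let ?S = "blk1 blk k" and ?Z = "gZ T (blk1 blk k)"
  note pdk = T_pd_block[OF assms(1)]
  have Z: "?Z > 0" by (rule gZ_block_pos[OF assms(1)])
  \<comment> \<open>Column \<open>i\<close> of the inverse of the diagonal block: it represents the
    centred coordinate function as \<open>bil T a\<close>, to which \<open>gker_moments\<close>
    applies.\<close>
  obtain a where "supp_on ?S a \<and> (\<forall>l\<in>?S. (\<Sum>j\<in>UNIV. T l j * a j) = (if l = i then 1 else 0))"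
    using pd_on_solve[OF pdk, of "\<lambda>l. if l = i then 1 else 0"] ..
  then have a: "supp_on ?S a" "\<And>l. l \<in> ?S \<Longrightarrow> (\<Sum>j\<in>UNIV. T l j * a j) = (if l = i then 1 else 0)"
    by auto
  have Y: "bil T a (coord_proj ?S (\<lambda>l. x l - m l)) = x i - m i" for x
  proof -
    have "bil T a (coord_proj ?S (\<lambda>l. x l - m l)) = bil T (coord_proj ?S (\<lambda>l. x l - m l)) a"
      by (rule bil_commute[OF T_sym])
    also have "\<dots> = (\<Sum>l\<in>UNIV. if l = i then x i - m i else 0)"
      unfolding bil_rows
    proof (rule sum.cong[OF refl])
      fix l
      show "coord_proj ?S (\<lambda>l. x l - m l) l * (\<Sum>j\<in>UNIV. T l j * a j) = (if l = i then x i - m i else 0)"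
        using a(2)[of l] assms(2) by (cases "l \<in> ?S") (auto simp: coord_proj_def)
    qed
    also have "\<dots> = x i - m i" by simp
    finally show ?thesis .
  qed
  have 0: "has_bochner_integral (LB ?S) (nrm k m) 1"
    by (rule integral_is_density[OF is_density_nrm[OF assms(1)]])
  have 1: "has_bochner_integral (LB ?S) (\<lambda>x. (x i - m i) * gker T ?S m x / ?Z) (0 / ?Z)"
    by (rule has_bochner_integral_divide) (rule gker_moments(1)[OF pdk a(1), of m, unfolded Y])
  have 2: "has_bochner_integral (LB ?S) (\<lambda>x. (x i - m i)\<^sup>2 * gker T ?S m x / ?Z) (quadform T a * ?Z / ?Z)"
    by (rule has_bochner_integral_divide) (rule gker_moments(2)[OF pdk a(1), of m, unfolded Y])
  have "has_bochner_integral (LB ?S) (\<lambda>x. (x i - m i) * gker T ?S m x / ?Z + m i * nrm k m x) (0 / ?Z + m i * 1)"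
    by (intro has_bochner_integral_add has_bochner_integral_mult_right 0 1)
  moreover have "(x i - m i) * gker T ?S m x / ?Z + m i * nrm k m x = nrm k m x * x i" for x
    by (simp add: nrm_def algebra_simps diff_divide_distrib)
  ultimately show "has_bochner_integral (LB ?S) (\<lambda>x. nrm k m x * x i) (m i)" by simp
  have "integrable (LB ?S) (\<lambda>x. (x i - m i)\<^sup>2 * gker T ?S m x / ?Z + 2 * m i * ((x i - m i) * gker T ?S m x / ?Z) + (m i)\<^sup>2 * nrm k m x)"
    by (intro Bochner_Integration.integrable_add integrable_mult_right integrable.intros[OF 0]
        integrable.intros[OF 1] integrable.intros[OF 2])
  moreover have "(x i - m i)\<^sup>2 * gker T ?S m x / ?Z + 2 * m i * ((x i - m i) * gker T ?S m x / ?Z) + (m i)\<^sup>2 * nrm k m x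
      = nrm k m x * (x i)\<^sup>2" for x
    by (simp add: nrm_def algebra_simps power2_eq_square diff_divide_distrib add_divide_distrib)
  ultimately show "integrable (LB ?S) (\<lambda>x. nrm k m x * (x i)\<^sup>2)" by simp
qed

lemma quadform_T_cong: "(\<And>i. i \<in> B \<Longrightarrow> x i = y i) \<Longrightarrow> quadform T x = quadform T y"
  using lift_cong[of x y] by (simp add: quadform_bil bil_T)

lemma cquad_T_B: "cquad T B m y = quadform T (\<lambda>i. y i - m i)"
  unfolding cquad_def by (rule quadform_T_proj)

lemma cquad_C_center: "cquad Q (- B) (center \<theta>) \<theta> = quadform Q (\<lambda>i. (\<theta> i - mu i) - lift (\<lambda>j. \<theta> j - mu j) i)"
proof -
  have "coord_proj (- B) (\<lambda>i. \<theta> i - center \<theta> i) = (\<lambda>i. (\<theta> i - mu i) - lift (\<lambda>j. \<theta> j - mu j) i)"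
    by (auto simp: coord_proj_def center_def lift_B fun_eq_iff)
  then show ?thesis by (simp add: cquad_def)
qed

text \<open>\<open>center \<theta>\<close> is, off \<open>B\<close>, the conditional mean of the Gaussian given the coordinates in \<open>B\<close>.\<close>
lemma gker_split: "gker Q UNIV mu \<theta> = gker T B mu \<theta> * gker Q (- B) (center \<theta>) \<theta>"
proof -
  have "cquad Q UNIV mu \<theta> = cquad T B mu \<theta> + cquad Q (- B) (center \<theta>) \<theta>"
    unfolding cquad_T_B cquad_C_center
    using quadform_Q_split[of "\<lambda>i. \<theta> i - mu i"] by (simp add: cquad_def coord_proj_def)
  then show ?thesis by (simp add: gker_def add_divide_distrib flip: exp_add)
qed

lemma center_merge: "center (merge (- B) B (x, y)) = center y"
  unfolding center_def
  by (intro ext arg_cong2[where f="(+)"] refl fun_cong[OF lift_cong]) (auto simp: merge_def)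

lemma margU_eq: "margU blk U pd y = gker T B mu y * (gZ Q (- B) / gZ Q UNIV)"
proof -
  have "pd (merge (- B) B (x, y)) = gker T B mu y / gZ Q UNIV * gker Q (- B) (center y) x" for x
  proof -
    have "gker T B mu (merge (- B) B (x, y)) = gker T B mu y"
      by (rule gker_cong) (auto simp: merge_def)
    moreover have "gker Q (- B) (center y) (merge (- B) B (x, y)) = gker Q (- B) (center y) x"
      by (rule gker_cong) (auto simp: merge_def)
    ultimately show ?thesis by (simp add: gauss_eq_gker gker_split center_merge)
  qed
  then show ?thesis unfolding margU_def using integral_gker[of "- B" Q "center y"] by simp
qed

lemma margU_pos: "margU blk U pd y > 0"
  by (simp add: margU_eq gker_pos gZ_C_pos gZ_Q_pos)

lemma gker_T_restrict: "gker T B mu (restrict \<theta> B) = gker T B mu \<theta>"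
  by (rule gker_cong) simp

lemma condC_eq: "condC blk U pd \<theta> = gker Q (- B) (center \<theta>) \<theta> / gZ Q (- B)"
  unfolding condC_def margU_eq gker_T_restrict gauss_eq_gker gker_split
  using gker_pos[of T B mu \<theta>] gZ_C_pos gZ_Q_pos by (simp add: field_simps)

lemma condC_pos: "condC blk U pd \<theta> > 0"
  by (simp add: condC_eq gker_pos gZ_C_pos)

lemma pd_eq: "pd \<theta> = condC blk U pd \<theta> * margU blk U pd (restrict \<theta> B)"
  using margU_pos[of "restrict \<theta> B"] by (simp add: condC_def)

lemma measurable_condC: "condC blk U pd \<in> borel_measurable Lp"
proof -
  have "condC blk U pd = (\<lambda>\<theta>. gker Q UNIV mu \<theta> / gker T B mu \<theta> / gZ Q (- B))"
    using gker_pos[of T B mu] by (auto simp: condC_eq gker_split less_imp_neq[THEN not_sym])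
  moreover have "(\<lambda>\<theta>. gker Q UNIV mu \<theta> / gker T B mu \<theta> / gZ Q (- B)) \<in> borel_measurable Lp"
    by (intro borel_measurable_divide measurable_gker borel_measurable_const subset_UNIV)
  ultimately show ?thesis by simp
qed

lemma factorized_qjoint:
  assumes "valid_factors blk U qf"
  shows "factorized blk U (condC blk U pd) qf (qjoint blk U pd qf)"
  unfolding factorized_def
proof (intro conjI ballI allI assms measurable_condC)
  fix y
  have "condC blk U pd (merge (- B) B (x, y)) = gker Q (- B) (center y) x / gZ Q (- B)" for x
  proof -
    have "gker Q (- B) (center y) (merge (- B) B (x, y)) = gker Q (- B) (center y) x"
      by (rule gker_cong) (auto simp: merge_def)
    then show ?thesis by (simp add: condC_eq center_merge)
  qed
  then show "is_density (LB (- B)) (\<lambda>x. condC blk U pd (merge (- B) B (x, y)))"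
    using is_density_gker[OF pd_on_subset[OF Q_pd subset_UNIV], of "- B" "center y"] by simp
next
  fix \<theta> show "qjoint blk U pd qf \<theta> = condC blk U pd \<theta> * prodf blk U qf \<theta>" by (simp add: qjoint_def)
qed

text \<open>Log normalising constant of the product of block normals minus that of the marginal
  kernel. It turns out to be the maximum of V over the family.\<close>

definition V0 :: real where
  "V0 = ln (gZ Q (- B) / gZ Q UNIV) + (\<Sum>k\<in>U. ln (gZ T (blk1 blk k)))"

text \<open>Up to a constant, twice the log of the product of block normals centred at
  \<open>m\<close> minus twice the log marginal; see \<open>ln_margU\<close>.\<close>

definition dquad :: "('n \<Rightarrow> real) \<Rightarrow> ('n \<Rightarrow> real) \<Rightarrow> real" where
  "dquad m y = cquad T B mu y - (\<Sum>k\<in>U. cquad T (blk1 blk k) m y)"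

lemma ln_margU: "ln (margU blk U pd y) = V0 - dquad m y / 2 + (\<Sum>k\<in>U. ln (nrm k m (restrict y (blk1 blk k))))"
proof -
  have "cquad T (blk1 blk k) m (restrict y (blk1 blk k)) = cquad T (blk1 blk k) m y" for k
    by (rule cquad_cong) simp
  then have "(\<Sum>k\<in>U. ln (nrm k m (restrict y (blk1 blk k))))
      = (\<Sum>k\<in>U. - cquad T (blk1 blk k) m y / 2 - ln (gZ T (blk1 blk k)))"
    by (intro sum.cong refl) (simp add: ln_nrm)
  moreover have "ln (margU blk U pd y) = - cquad T B mu y / 2 + ln (gZ Q (- B) / gZ Q UNIV)"
    unfolding margU_eq using gZ_C_pos gZ_Q_pos
    by (subst ln_mult_pos) (auto simp: gker_pos gker_def)
  ultimately show ?thesis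
    by (simp add: V0_def dquad_def sum_subtractf sum_negf sum_divide_distrib diff_divide_distrib)
qed

lemma measurable_dquad: "dquad m \<in> borel_measurable (LB B)"
  unfolding dquad_def[abs_def]
  by (intro borel_measurable_diff borel_measurable_sum measurable_cquad blk1_sub order_refl)

lemma sum_cquad_blocks: "(\<Sum>k\<in>U. cquad T (blk1 blk k) m y) = quadform D (\<lambda>i. y i - m i)"
  by (simp add: quadform_D cquad_def)

text \<open>Around \<open>m\<close> the quadratic terms within a block cancel between
  \<open>T\<close> and \<open>D\<close>. Only products across blocks survive, so the variances of
  the factors do not enter its expectation.\<close>

lemma dquad_expand:
  "dquad m y = (\<Sum>i\<in>UNIV. \<Sum>j\<in>UNIV. (if blk i = blk j then 0 else T i j) * ((y i - m i) * (y j - m j)))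
     + (\<Sum>i\<in>UNIV. \<Sum>j\<in>UNIV. 2 * T i j * (m j - mu j) * (y i - m i)) + quadform T (\<lambda>i. m i - mu i)"
proof -
  have "cquad T B mu y = quadform T (\<lambda>i. (y i - m i) + (m i - mu i))" by (simp add: cquad_T_B)
  also have "\<dots> = quadform T (\<lambda>i. y i - m i) + 2 * bil T (\<lambda>i. y i - m i) (\<lambda>i. m i - mu i) + quadform T (\<lambda>i. m i - mu i)"
    by (rule quadform_add[OF T_sym])
  finally have "dquad m y = (quadform T (\<lambda>i. y i - m i) - quadform D (\<lambda>i. y i - m i))
      + 2 * bil T (\<lambda>i. y i - m i) (\<lambda>i. m i - mu i) + quadform T (\<lambda>i. m i - mu i)"
    by (simp add: dquad_def sum_cquad_blocks)
  moreover have "quadform T (\<lambda>i. y i - m i) - quadform D (\<lambda>i. y i - m i)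
      = (\<Sum>i\<in>UNIV. \<Sum>j\<in>UNIV. (if blk i = blk j then 0 else T i j) * ((y i - m i) * (y j - m j)))"
    unfolding quadform_def sum_subtractf[symmetric]
    by (intro sum.cong refl) (simp add: D_def)
  moreover have "2 * bil T (\<lambda>i. y i - m i) (\<lambda>i. m i - mu i)
      = (\<Sum>i\<in>UNIV. \<Sum>j\<in>UNIV. 2 * T i j * (m j - mu j) * (y i - m i))"
    unfolding bil_def sum_distrib_left by (intro sum.cong refl) simp
  ultimately show ?thesis by simp
qed

lemma B_iff: "i \<in> B \<longleftrightarrow> blk i \<in> U" by (simp add: blockset_def)

text \<open>Blocks are independent under \<open>q\<close>, so the cross-block terms have mean zero around the means.\<close>
lemma expectation_dquad:
  assumes "valid_factors blk U qf" "sq_moments blk U qf"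
  shows "has_bochner_integral (LB B) (\<lambda>y. prodf blk U qf y * dquad (fmean blk qf) y)
      (quadform T (\<lambda>i. fmean blk qf i - mu i))"
proof -
  let ?m = "fmean blk qf" and ?p = "prodf blk U qf" and ?t = "quadform T (\<lambda>i. fmean blk qf i - mu i)"
  have 1: "has_bochner_integral (LB B) (\<lambda>y. (if blk i = blk j then 0 else T i j) * (?p y * ((y i - ?m i) * (y j - ?m j)))) 0" for i j
  proof (cases "blk i \<noteq> blk j \<and> i \<in> B \<and> j \<in> B")
    case True
    then have "has_bochner_integral (LB B) (\<lambda>y. ?p y * ((y i - ?m i) * (y j - ?m j))) ((?m i - ?m i) * (?m j - ?m j))"
      by (intro expectation_cross finite_U assms) (auto simp: B_iff)
    then show ?thesis
      using has_bochner_integral_mult_right[of "if blk i = blk j then 0 else T i j" "LB B"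
          "\<lambda>y. ?p y * ((y i - ?m i) * (y j - ?m j))" 0] by simp
  next
    case False
    then have "(if blk i = blk j then 0 else T i j) = 0" using T_off by auto
    then show ?thesis by (simp only: mult_zero_left) (rule has_bochner_integral_zero)
  qed
  have 2: "has_bochner_integral (LB B) (\<lambda>y. 2 * T i j * (?m j - mu j) * (?p y * (y i - ?m i))) 0" for i j
  proof (cases "i \<in> B")
    case True
    then have "has_bochner_integral (LB B) (\<lambda>y. ?p y * (y i - ?m i)) (?m i - ?m i)"
      by (intro expectation_linear finite_U assms) (auto simp: B_iff)
    then show ?thesis
      using has_bochner_integral_mult_right[of "2 * T i j * (?m j - mu j)" "LB B" "\<lambda>y. ?p y * (y i - ?m i)" 0] by simp
  next
    case False
    then have "T i j = 0" using T_off by auto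
    then show ?thesis by (simp only: mult_zero_left mult_zero_right) (rule has_bochner_integral_zero)
  qed
  have 3: "has_bochner_integral (LB B) ?p 1"
    by (intro integral_is_density is_density_prodf finite_U assms)
  have H: "has_bochner_integral (LB B)
     (\<lambda>y. (\<Sum>i\<in>UNIV. \<Sum>j\<in>UNIV. (if blk i = blk j then 0 else T i j) * (?p y * ((y i - ?m i) * (y j - ?m j))))
       + (\<Sum>i\<in>UNIV. \<Sum>j\<in>UNIV. 2 * T i j * (?m j - mu j) * (?p y * (y i - ?m i))) + ?t * ?p y)
     ((\<Sum>i\<in>(UNIV::'n set). \<Sum>j\<in>(UNIV::'n set). 0) + (\<Sum>i\<in>(UNIV::'n set). \<Sum>j\<in>(UNIV::'n set). 0) + ?t * 1)"
    by (intro has_bochner_integral_add has_bochner_integral_sum has_bochner_integral_mult_right 1 2 3)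
  have eq: "?p y * dquad ?m y = (\<Sum>i\<in>UNIV. \<Sum>j\<in>UNIV. (if blk i = blk j then 0 else T i j) * (?p y * ((y i - ?m i) * (y j - ?m j))))
       + (\<Sum>i\<in>UNIV. \<Sum>j\<in>UNIV. 2 * T i j * (?m j - mu j) * (?p y * (y i - ?m i))) + ?t * ?p y" for y
    unfolding dquad_expand distrib_left sum_distrib_left
    by (intro arg_cong2[where f="(+)"] sum.cong refl) (simp_all only: mult_ac)
  show ?thesis
    unfolding eq using H by (simp only: sum.neutral_const add_0 mult_1_right)
qed


text \<open>Second moments of the joint law around \<open>mu\<close> pass to the marginal on
  \<open>B\<close>, then to each block; recentring at 0 costs a multiple of the density.\<close>

lemma sq_moments_factorized:
  assumes "factorized blk U g qf q" "integrable Lp (\<lambda>\<theta>. q \<theta> * (ln (pd \<theta>) - ln (q \<theta>)))"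
  shows "sq_moments blk U qf"
  unfolding sq_moments_def
proof (intro ballI)
  fix k i assume k: "k \<in> U" and i: "i \<in> blk1 blk k"
  let ?S = "blk1 blk k"
  note v = factorized_valid[OF assms(1)]
  have iB: "i \<in> B" using blk1_sub[OF k] i by blast
  have sqm: "(\<lambda>x. (x i - mu i)\<^sup>2) \<in> borel_measurable (LB S)" if "i \<in> S" for S
    using measurable_LB_component[OF that] by measurable
  have "integrable Lp (\<lambda>\<theta>. q \<theta> * (\<theta> i - mu i)\<^sup>2)"
    by (rule finite_second_moments[OF Q_pd is_density_factorized[OF finite_U assms(1)] assms(2)])
  then have "integrable (LB B) (\<lambda>y. prodf blk U qf y * (y i - mu i)\<^sup>2)"
    using factorized_integrable[OF finite_U assms(1) sqm[OF iB]] iB by simp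
  then have a: "integrable (LB ?S) (\<lambda>x. qf k x * (x i - mu i)\<^sup>2)"
    using block_marginal_integrable[OF finite_U v k sqm[OF i]] i by simp
  have d: "is_density (LB ?S) (qf k)" using v k by (simp add: valid_factors_def)
  have q0: "x \<in> space (LB ?S) \<Longrightarrow> 0 \<le> qf k x" for x using d by (simp add: is_density_def)
  show "integrable (LB ?S) (\<lambda>x. qf k x * (x i)\<^sup>2)"
  proof (rule Bochner_Integration.integrable_bound)
    show "integrable (LB ?S) (\<lambda>x. 2 * (qf k x * (x i - mu i)\<^sup>2) + 2 * (mu i)\<^sup>2 * qf k x)"
      using a integral_is_density[OF d]
      by (intro Bochner_Integration.integrable_add integrable_mult_right) (auto simp: has_bochner_integral_iff)
    have "qf k \<in> borel_measurable (LB ?S)" using d by (simp add: is_density_def)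
    then show "(\<lambda>x. qf k x * (x i)\<^sup>2) \<in> borel_measurable (LB ?S)"
      using measurable_LB_component[OF i] by measurable
    show "AE x in LB ?S. norm (qf k x * (x i)\<^sup>2) \<le> norm (2 * (qf k x * (x i - mu i)\<^sup>2) + 2 * (mu i)\<^sup>2 * qf k x)"
    proof (rule AE_I2)
      fix x assume x: "x \<in> space (LB ?S)"
      have "(x i)\<^sup>2 \<le> 2 * (x i - mu i)\<^sup>2 + 2 * (mu i)\<^sup>2"
        using shifted_square_le[of "x i - mu i" "- mu i"] by simp
      then have "qf k x * (x i)\<^sup>2 \<le> qf k x * (2 * (x i - mu i)\<^sup>2 + 2 * (mu i)\<^sup>2)"
        by (rule mult_left_mono) (rule q0[OF x])
      moreover have "0 \<le> qf k x * (x i)\<^sup>2" using q0[OF x] by simp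
      moreover have "qf k x * (2 * (x i - mu i)\<^sup>2 + 2 * (mu i)\<^sup>2) = 2 * (qf k x * (x i - mu i)\<^sup>2) + 2 * (mu i)\<^sup>2 * qf k x"
        by (simp only: distrib_left mult_ac)
      ultimately show "norm (qf k x * (x i)\<^sup>2) \<le> norm (2 * (qf k x * (x i - mu i)\<^sup>2) + 2 * (mu i)\<^sup>2 * qf k x)"
        unfolding real_norm_def by linarith
    qed
  qed
qed

section \<open>Decomposition of V into divergences and a quadratic term\<close>

definition mean_err :: "(nat \<Rightarrow> ('n \<Rightarrow> real) \<Rightarrow> real) \<Rightarrow> 'n \<Rightarrow> real" where
  "mean_err qf i = fmean blk qf i - mu i"

definition log_ratio :: "(nat \<Rightarrow> ('n \<Rightarrow> real) \<Rightarrow> real) \<Rightarrow> nat \<Rightarrow> ('n \<Rightarrow> real) \<Rightarrow> real" where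
  "log_ratio qf k x = ln (qf k x) - ln (nrm k (fmean blk qf) x)"

definition block_KL :: "(nat \<Rightarrow> ('n \<Rightarrow> real) \<Rightarrow> real) \<Rightarrow> nat \<Rightarrow> real" where
  "block_KL qf k = (\<integral>x. qf k x * log_ratio qf k x \<partial>LB (blk1 blk k))"

text \<open>Bochner integrals of non-integrable functions default to 0, so integrability of each
  divergence integrand is carried along to make every term of the decomposition genuine.\<close>

definition regular :: "(nat \<Rightarrow> ('n \<Rightarrow> real) \<Rightarrow> real) \<Rightarrow> bool" where
  "regular qf \<longleftrightarrow> valid_factors blk U qf \<and> sq_moments blk U qf
     \<and> (\<forall>k\<in>U. integrable (LB (blk1 blk k)) (\<lambda>x. qf k x * log_ratio qf k x))"

definition elbo_int :: "(nat \<Rightarrow> ('n \<Rightarrow> real) \<Rightarrow> real) \<Rightarrow> ('n \<Rightarrow> real) \<Rightarrow> real" where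
  "elbo_int qf y = V0 - dquad (fmean blk qf) y / 2 - (\<Sum>k\<in>U. log_ratio qf k (restrict y (blk1 blk k)))"

lemma dquad_restrict: "dquad m (restrict \<theta> B) = dquad m \<theta>"
proof -
  have "cquad T B mu (restrict \<theta> B) = cquad T B mu \<theta>" by (rule cquad_cong) simp
  moreover have "cquad T (blk1 blk k) m (restrict \<theta> B) = cquad T (blk1 blk k) m \<theta>" if "k \<in> U" for k
    by (rule cquad_cong) (use blk1_sub[OF that] in auto)
  ultimately show ?thesis by (simp add: dquad_def)
qed

lemma B_Int_block: "k \<in> U \<Longrightarrow> B \<inter> blk1 blk k = blk1 blk k"
  using blk1_sub[of k] by (rule Int_absorb1)

text \<open>The conditional density cancels in the log ratio, leaving a function of the coordinates
  in \<open>B\<close>. Logarithms are split only where all factors are positive; elsewhere both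
  sides are 0.\<close>

lemma qjoint_integrand:
  assumes "valid_factors blk U qf"
  shows "qjoint blk U pd qf \<theta> * (ln (pd \<theta>) - ln (qjoint blk U pd qf \<theta>))
    = qjoint blk U pd qf \<theta> * elbo_int qf (restrict \<theta> B)"
proof (cases "qjoint blk U pd qf \<theta> = 0")
  case False
  have q0: "0 \<le> qf k (restrict \<theta> (blk1 blk k))" if "k \<in> U" for k
    using assms that by (auto simp: valid_factors_def is_density_def space_LB)
  have nz: "qf k (restrict \<theta> (blk1 blk k)) \<noteq> 0" if "k \<in> U" for k
    using False that finite_U by (auto simp: qjoint_def prodf_def)
  have pos: "0 < qf k (restrict \<theta> (blk1 blk k))" if "k \<in> U" for k
    using q0[OF that] nz[OF that] by simp
  have "ln (prodf blk U qf \<theta>) = (\<Sum>k\<in>U. ln (qf k (restrict \<theta> (blk1 blk k))))"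
    unfolding prodf_def by (rule ln_prod) (use nz finite_U in blast)+
  moreover have "0 < prodf blk U qf \<theta>" unfolding prodf_def by (rule prod_pos) (rule pos)
  ultimately have "ln (qjoint blk U pd qf \<theta>) = ln (condC blk U pd \<theta>) + (\<Sum>k\<in>U. ln (qf k (restrict \<theta> (blk1 blk k))))"
    unfolding qjoint_def using condC_pos[of \<theta>] by (simp add: ln_mult_pos)
  moreover have "ln (pd \<theta>) = ln (condC blk U pd \<theta>) + ln (margU blk U pd (restrict \<theta> B))"
    using pd_eq[of \<theta>] ln_mult_pos[OF condC_pos[of \<theta>] margU_pos[of "restrict \<theta> B"]] by simp
  moreover have "elbo_int qf (restrict \<theta> B) = ln (margU blk U pd (restrict \<theta> B)) - (\<Sum>k\<in>U. ln (qf k (restrict \<theta> (blk1 blk k))))"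
    unfolding ln_margU[of _ "fmean blk qf"] elbo_int_def log_ratio_def
    by (simp add: sum_subtractf B_Int_block)
  ultimately show ?thesis by simp
qed simp

lemma measurable_nrm: "k \<in> U \<Longrightarrow> nrm k m \<in> borel_measurable (LB (blk1 blk k))"
  using is_density_nrm[of k m] by (simp add: is_density_def)

lemma measurable_log_ratio:
  assumes "valid_factors blk U qf" "k \<in> U"
  shows "log_ratio qf k \<in> borel_measurable (LB (blk1 blk k))"
proof -
  have [measurable]: "qf k \<in> borel_measurable (LB (blk1 blk k))"
    using assms by (simp add: valid_factors_def is_density_def)
  have [measurable]: "nrm k (fmean blk qf) \<in> borel_measurable (LB (blk1 blk k))"
    by (rule measurable_nrm[OF assms(2)])
  show ?thesis unfolding log_ratio_def[abs_def] by measurable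
qed

lemma measurable_log_ratio_block:
  assumes "valid_factors blk U qf" "k \<in> U"
  shows "(\<lambda>y. log_ratio qf k (restrict y (blk1 blk k))) \<in> borel_measurable (LB B)"
  using measurable_LB_block[OF assms(2) measurable_log_ratio[OF assms]] .

lemma measurable_elbo_int:
  assumes "valid_factors blk U qf"
  shows "elbo_int qf \<in> borel_measurable (LB B)"
  unfolding elbo_int_def[abs_def]
proof (intro borel_measurable_diff borel_measurable_sum borel_measurable_const)
  show "(\<lambda>y. dquad (fmean blk qf) y / 2) \<in> borel_measurable (LB B)"
    using measurable_dquad[of "fmean blk qf"] by measurable
qed (rule measurable_log_ratio_block[OF assms])

text \<open>The integrand depends on the coordinates in \<open>B\<close> only, so it is averaged
  under the product of factors: \<open>dquad\<close> averages to the quadratic form of the mean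
  error, and each log ratio to the divergence of its own block.\<close>

lemma Vfun_regular:
  assumes "regular qf"
  shows "Vfun pd (qjoint blk U pd qf) = ereal (V0 - (\<Sum>k\<in>U. block_KL qf k) - quadform T (mean_err qf) / 2)"
proof -
  have v: "valid_factors blk U qf" and m: "sq_moments blk U qf"
    and e: "\<And>k. k \<in> U \<Longrightarrow> integrable (LB (blk1 blk k)) (\<lambda>x. qf k x * log_ratio qf k x)"
    using assms by (auto simp: regular_def)
  let ?p = "prodf blk U qf" and ?d = "dquad (fmean blk qf)"
  note fz = factorized_qjoint[OF v]
  have 1: "has_bochner_integral (LB B) ?p 1"
    by (intro integral_is_density is_density_prodf finite_U v)
  have 2: "has_bochner_integral (LB B) (\<lambda>y. ?p y * ?d y) (quadform T (mean_err qf))"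
    using expectation_dquad[OF v m] by (simp add: mean_err_def[abs_def])
  have 3: "has_bochner_integral (LB B) (\<lambda>y. ?p y * log_ratio qf k (restrict y (blk1 blk k))) (block_KL qf k)" if k: "k \<in> U" for k
    unfolding has_bochner_integral_iff block_KL_def
    using block_marginal_integrable[OF finite_U v k measurable_log_ratio[OF v k]]
      block_marginal_integral[OF finite_U v k measurable_log_ratio[OF v k]] e[OF k] by blast
  have "has_bochner_integral (LB B) (\<lambda>y. V0 * ?p y - (1/2) * (?p y * ?d y) - (\<Sum>k\<in>U. ?p y * log_ratio qf k (restrict y (blk1 blk k))))
     (V0 * 1 - (1/2) * quadform T (mean_err qf) - (\<Sum>k\<in>U. block_KL qf k))"
    by (intro has_bochner_integral_diff has_bochner_integral_sum has_bochner_integral_mult_right 1 2 3)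
  moreover have "V0 * ?p y - (1/2) * (?p y * ?d y) - (\<Sum>k\<in>U. ?p y * log_ratio qf k (restrict y (blk1 blk k))) = ?p y * elbo_int qf y" for y
    by (simp add: elbo_int_def right_diff_distrib sum_distrib_left)
  ultimately have "has_bochner_integral (LB B) (\<lambda>y. ?p y * elbo_int qf y) (V0 - (\<Sum>k\<in>U. block_KL qf k) - quadform T (mean_err qf) / 2)"
    by (simp add: algebra_simps)
  then have "has_bochner_integral Lp (\<lambda>\<theta>. qjoint blk U pd qf \<theta> * elbo_int qf (restrict \<theta> B)) (V0 - (\<Sum>k\<in>U. block_KL qf k) - quadform T (mean_err qf) / 2)"
    using factorized_integrable[OF finite_U fz measurable_elbo_int[OF v]]
      factorized_integral[OF finite_U fz measurable_elbo_int[OF v]]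
    by (simp add: has_bochner_integral_iff)
  then show ?thesis
    unfolding Vfun_def qjoint_integrand[OF v] by (simp add: has_bochner_integral_iff)
qed

lemma block_KL_nonneg:
  assumes "regular qf" "k \<in> U"
  shows "0 \<le> block_KL qf k"
proof -
  have d: "is_density (LB (blk1 blk k)) (qf k)" and e: "integrable (LB (blk1 blk k)) (\<lambda>x. qf k x * log_ratio qf k x)"
    using assms by (auto simp: regular_def valid_factors_def)
  have eq: "qf k x * (ln (nrm k (fmean blk qf) x) - ln (qf k x)) = - (qf k x * log_ratio qf k x)" for x
    by (simp add: log_ratio_def algebra_simps)
  have "(\<integral>x. qf k x * (ln (nrm k (fmean blk qf) x) - ln (qf k x)) \<partial>LB (blk1 blk k)) \<le> 0"
    by (rule gibbs_integral[OF d is_density_nrm[OF assms(2)] nrm_pos[OF assms(2)]])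
      (unfold eq, intro integrable_minus e)
  then show ?thesis unfolding eq block_KL_def by simp
qed

text \<open>By Gibbs' inequality each relative-entropy integrand has an integrable negative part, hence
  integrability of their sum transfers to the summands.\<close>
lemma regular_of_Vfun:
  assumes v: "valid_factors blk U qf" and V: "Vfun pd (qjoint blk U pd qf) > -\<infinity>"
  shows "regular qf"
proof -
  let ?q = "qjoint blk U pd qf" and ?p = "prodf blk U qf" and ?d = "dquad (fmean blk qf)"
  let ?r = "\<lambda>k y. log_ratio qf k (restrict y (blk1 blk k))"
  let ?n = "\<lambda>k y. max 0 (- ?r k y)"
  note fz = factorized_qjoint[OF v]
  have int: "integrable Lp (\<lambda>\<theta>. ?q \<theta> * (ln (pd \<theta>) - ln (?q \<theta>)))"
    using V by (auto simp: Vfun_def split: if_splits)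
  have m: "sq_moments blk U qf" by (rule sq_moments_factorized[OF fz int])
  have "integrable (LB B) (\<lambda>y. ?p y * elbo_int qf y)"
    using int factorized_integrable[OF finite_U fz measurable_elbo_int[OF v]]
    unfolding qjoint_integrand[OF v] by blast
  moreover have "integrable (LB B) (\<lambda>y. ?p y * ?d y)"
    by (rule integrable.intros[OF expectation_dquad[OF v m]])
  moreover have "integrable (LB B) ?p"
    by (rule integrable.intros[OF integral_is_density[OF is_density_prodf[OF finite_U v]]])
  ultimately have "integrable (LB B) (\<lambda>y. V0 * ?p y - (1/2) * (?p y * ?d y) - ?p y * elbo_int qf y)"
    by (intro Bochner_Integration.integrable_diff integrable_mult_right)
  moreover have "V0 * ?p y - (1/2) * (?p y * ?d y) - ?p y * elbo_int qf y = ?p y * (\<Sum>k\<in>U. ?r k y)" for y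
    by (simp add: elbo_int_def right_diff_distrib)
  ultimately have sum: "integrable (LB B) (\<lambda>y. ?p y * (\<Sum>k\<in>U. ?r k y))" by simp
  have neg: "integrable (LB B) (\<lambda>y. ?p y * ?n k y)" if k: "k \<in> U" for k
  proof -
    let ?S = "blk1 blk k" and ?h = "nrm k (fmean blk qf)"
    have nm: "(\<lambda>x. max 0 (- log_ratio qf k x)) \<in> borel_measurable (LB ?S)"
      using measurable_log_ratio[OF v k] by measurable
    have qm: "qf k \<in> borel_measurable (LB ?S)" and q0: "\<And>x. x \<in> space (LB ?S) \<Longrightarrow> 0 \<le> qf k x"
      using v k by (auto simp: valid_factors_def is_density_def)
    have "integrable (LB ?S) (\<lambda>x. qf k x * max 0 (- log_ratio qf k x))"
    proof (rule Bochner_Integration.integrable_bound)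
      show "integrable (LB ?S) ?h" by (rule integrable.intros[OF integral_is_density[OF is_density_nrm[OF k]]])
      show "(\<lambda>x. qf k x * max 0 (- log_ratio qf k x)) \<in> borel_measurable (LB ?S)"
        using qm nm by measurable
      show "AE x in LB ?S. norm (qf k x * max 0 (- log_ratio qf k x)) \<le> norm (?h x)"
      proof (rule AE_I2)
        fix x assume x: "x \<in> space (LB ?S)"
        have "qf k x * (- log_ratio qf k x) \<le> ?h x"
          using gibbs_pointwise[OF q0[OF x] nrm_pos[OF k, of "fmean blk qf" x]] q0[OF x] by (simp add: log_ratio_def)
        then have "qf k x * max 0 (- log_ratio qf k x) \<le> ?h x"
          using nrm_pos[OF k, of "fmean blk qf" x] by (simp add: max_def)
        moreover have "0 \<le> qf k x * max 0 (- log_ratio qf k x)" using q0[OF x] by simp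
        ultimately show "norm (qf k x * max 0 (- log_ratio qf k x)) \<le> norm (?h x)"
          unfolding real_norm_def by linarith
      qed
    qed
    then show ?thesis using block_marginal_integrable[OF finite_U v k nm] by blast
  qed
  have "integrable (LB (blk1 blk k)) (\<lambda>x. qf k x * log_ratio qf k x)" if k: "k \<in> U" for k
  proof -
    have "integrable (LB B) (\<lambda>y. ?p y * ?r k y)"
    proof (rule Bochner_Integration.integrable_bound)
      show "integrable (LB B) (\<lambda>y. \<bar>?p y * (\<Sum>k\<in>U. ?r k y)\<bar> + (\<Sum>j\<in>U. ?p y * ?n j y))"
        by (intro Bochner_Integration.integrable_add integrable_abs sum Bochner_Integration.integrable_sum neg)
      show "(\<lambda>y. ?p y * ?r k y) \<in> borel_measurable (LB B)"
        by (intro borel_measurable_times measurable_prodf measurable_log_ratio_block finite_U v k)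
      show "AE y in LB B. norm (?p y * ?r k y) \<le> norm (\<bar>?p y * (\<Sum>k\<in>U. ?r k y)\<bar> + (\<Sum>j\<in>U. ?p y * ?n j y))"
      proof (rule AE_I2)
        fix y assume y: "y \<in> space (LB B)"
        have p0: "0 \<le> ?p y" by (rule prodf_nonneg[OF finite_U v y])
        \<comment> \<open>\<open>?r k\<close> is the whole sum minus the other terms, and minus each
          of those is at most its negative part \<open>?n\<close>.\<close>
        have "\<bar>?r k y\<bar> \<le> \<bar>\<Sum>k\<in>U. ?r k y\<bar> + (\<Sum>j\<in>U. ?n j y)"
        proof (rule abs_leI)
          have "?r k y + (\<Sum>j\<in>U - {k}. ?r j y) = (\<Sum>k\<in>U. ?r k y)"
            using finite_U k by (simp add: sum.remove)
          moreover have "- (\<Sum>j\<in>U - {k}. ?r j y) \<le> (\<Sum>j\<in>U - {k}. ?n j y)"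
            unfolding sum_negf[symmetric] by (rule sum_mono) simp
          moreover have "(\<Sum>j\<in>U - {k}. ?n j y) \<le> (\<Sum>j\<in>U. ?n j y)"
            using finite_U by (intro sum_mono2) auto
          ultimately show "?r k y \<le> \<bar>\<Sum>k\<in>U. ?r k y\<bar> + (\<Sum>j\<in>U. ?n j y)" by linarith
          have "?n k y \<le> (\<Sum>j\<in>U. ?n j y)" using finite_U k by (intro member_le_sum) auto
          then show "- ?r k y \<le> \<bar>\<Sum>k\<in>U. ?r k y\<bar> + (\<Sum>j\<in>U. ?n j y)" by linarith
        qed
        then have "?p y * \<bar>?r k y\<bar> \<le> ?p y * (\<bar>\<Sum>k\<in>U. ?r k y\<bar> + (\<Sum>j\<in>U. ?n j y))"
          by (rule mult_left_mono) (rule p0)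
        moreover have "?p y * (\<bar>\<Sum>k\<in>U. ?r k y\<bar> + (\<Sum>j\<in>U. ?n j y)) = \<bar>?p y * (\<Sum>k\<in>U. ?r k y)\<bar> + (\<Sum>j\<in>U. ?p y * ?n j y)"
          unfolding abs_mult abs_of_nonneg[OF p0] distrib_left sum_distrib_left[of "?p y" "\<lambda>j. ?n j y"]
          by (rule refl)
        moreover have "norm (?p y * ?r k y) = ?p y * \<bar>?r k y\<bar>"
          unfolding real_norm_def abs_mult abs_of_nonneg[OF p0] by (rule refl)
        ultimately show "norm (?p y * ?r k y) \<le> norm (\<bar>?p y * (\<Sum>k\<in>U. ?r k y)\<bar> + (\<Sum>j\<in>U. ?p y * ?n j y))"
          unfolding real_norm_def by linarith
      qed
    qed
    then show ?thesis using block_marginal_integrable[OF finite_U v k measurable_log_ratio[OF v k]] by blast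
  qed
  then show ?thesis using v m by (simp add: regular_def)
qed

section \<open>The optimum\<close>

lemma valid_nrm: "valid_factors blk U (\<lambda>k. nrm k m)"
  by (simp add: valid_factors_def is_density_nrm)

lemma fmean_nrm: "i \<in> B \<Longrightarrow> fmean blk (\<lambda>k. nrm k m) i = m i"
  unfolding fmean_def
  by (intro has_bochner_integral_integral_eq nrm_mean) (auto simp: blockset_def)

lemma nrm_fmean: "k \<in> U \<Longrightarrow> nrm k (fmean blk (\<lambda>k. nrm k m)) = nrm k m"
  by (rule nrm_cong) (use fmean_nrm blk1_sub in blast)

lemma log_ratio_nrm: "k \<in> U \<Longrightarrow> log_ratio (\<lambda>k. nrm k m) k x = 0"
  by (simp add: log_ratio_def nrm_fmean)

lemma regular_nrm: "regular (\<lambda>k. nrm k m)"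
  using valid_nrm nrm_square by (auto simp: regular_def sq_moments_def log_ratio_nrm)

lemma Vfun_nrm: "Vfun pd (qjoint blk U pd (\<lambda>k. nrm k m)) = ereal (V0 - quadform T (\<lambda>i. m i - mu i) / 2)"
proof -
  have "block_KL (\<lambda>k. nrm k m) k = 0" if "k \<in> U" for k by (simp add: block_KL_def log_ratio_nrm that)
  moreover have "quadform T (mean_err (\<lambda>k. nrm k m)) = quadform T (\<lambda>i. m i - mu i)"
    by (rule quadform_T_cong) (simp add: mean_err_def fmean_nrm)
  ultimately show ?thesis by (simp add: Vfun_regular[OF regular_nrm])
qed

text \<open>The exponents add up to \<open>Qh\<close> by \<open>quadform_Qh\<close>. The constants
  then agree because the left side is a probability density.\<close>

lemma qjoint_nrm_mu:
  assumes "\<And>i. i \<in> B \<Longrightarrow> m i = mu i"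
  shows "qjoint blk U pd (\<lambda>k. nrm k m) = gauss Qh mu"
proof -
  define c where "c = gZ Q (- B) * (\<Prod>k\<in>U. gZ T (blk1 blk k))"
  have c: "c > 0" unfolding c_def by (intro mult_pos_pos gZ_C_pos prod_pos gZ_block_pos)
  have eq: "qjoint blk U pd (\<lambda>k. nrm k m) \<theta> = gker Qh UNIV mu \<theta> / c" for \<theta>
  proof -
    have "nrm k m (restrict \<theta> (blk1 blk k)) = exp (- cquad T (blk1 blk k) mu \<theta> / 2) / gZ T (blk1 blk k)" if k: "k \<in> U" for k
    proof -
      have "gker T (blk1 blk k) m (restrict \<theta> (blk1 blk k)) = gker T (blk1 blk k) mu \<theta>"
        by (rule gker_cong) (use assms blk1_sub[OF k] in auto)
      then show ?thesis by (simp add: nrm_def gker_def)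
    qed
    then have "prodf blk U (\<lambda>k. nrm k m) \<theta> = (\<Prod>k\<in>U. exp (- cquad T (blk1 blk k) mu \<theta> / 2) / gZ T (blk1 blk k))"
      unfolding prodf_def by (intro prod.cong refl)
    also have "\<dots> = exp (\<Sum>k\<in>U. - cquad T (blk1 blk k) mu \<theta> / 2) / (\<Prod>k\<in>U. gZ T (blk1 blk k))"
      by (simp add: prod_dividef exp_sum finite_U)
    also have "(\<Sum>k\<in>U. - cquad T (blk1 blk k) mu \<theta> / 2) = - quadform D (\<lambda>i. \<theta> i - mu i) / 2"
      unfolding sum_cquad_blocks[symmetric] by (simp add: sum_negf sum_divide_distrib)
    finally have "qjoint blk U pd (\<lambda>k. nrm k m) \<theta>
        = exp (- cquad Q (- B) (center \<theta>) \<theta> / 2) * exp (- quadform D (\<lambda>i. \<theta> i - mu i) / 2) / c"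
      by (simp add: qjoint_def condC_eq c_def gker_def)
    also have "\<dots> = gker Qh UNIV mu \<theta> / c"
      unfolding cquad_C_center gker_def
      by (simp add: cquad_def coord_proj_def quadform_Qh add_divide_distrib flip: exp_add)
    finally show ?thesis .
  qed
  have "has_bochner_integral Lp (qjoint blk U pd (\<lambda>k. nrm k m)) 1"
    by (rule integral_is_density[OF is_density_factorized[OF finite_U factorized_qjoint[OF valid_nrm]]])
  then have "(\<integral>\<theta>. gker Qh UNIV mu \<theta> / c \<partial>Lp) = 1"
    unfolding eq[abs_def] by (simp add: has_bochner_integral_iff)
  then have "gZ Qh UNIV = c" using c integral_gker[of UNIV Qh mu] by simp
  then show ?thesis by (auto simp: eq gauss_eq_gker)
qed

text \<open>\<open>q\<close>, with any conditional, is compared to \<open>?h\<close>, the true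
  conditional times block normals at the means of \<open>q\<close>. The divergence of
  \<open>q\<close> from \<open>?h\<close> equals V0 - V(q) minus half the quadratic form of the mean
  error. As V(q) is at least \<open>V0\<close>, both the divergence and the mean error on
  \<open>B\<close> must vanish.\<close>

lemma factorized_elbo:
  assumes fz: "factorized blk U g qf q" and int: "integrable Lp (\<lambda>\<theta>. q \<theta> * (ln (pd \<theta>) - ln (q \<theta>)))"
    and ge: "V0 \<le> (\<integral>\<theta>. q \<theta> * (ln (pd \<theta>) - ln (q \<theta>)) \<partial>Lp)"
  shows "(\<integral>\<theta>. q \<theta> * (ln (pd \<theta>) - ln (q \<theta>)) \<partial>Lp) = V0" "AE \<theta> in Lp. q \<theta> = gauss Qh mu \<theta>"
proof -
  note v = factorized_valid[OF fz]
  let ?m = "fmean blk qf"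
  let ?h = "qjoint blk U pd (\<lambda>k. nrm k ?m)" and ?t = "quadform T (\<lambda>i. ?m i - mu i)"
  have m: "sq_moments blk U qf" by (rule sq_moments_factorized[OF fz int])
  note fh = factorized_qjoint[OF valid_nrm[of ?m]]
  have hpos: "0 < ?h \<theta>" for \<theta>
    unfolding qjoint_def prodf_def by (intro mult_pos_pos condC_pos prod_pos nrm_pos)
  have lnh: "ln (?h \<theta>) = ln (pd \<theta>) - (V0 - dquad ?m \<theta> / 2)" for \<theta>
  proof -
    have "elbo_int (\<lambda>k. nrm k ?m) (restrict \<theta> B) = V0 - dquad (fmean blk (\<lambda>k. nrm k ?m)) \<theta> / 2"
      by (simp add: elbo_int_def log_ratio_nrm dquad_restrict)
    moreover have "dquad (fmean blk (\<lambda>k. nrm k ?m)) \<theta> = dquad ?m \<theta>"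
    proof -
      have "cquad T (blk1 blk k) (fmean blk (\<lambda>k. nrm k ?m)) \<theta> = cquad T (blk1 blk k) ?m \<theta>" if "k \<in> U" for k
        by (rule cquad_cong) (use blk1_sub[OF that] fmean_nrm in auto)
      then show ?thesis by (simp add: dquad_def)
    qed
    ultimately have "?h \<theta> * (ln (pd \<theta>) - ln (?h \<theta>)) = ?h \<theta> * (V0 - dquad ?m \<theta> / 2)"
      using qjoint_integrand[OF valid_nrm[of ?m], of \<theta>] by simp
    then have "ln (pd \<theta>) - ln (?h \<theta>) = V0 - dquad ?m \<theta> / 2"
      using hpos[of \<theta>] by (simp only: mult_cancel_left) auto
    then show ?thesis by simp
  qed
  have dq: "has_bochner_integral Lp (\<lambda>\<theta>. q \<theta> * dquad ?m \<theta>) ?t"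
    using factorized_integrable[OF finite_U fz measurable_dquad[of ?m]]
      factorized_integral[OF finite_U fz measurable_dquad[of ?m]] expectation_dquad[OF v m]
    by (simp add: has_bochner_integral_iff dquad_restrict)
  have dens: "is_density Lp q" by (rule is_density_factorized[OF finite_U fz])
  have q1: "has_bochner_integral Lp q 1" by (rule integral_is_density[OF dens])
  let ?I = "\<lambda>\<theta>. q \<theta> * (ln (pd \<theta>) - ln (q \<theta>))"
  have eq: "q \<theta> * (ln (?h \<theta>) - ln (q \<theta>)) = ?I \<theta> - V0 * q \<theta> + (1/2) * (q \<theta> * dquad ?m \<theta>)" for \<theta>
    unfolding lnh by (simp add: algebra_simps)
  have KL: "has_bochner_integral Lp (\<lambda>\<theta>. q \<theta> * (ln (?h \<theta>) - ln (q \<theta>))) (integral\<^sup>L Lp ?I - V0 * 1 + (1/2) * ?t)"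
    unfolding eq
    by (intro has_bochner_integral_add has_bochner_integral_diff has_bochner_integral_mult_right dq q1)
      (rule has_bochner_integral_integrable[OF int])
  have dh: "is_density Lp ?h" by (rule is_density_factorized[OF finite_U fh])
  have KLi: "integrable Lp (\<lambda>\<theta>. q \<theta> * (ln (?h \<theta>) - ln (q \<theta>)))" by (rule integrable.intros[OF KL])
  have KLv: "(\<integral>\<theta>. q \<theta> * (ln (?h \<theta>) - ln (q \<theta>)) \<partial>Lp) = integral\<^sup>L Lp ?I - V0 + ?t / 2"
    using has_bochner_integral_integral_eq[OF KL] by simp
  have le: "integral\<^sup>L Lp ?I - V0 + ?t / 2 \<le> 0"
    using gibbs_integral[OF dens dh hpos KLi] unfolding KLv .
  have t0: "0 \<le> ?t" by (rule quadform_T_nonneg)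
  show "integral\<^sup>L Lp ?I = V0" using le t0 ge by linarith
  have "?t = 0" and z: "integral\<^sup>L Lp ?I - V0 + ?t / 2 = 0" using le t0 ge by linarith+
  have "?m i = mu i" if i: "i \<in> B" for i
  proof (rule ccontr)
    assume "?m i \<noteq> mu i"
    then have "\<exists>j. coord_proj B (\<lambda>i. ?m i - mu i) j \<noteq> 0" using i by (auto simp: coord_proj_def)
    then have "quadform T (coord_proj B (\<lambda>i. ?m i - mu i)) > 0"
      using T_pd supp_on_coord_proj unfolding pd_on_def by blast
    then show False using \<open>?t = 0\<close> by (simp add: quadform_T_proj)
  qed
  then have "?h = gauss Qh mu" by (rule qjoint_nrm_mu)
  moreover have "AE \<theta> in Lp. q \<theta> = ?h \<theta>"
    by (rule gibbs_integral_eq[OF dens dh hpos KLi]) (use KLv z in simp_all)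
  ultimately show "AE \<theta> in Lp. q \<theta> = gauss Qh mu \<theta>" by simp
qed

end

section \<open>Coordinate ascent\<close>

text \<open>The last list entry is the latest update under \<open>foldl\<close>; splitting it off
  amounts to conditioning on the earlier choices.\<close>

lemma sum_lists_snoc:
  fixes f :: "'a list \<Rightarrow> real"
  assumes "finite A"
  shows "(\<Sum>xs | set xs \<subseteq> A \<and> length xs = Suc n. f xs) = (\<Sum>xs | set xs \<subseteq> A \<and> length xs = n. \<Sum>a\<in>A. f (xs @ [a]))"
proof -
  let ?L = "{xs. set xs \<subseteq> A \<and> length xs = n}"
  have "(\<Sum>xs\<in>?L. \<Sum>a\<in>A. f (xs @ [a])) = (\<Sum>(xs, a)\<in>?L \<times> A. f (xs @ [a]))"
    by (rule sum.cartesian_product)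
  also have "\<dots> = (\<Sum>xs | set xs \<subseteq> A \<and> length xs = Suc n. f xs)"
  proof (rule sum.reindex_bij_witness[where i="\<lambda>xs. (butlast xs, last xs)" and j="\<lambda>(xs, a). xs @ [a]"])
    fix xs assume "xs \<in> {xs. set xs \<subseteq> A \<and> length xs = Suc n}"
    then have xs: "set xs \<subseteq> A" "length xs = Suc n" by auto
    then have "xs \<noteq> []" by auto
    then show "(case (butlast xs, last xs) of (xs, a) \<Rightarrow> xs @ [a]) = xs" by simp
    show "(butlast xs, last xs) \<in> ?L \<times> A"
      using xs \<open>xs \<noteq> []\<close> last_in_set[of xs] by (auto dest: in_set_butlastD)
  qed auto
  finally show ?thesis by simp
qed

context gauss_cavi
begin

text \<open>Averaging the log marginal over the other blocks keeps the quadratic form in block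
  \<open>k\<close> and replaces the other coordinates by their means in the cross term. Completing
  the square gives a normal law whose precision does not depend on the current factors.\<close>

lemma cavi_upd_eq:
  assumes v: "valid_factors blk U qf" and m: "sq_moments blk U qf" and k: "k \<in> U"
  shows "cavi_upd blk U pd qf k = qf(k := nrm k (\<lambda>i. fmean blk qf i - newton k (mean_err qf) i))"
proof -
  let ?A = "U - {k}" and ?S = "blk1 blk k"
  let ?J = "blockset blk ?A" and ?p = "prodf blk ?A qf"
  let ?mn = "\<lambda>i. fmean blk qf i - newton k (mean_err qf) i"
  define c1 where "c1 = ln (gZ Q (- B) / gZ Q UNIV)"
  have vA: "valid_factors blk ?A qf" using v by (simp add: valid_factors_def)
  have mA: "sq_moments blk ?A qf" using m by (simp add: sq_moments_def)
  have fA: "finite ?A" using finite_U by simp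
  have Jiff: "i \<in> ?J \<longleftrightarrow> blk i \<in> ?A" for i by (simp add: blockset_def)
  have Siff: "i \<in> ?S \<longleftrightarrow> blk i = k" for i by (simp add: blockset_def)
  define w where "w y = coord_proj ?J (\<lambda>i. y i - mu i)" for y
  define p where "p x = coord_proj ?S (\<lambda>i. x i - mu i)" for x
  define mean_err' where "mean_err' = coord_proj ?J (mean_err qf)"
  have lnm: "ln (margU blk U pd (merge ?S ?J (x, y))) = c1 - (quadform T (p x) + 2 * bil T (p x) (w y) + quadform T (w y)) / 2" for x y
  proof -
    have "cquad T B mu (merge ?S ?J (x, y)) = quadform T (\<lambda>i. p x i + w y i)"
      unfolding cquad_T_B
      by (rule quadform_T_cong) (auto simp: p_def w_def coord_proj_def merge_def Jiff Siff B_iff)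
    also have "\<dots> = quadform T (p x) + 2 * bil T (p x) (w y) + quadform T (w y)"
      by (rule quadform_add[OF T_sym])
    finally have c: "cquad T B mu (merge ?S ?J (x, y)) = quadform T (p x) + 2 * bil T (p x) (w y) + quadform T (w y)" .
    have "ln (margU blk U pd (merge ?S ?J (x, y))) = - cquad T B mu (merge ?S ?J (x, y)) / 2 + c1"
      unfolding margU_eq c1_def using gZ_C_pos gZ_Q_pos
      by (subst ln_mult_pos) (auto simp: gker_pos gker_def)
    then show ?thesis unfolding c by linarith
  qed
  have I1: "has_bochner_integral (LB ?J) ?p 1"
    by (intro integral_is_density is_density_prodf fA vA)
  have I2: "has_bochner_integral (LB ?J) (\<lambda>y. ?p y * bil T (p x) (w y)) (bil T (p x) mean_err')" for x
  proof -
    have w1: "has_bochner_integral (LB ?J) (\<lambda>y. ?p y * w y j) (mean_err' j)" for j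
    proof (cases "j \<in> ?J")
      case True
      then have "has_bochner_integral (LB ?J) (\<lambda>y. ?p y * (y j - mu j)) (fmean blk qf j - mu j)"
        using Jiff by (intro expectation_linear fA vA mA) blast
      then show ?thesis using True by (simp add: w_def mean_err'_def coord_proj_def mean_err_def)
    next
      case False
      then show ?thesis by (simp add: w_def mean_err'_def coord_proj_def has_bochner_integral_zero)
    qed
    have "has_bochner_integral (LB ?J) (\<lambda>y. \<Sum>i\<in>UNIV. \<Sum>j\<in>UNIV. p x i * T i j * (?p y * w y j))
        (\<Sum>i\<in>UNIV. \<Sum>j\<in>UNIV. p x i * T i j * mean_err' j)"
      by (intro has_bochner_integral_sum has_bochner_integral_mult_right w1)
    moreover have "(\<Sum>i\<in>UNIV. \<Sum>j\<in>UNIV. p x i * T i j * (?p y * w y j)) = ?p y * bil T (p x) (w y)" for y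
      unfolding bil_def sum_distrib_left by (intro sum.cong refl) (simp only: mult_ac)
    ultimately show ?thesis by (simp only: bil_def)
  qed
  \<comment> \<open>The part quadratic in the other blocks is free of \<open>x\<close>, so it only
    shifts the exponent and cancels on normalisation.\<close>
  define K where "K = (\<integral>y. ?p y * quadform T (w y) \<partial>LB ?J)"
  have I3: "has_bochner_integral (LB ?J) (\<lambda>y. ?p y * quadform T (w y)) K"
  proof -
    have w2: "integrable (LB ?J) (\<lambda>y. ?p y * (w y i * w y j))" for i j
    proof (cases "i \<in> ?J \<and> j \<in> ?J")
      case True
      then have "integrable (LB ?J) (\<lambda>y. ?p y * ((y i - mu i) * (y j - mu j)))"
        using Jiff by (intro integrable_product fA vA mA) blast+
      then show ?thesis using True by (simp add: w_def coord_proj_def)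
    next
      case False
      then show ?thesis by (auto simp: w_def coord_proj_def)
    qed
    have "integrable (LB ?J) (\<lambda>y. \<Sum>i\<in>UNIV. \<Sum>j\<in>UNIV. T i j * (?p y * (w y i * w y j)))"
      by (intro Bochner_Integration.integrable_sum integrable_mult_right w2)
    moreover have "(\<Sum>i\<in>UNIV. \<Sum>j\<in>UNIV. T i j * (?p y * (w y i * w y j))) = ?p y * quadform T (w y)" for y
      unfolding quadform_def sum_distrib_left by (intro sum.cong refl) (simp only: mult_ac)
    ultimately have "integrable (LB ?J) (\<lambda>y. ?p y * quadform T (w y))" by (simp only:)
    then show ?thesis unfolding K_def by (rule has_bochner_integral_integrable)
  qed
  \<comment> \<open>The error of the mean in block \<open>k\<close> after the update.\<close>
  define nu where "nu = coord_proj ?S (\<lambda>i. mean_err qf i - newton k (mean_err qf) i)"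
  define c2 where "c2 = c1 + (quadform T nu - K) / 2"
  have expo: "cavi_exponent blk U pd qf k x = c2 - cquad T ?S ?mn x / 2" for x
  proof -
    have "has_bochner_integral (LB ?J)
       (\<lambda>y. (c1 - quadform T (p x) / 2) * ?p y - ?p y * bil T (p x) (w y) - (1/2) * (?p y * quadform T (w y)))
       ((c1 - quadform T (p x) / 2) * 1 - bil T (p x) mean_err' - (1/2) * K)"
      by (intro has_bochner_integral_diff has_bochner_integral_mult_right I1 I2 I3)
    moreover have "?p y * ln (margU blk U pd (merge ?S ?J (x, y)))
       = (c1 - quadform T (p x) / 2) * ?p y - ?p y * bil T (p x) (w y) - (1/2) * (?p y * quadform T (w y))" for y
      unfolding lnm by (simp add: field_simps)
    ultimately have "cavi_exponent blk U pd qf k x = c1 - quadform T (p x) / 2 - bil T (p x) mean_err' - K / 2"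
      unfolding cavi_exponent_def by (simp add: has_bochner_integral_iff)
    \<comment> \<open>On \<open>B\<close> the updated error is \<open>mean_err' + nu\<close>, and
      the equation for \<open>newton\<close> makes \<open>T\<close> applied to it vanish in block
      \<open>k\<close>. The cross term is thus that of a square centred at
      \<open>nu\<close>.\<close>
    moreover have "bil T (p x) mean_err' = - bil T (p x) nu"
    proof -
      have ps: "supp_on ?S (p x)" by (simp add: p_def)
      have "bil T (p x) (\<lambda>i. mean_err' i + nu i) = bil T (p x) (coord_proj B (\<lambda>i. mean_err qf i - newton k (mean_err qf) i))"
      proof -
        have "(\<lambda>i. mean_err' i + nu i) = coord_proj B (\<lambda>i. mean_err qf i - newton k (mean_err qf) i)"
          using newton_supp[OF k, of "mean_err qf"] k
          by (auto simp: mean_err'_def nu_def coord_proj_def Jiff Siff B_iff supp_on_def fun_eq_iff)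
        then show ?thesis by simp
      qed
      also have "\<dots> = bil T (p x) (mean_err qf) - bil T (p x) (newton k (mean_err qf))"
        by (simp add: bil_T_proj bil_diff_right)
      also have "\<dots> = 0" using newton_eq[OF k ps] by simp
      finally show ?thesis by (simp add: bil_add_right)
    qed
    moreover have "cquad T ?S ?mn x = quadform T (p x) - 2 * bil T (p x) nu + quadform T nu"
    proof -
      have "coord_proj ?S (\<lambda>i. x i - ?mn i) = (\<lambda>i. p x i - nu i)"
        by (auto simp: p_def nu_def coord_proj_def mean_err_def fun_eq_iff)
      then show ?thesis unfolding cquad_def by (simp only: quadform_diff[OF T_sym])
    qed
    ultimately show ?thesis by (simp add: c2_def field_simps)
  qed
  have "exp (cavi_exponent blk U pd qf k x) = exp c2 * gker T ?S ?mn x" for x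
    unfolding expo gker_def by (simp flip: exp_add)
  then have "exp (cavi_exponent blk U pd qf k x) / (\<integral>z. exp (cavi_exponent blk U pd qf k z) \<partial>LB ?S) = nrm k ?mn x" for x
    using integral_gker[of ?S T ?mn] by (simp add: nrm_def)
  then show ?thesis by (simp add: cavi_upd_def)
qed

text \<open>Block \<open>k\<close> now coincides with its reference law. Since
  \<open>newton k\<close> is supported on that block, the other means, and with them the other
  reference laws, stay put.\<close>

lemma regular_cavi_upd:
  assumes g: "regular qf" and k: "k \<in> U"
  shows "regular (cavi_upd blk U pd qf k)"
    and "mean_err (cavi_upd blk U pd qf k) = (\<lambda>i. mean_err qf i - newton k (mean_err qf) i)"
    and "l \<in> U \<Longrightarrow> block_KL (cavi_upd blk U pd qf k) l = (if l = k then 0 else block_KL qf l)"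
proof -
  have v: "valid_factors blk U qf" and m: "sq_moments blk U qf"
    and e: "\<And>k. k \<in> U \<Longrightarrow> integrable (LB (blk1 blk k)) (\<lambda>x. qf k x * log_ratio qf k x)"
    using g by (auto simp: regular_def)
  let ?mn = "\<lambda>i. fmean blk qf i - newton k (mean_err qf) i"
  define qf' where "qf' = qf(k := nrm k ?mn)"
  have upd: "cavi_upd blk U pd qf k = qf'" unfolding qf'_def by (rule cavi_upd_eq[OF v m k])
  have v': "valid_factors blk U qf'" using v is_density_nrm[OF k] by (simp add: valid_factors_def qf'_def)
  have m': "sq_moments blk U qf'" using m nrm_square[OF k] by (auto simp: sq_moments_def qf'_def)
  have mean: "fmean blk qf' = ?mn"
  proof
    fix i
    show "fmean blk qf' i = ?mn i"
    proof (cases "blk i = k")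
      case True
      then have "i \<in> blk1 blk k" by (simp add: blockset_def)
      from has_bochner_integral_integral_eq[OF nrm_mean[OF k this, of ?mn]] True
      show ?thesis by (simp add: fmean_def qf'_def)
    next
      case False
      then have "newton k (mean_err qf) i = 0"
        using newton_supp[OF k, of "mean_err qf"] by (auto simp: supp_on_def blockset_def)
      then show ?thesis using False by (simp add: fmean_def qf'_def)
    qed
  qed
  show "mean_err (cavi_upd blk U pd qf k) = (\<lambda>i. mean_err qf i - newton k (mean_err qf) i)"
    unfolding upd by (auto simp: mean_err_def mean)
  have relk: "log_ratio qf' k = (\<lambda>x. 0)"
    unfolding log_ratio_def[abs_def] mean by (simp add: qf'_def)
  have rell: "log_ratio qf' l = log_ratio qf l" if "l \<noteq> k" for l
  proof -
    have "nrm l (fmean blk qf') = nrm l (fmean blk qf)"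
      unfolding mean using newton_supp[OF k, of "mean_err qf"] that
      by (intro nrm_cong) (auto simp: supp_on_def blockset_def)
    then show ?thesis using that by (auto simp: log_ratio_def qf'_def)
  qed
  show "block_KL (cavi_upd blk U pd qf k) l = (if l = k then 0 else block_KL qf l)" if "l \<in> U"
    unfolding upd block_KL_def using relk rell[of l] by (auto simp: qf'_def)
  have "integrable (LB (blk1 blk l)) (\<lambda>x. qf' l x * log_ratio qf' l x)" if "l \<in> U" for l
  proof (cases "l = k")
    case True
    then show ?thesis by (simp add: relk)
  next
    case False
    then show ?thesis using e[OF that] rell[OF False] by (simp add: qf'_def)
  qed
  then show "regular (cavi_upd blk U pd qf k)"
    unfolding upd regular_def using v' m' by blast
qed

section \<open>Recursions for the expected gap\<close>

definition gap :: "(nat \<Rightarrow> ('n \<Rightarrow> real) \<Rightarrow> real) \<Rightarrow> real" where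
  "gap qf = (\<Sum>k\<in>U. block_KL qf k) + quadform T (mean_err qf) / 2"

lemma gap_cavi_upd:
  assumes "regular qf" "k \<in> U"
  shows "gap (cavi_upd blk U pd qf k) = gap qf - block_KL qf k - quadform T (newton k (mean_err qf)) / 2"
proof -
  have "(\<Sum>l\<in>U. block_KL (cavi_upd blk U pd qf k) l) = (\<Sum>l\<in>U. if l = k then 0 else block_KL qf l)"
    by (intro sum.cong refl regular_cavi_upd assms)
  also have "\<dots> = (\<Sum>l\<in>U - {k}. block_KL qf l)"
    using finite_U assms(2) by (simp add: sum.remove)
  also have "\<dots> = (\<Sum>l\<in>U. block_KL qf l) - block_KL qf k"
    using finite_U assms(2) by (simp add: sum.remove)
  finally show ?thesis
    unfolding gap_def regular_cavi_upd(2)[OF assms] newton_descent[OF assms(2)] by (simp add: diff_divide_distrib)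
qed

text \<open>Summed over \<open>k\<close>, the divergences drop by their full amount and the
  quadratic term by at least the fraction \<open>lam\<close>; since \<open>lam\<close> <= 1, that
  fraction bounds both.\<close>

lemma gap_decrease:
  assumes "regular qf"
  shows "(\<Sum>k\<in>U. gap (cavi_upd blk U pd qf k)) \<le> (real (card U) - lam) * gap qf"
proof -
  have "(\<Sum>k\<in>U. gap (cavi_upd blk U pd qf k)) = (\<Sum>k\<in>U. gap qf - block_KL qf k - quadform T (newton k (mean_err qf)) / 2)"
    by (intro sum.cong refl gap_cavi_upd assms)
  also have "\<dots> = real (card U) * gap qf - (\<Sum>k\<in>U. block_KL qf k) - (\<Sum>k\<in>U. quadform T (newton k (mean_err qf))) / 2"
    by (simp add: sum_subtractf sum_divide_distrib)
  also have "\<dots> \<le> real (card U) * gap qf - lam * (\<Sum>k\<in>U. block_KL qf k) - (lam * quadform T (mean_err qf)) / 2"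
  proof -
    have "0 \<le> (\<Sum>k\<in>U. block_KL qf k)" by (intro sum_nonneg block_KL_nonneg assms)
    then have "lam * (\<Sum>k\<in>U. block_KL qf k) \<le> 1 * (\<Sum>k\<in>U. block_KL qf k)"
      using lam_le_1 by (intro mult_right_mono)
    then show ?thesis using sum_newton_quad[of "mean_err qf"] by simp
  qed
  also have "\<dots> = (real (card U) - lam) * gap qf" by (simp add: gap_def field_simps)
  finally show ?thesis .
qed

abbreviation seqs :: "nat \<Rightarrow> nat list set" where "seqs s \<equiv> {ks. set ks \<subseteq> U \<and> length ks = s}"

abbreviation run :: "(nat \<Rightarrow> ('n \<Rightarrow> real) \<Rightarrow> real) \<Rightarrow> nat list \<Rightarrow> nat \<Rightarrow> ('n \<Rightarrow> real) \<Rightarrow> real" where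
  "run \<equiv> cavi_run blk U pd"

lemma run_snoc: "run qf (ks @ [k]) = cavi_upd blk U pd (run qf ks) k"
  by (simp add: cavi_run_def)

lemma regular_run: "regular qf \<Longrightarrow> set ks \<subseteq> U \<Longrightarrow> regular (run qf ks)"
proof (induction ks rule: rev_induct)
  case (snoc k ks)
  then show ?case unfolding run_snoc by (intro regular_cavi_upd) auto
qed (simp add: cavi_run_def)

lemma card_U_ge_1: "real (card U) \<ge> 1"
  using finite_U U_ne by (simp add: Suc_le_eq card_gt_0_iff)

lemma rate_nonneg: "0 \<le> 1 - lam / real (card U)"
  using card_U_ge_1 lam_le_1 by (simp add: divide_le_eq)

lemma mean_gap_upper:
  assumes "regular qf"
  shows "(\<Sum>ks\<in>seqs s. gap (run qf ks)) / real (card U) ^ s \<le> (1 - lam / real (card U)) ^ s * gap qf"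
proof (induction s)
  case 0
  then show ?case by (simp add: cavi_run_def cong: conj_cong)
next
  case (Suc s)
  let ?u = "real (card U)"
  have u: "?u > 0" using card_U_ge_1 by simp
  have "(\<Sum>ks\<in>seqs (Suc s). gap (run qf ks)) = (\<Sum>ks\<in>seqs s. \<Sum>k\<in>U. gap (run qf (ks @ [k])))"
    by (rule sum_lists_snoc[OF finite_U])
  also have "\<dots> \<le> (\<Sum>ks\<in>seqs s. (?u - lam) * gap (run qf ks))"
    unfolding run_snoc by (intro sum_mono gap_decrease regular_run assms) simp
  also have "\<dots> = (?u - lam) * (\<Sum>ks\<in>seqs s. gap (run qf ks))" by (simp add: sum_distrib_left)
  finally have "(\<Sum>ks\<in>seqs (Suc s). gap (run qf ks)) / ?u ^ Suc s \<le> (?u - lam) * (\<Sum>ks\<in>seqs s. gap (run qf ks)) / ?u ^ Suc s"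
    using u by (intro divide_right_mono) auto
  also have "\<dots> = (1 - lam / ?u) * ((\<Sum>ks\<in>seqs s. gap (run qf ks)) / ?u ^ s)"
    using u by (simp add: field_simps)
  also have "\<dots> \<le> (1 - lam / ?u) * ((1 - lam / ?u) ^ s * gap qf)"
    by (intro mult_left_mono Suc.IH rate_nonneg)
  finally show ?case by (simp add: mult.assoc)
qed

text \<open>By \<open>sum_newton_lin\<close> the functional \<open>bil T x0\<close> is an
  eigenvector of the averaged update of the mean error, so the recursion is an equality for every
  regular start.\<close>

lemma mean_linear:
  assumes "regular qf"
  shows "(\<Sum>ks\<in>seqs s. bil T x0 (mean_err (run qf ks))) / real (card U) ^ s
     = (1 - lam / real (card U)) ^ s * bil T x0 (mean_err qf)"
proof (induction s)
  case 0
  then show ?case by (simp add: cavi_run_def cong: conj_cong)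
next
  case (Suc s)
  let ?u = "real (card U)" and ?f = "\<lambda>qf. bil T x0 (mean_err qf)"
  have u: "?u > 0" using card_U_ge_1 by simp
  have step: "(\<Sum>k\<in>U. ?f (cavi_upd blk U pd q k)) = (?u - lam) * ?f q" if "regular q" for q
  proof -
    have "(\<Sum>k\<in>U. ?f (cavi_upd blk U pd q k)) = (\<Sum>k\<in>U. ?f q - bil T x0 (newton k (mean_err q)))"
      by (intro sum.cong refl) (simp add: regular_cavi_upd(2)[OF that] bil_diff_right)
    then show ?thesis by (simp add: sum_subtractf sum_newton_lin algebra_simps)
  qed
  have "(\<Sum>ks\<in>seqs (Suc s). ?f (run qf ks)) = (\<Sum>ks\<in>seqs s. \<Sum>k\<in>U. ?f (run qf (ks @ [k])))"
    by (rule sum_lists_snoc[OF finite_U])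
  also have "\<dots> = (\<Sum>ks\<in>seqs s. (?u - lam) * ?f (run qf ks))"
    unfolding run_snoc by (intro sum.cong refl step regular_run assms) simp
  also have "\<dots> = (?u - lam) * (\<Sum>ks\<in>seqs s. ?f (run qf ks))" by (simp add: sum_distrib_left)
  finally have "(\<Sum>ks\<in>seqs (Suc s). ?f (run qf ks)) / ?u ^ Suc s = (1 - lam / ?u) * ((\<Sum>ks\<in>seqs s. ?f (run qf ks)) / ?u ^ s)"
    using u by (simp add: field_simps)
  then show ?case unfolding Suc.IH by (simp add: mult.assoc)
qed

definition qdag :: "nat \<Rightarrow> ('n \<Rightarrow> real) \<Rightarrow> real" where
  "qdag k = nrm k (\<lambda>i. mu i + x0 i)"

lemma regular_qdag: "regular qdag"
  using regular_nrm[of "\<lambda>i. mu i + x0 i"] by (simp add: qdag_def[abs_def])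

lemma gap_qdag: "gap qdag = quadform T x0 / 2"
proof -
  have "block_KL qdag k = 0" if "k \<in> U" for k using log_ratio_nrm[OF that, of "\<lambda>i. mu i + x0 i"] by (simp add: block_KL_def qdag_def[abs_def])
  moreover have "quadform T (mean_err qdag) = quadform T x0"
    by (rule quadform_T_cong) (simp add: mean_err_def qdag_def[abs_def] fmean_nrm)
  ultimately show ?thesis by (simp add: gap_def)
qed

text \<open>On the eigenvector \<open>x0\<close> the linear functional \<open>bil T x0\<close> of the mean error contracts exactly at rate
  \<open>1 - lam / u\<close> in expectation; Cauchy-Schwarz and Jensen square the rate.\<close>
lemma mean_gap_lower:
  "(1 - lam / real (card U)) ^ (2 * s) * gap qdag \<le> (\<Sum>ks\<in>seqs s. gap (run qdag ks)) / real (card U) ^ s"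
proof -
  let ?u = "real (card U)" and ?f = "\<lambda>qf. bil T x0 (mean_err qf)" and ?t = "quadform T x0"
  have u: "?u > 0" using card_U_ge_1 by simp
  have t: "?t > 0" by (rule x0_pos)
  have card: "real (card (seqs s)) = ?u ^ s" using card_lists_length_eq[OF finite_U, of s] by simp
  have fin: "finite (seqs s)" by (rule finite_lists_length_eq[OF finite_U])
  have f0: "?f qdag = ?t"
  proof -
    have "bil T x0 (mean_err qdag) = bil T x0 x0"
      unfolding bil_T by (rule arg_cong[where f="bil Q (lift x0)"], rule lift_cong)
        (simp add: mean_err_def qdag_def[abs_def] fmean_nrm)
    then show ?thesis by (simp add: quadform_bil)
  qed
  have point: "(?f (run qdag ks))\<^sup>2 / (2 * ?t) \<le> gap (run qdag ks)" if "ks \<in> seqs s" for ks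
  proof -
    have g: "regular (run qdag ks)" using that by (intro regular_run regular_qdag) simp
    have "(?f (run qdag ks))\<^sup>2 \<le> ?t * quadform T (mean_err (run qdag ks))"
      by (rule bil_cauchy_schwarz[where S=UNIV]) (auto simp: T_sym quadform_T_nonneg supp_on_def)
    then have "(?f (run qdag ks))\<^sup>2 / (2 * ?t) \<le> quadform T (mean_err (run qdag ks)) / 2"
      using t by (simp add: field_simps)
    moreover have "0 \<le> (\<Sum>k\<in>U. block_KL (run qdag ks) k)" by (intro sum_nonneg block_KL_nonneg g)
    ultimately show ?thesis by (simp add: gap_def)
  qed
  have "((1 - lam / ?u) ^ s * ?t)\<^sup>2 = ((\<Sum>ks\<in>seqs s. ?f (run qdag ks)) / ?u ^ s)\<^sup>2"
    using mean_linear[OF regular_qdag, of s] by (simp add: f0)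
  \<comment> \<open>Jensen for the square under the uniform law on \<open>seqs s\<close>, which has
    \<open>?u ^ s\<close> elements.\<close>
  also have "\<dots> \<le> (\<Sum>ks\<in>seqs s. (?f (run qdag ks))\<^sup>2) / ?u ^ s"
  proof -
    have "(\<Sum>ks\<in>seqs s. ?f (run qdag ks))\<^sup>2 \<le> (\<Sum>ks\<in>seqs s. (?f (run qdag ks))\<^sup>2) * ?u ^ s"
      using sum_squared_le_sum_of_squares[of "\<lambda>ks. ?f (run qdag ks)" "seqs s"] fin by (simp add: card mult.commute)
    then show ?thesis using u by (simp add: power_divide power2_eq_square field_simps)
  qed
  finally have *: "((1 - lam / ?u) ^ s * ?t)\<^sup>2 / (2 * ?t) \<le> (\<Sum>ks\<in>seqs s. (?f (run qdag ks))\<^sup>2) / ?u ^ s / (2 * ?t)"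
    using t by (intro divide_right_mono) auto
  have "(1 - lam / ?u) ^ (2 * s) * gap qdag = ((1 - lam / ?u) ^ s * ?t)\<^sup>2 / (2 * ?t)"
    using t by (simp add: gap_qdag power_mult_distrib power_mult power2_eq_square mult.commute[of 2 s] flip: power_mult)
      (simp add: power_mult power2_eq_square)
  also note *
  also have "(\<Sum>ks\<in>seqs s. (?f (run qdag ks))\<^sup>2) / ?u ^ s / (2 * ?t) = (\<Sum>ks\<in>seqs s. (?f (run qdag ks))\<^sup>2 / (2 * ?t)) / ?u ^ s"
    by (simp add: sum_divide_distrib mult.commute)
  also have "\<dots> \<le> (\<Sum>ks\<in>seqs s. gap (run qdag ks)) / ?u ^ s"
    using u by (intro divide_right_mono sum_mono point) auto
  finally show ?thesis .
qed

section \<open>From the recursions to the expected values of V\<close>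

lemma exp_gap_eq:
  assumes "regular qf" "Vfun pd qs = ereal V0"
  shows "exp_gap blk U pd qs qf s = ereal ((\<Sum>ks\<in>seqs s. gap (run qf ks)) / real (card U) ^ s)"
proof -
  have "ereal (1 / real (card U) ^ s) * (Vfun pd qs - Vfun pd (qjoint blk U pd (run qf ks)))
      = ereal (gap (run qf ks) / real (card U) ^ s)" if "ks \<in> seqs s" for ks
  proof -
    have "regular (run qf ks)" using that by (intro regular_run assms) simp
    then show ?thesis by (simp add: Vfun_regular assms gap_def)
  qed
  then have "exp_gap blk U pd qs qf s = (\<Sum>ks\<in>seqs s. ereal (gap (run qf ks) / real (card U) ^ s))"
    unfolding exp_gap_def by (intro sum.cong refl) blast
  then show ?thesis by (simp add: sum_divide_distrib)
qed

lemma UQF_cong_AE: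
  assumes "q \<in> borel_measurable Lp" "AE \<theta> in Lp. q \<theta> = gauss Qh mu \<theta>"
  shows "UQF q pd = lam"
proof -
  have gm: "gauss Qh mu \<in> borel_measurable Lp"
    unfolding gauss_eq_gker[abs_def] by (intro borel_measurable_divide measurable_gker borel_measurable_const subset_UNIV)
  have "dvar q (\<lambda>\<theta>. \<Sum>i\<in>UNIV. \<theta> i * v i) = dvar (gauss Qh mu) (\<lambda>\<theta>. \<Sum>i\<in>UNIV. \<theta> i * v i)" for v :: "'n \<Rightarrow> real"
  proof -
    have fm: "(\<lambda>\<theta>. \<Sum>i\<in>UNIV. \<theta> i * v i) \<in> borel_measurable Lp"
      by (intro borel_measurable_sum borel_measurable_times measurable_LB_component borel_measurable_const UNIV_I)
    have "(\<integral>\<theta>. q \<theta> * h \<theta> \<partial>Lp) = (\<integral>\<theta>. gauss Qh mu \<theta> * h \<theta> \<partial>Lp)" if "h \<in> borel_measurable Lp" for h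
      using assms gm that by (intro integral_cong_AE borel_measurable_times) auto
    from this[OF fm] this[OF borel_measurable_power[OF fm]] show ?thesis unfolding dvar_def by simp
  qed
  then show ?thesis unfolding UQF_Qh[symmetric] UQF_def by simp
qed

text \<open>The strict inequality for \<open>qdag\<close> makes its initial gap positive, so the
  lower bound is not met trivially by starting at the optimum.\<close>

theorem cavi_rates:
  assumes "qs \<in> famQ blk U" and max: "\<forall>q\<in>famQ blk U. Vfun pd q \<le> Vfun pd qs"
  shows "valid_factors blk U qf0 \<Longrightarrow> Vfun pd (qjoint blk U pd qf0) > -\<infinity> \<Longrightarrow>
      exp_gap blk U pd qs qf0 s \<le> ereal ((1 - UQF qs pd / real (card U)) ^ s) * (Vfun pd qs - Vfun pd (qjoint blk U pd qf0))"
    and "valid_factors blk U qdag" "Vfun pd (qjoint blk U pd qdag) > -\<infinity>"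
      "Vfun pd (qjoint blk U pd qdag) < Vfun pd qs"
    and "ereal ((1 - UQF qs pd / real (card U)) ^ (2 * s)) * (Vfun pd qs - Vfun pd (qjoint blk U pd qdag))
       \<le> exp_gap blk U pd qs qdag s"
proof -
  obtain g qf where fz: "factorized blk U g qf qs"
    using assms(1) unfolding famQ_iff_factorized by blast
  have mem: "qjoint blk U pd (\<lambda>k. nrm k mu) \<in> famQ blk U"
    unfolding famQ_iff_factorized by (intro exI) (rule factorized_qjoint[OF valid_nrm])
  \<comment> \<open>The competitor with normal factors centred at \<open>mu\<close> has value
    \<open>V0\<close>. Hence V at the maximiser is finite and at least \<open>V0\<close>, as
    \<open>factorized_elbo\<close> requires.\<close>
  have ge: "ereal V0 \<le> Vfun pd qs"
    using bspec[OF max mem] by (simp add: Vfun_nrm quadform_eq_0)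
  have int: "integrable Lp (\<lambda>\<theta>. qs \<theta> * (ln (pd \<theta>) - ln (qs \<theta>)))"
    using ge by (auto simp: Vfun_def split: if_splits)
  then have Vs: "Vfun pd qs = ereal (\<integral>\<theta>. qs \<theta> * (ln (pd \<theta>) - ln (qs \<theta>)) \<partial>Lp)" by (simp add: Vfun_def)
  have ge': "V0 \<le> (\<integral>\<theta>. qs \<theta> * (ln (pd \<theta>) - ln (qs \<theta>)) \<partial>Lp)" using ge unfolding Vs by simp
  note star = factorized_elbo[OF fz int ge']
  have V: "Vfun pd qs = ereal V0" unfolding Vs star(1) ..
  have uqf: "UQF qs pd = lam" by (rule UQF_cong_AE[OF measurable_factorized[OF finite_U fz] star(2)])
  have diff: "Vfun pd qs - Vfun pd (qjoint blk U pd q) = ereal (gap q)" if "regular q" for q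
    by (simp add: V Vfun_regular[OF that] gap_def)
  show "exp_gap blk U pd qs qf0 s \<le> ereal ((1 - UQF qs pd / real (card U)) ^ s) * (Vfun pd qs - Vfun pd (qjoint blk U pd qf0))"
    if "valid_factors blk U qf0" "Vfun pd (qjoint blk U pd qf0) > -\<infinity>"
  proof -
    have g: "regular qf0" by (rule regular_of_Vfun[OF that])
    show ?thesis unfolding exp_gap_eq[OF g V] diff[OF g] uqf using mean_gap_upper[OF g, of s] by simp
  qed
  show "valid_factors blk U qdag" using regular_qdag by (simp add: regular_def)
  show "Vfun pd (qjoint blk U pd qdag) > -\<infinity>" by (simp add: Vfun_regular[OF regular_qdag])
  show "Vfun pd (qjoint blk U pd qdag) < Vfun pd qs"
    using gap_qdag x0_pos(1) by (simp add: V Vfun_regular[OF regular_qdag] gap_def)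
  show "ereal ((1 - UQF qs pd / real (card U)) ^ (2 * s)) * (Vfun pd qs - Vfun pd (qjoint blk U pd qdag))
       \<le> exp_gap blk U pd qs qdag s"
    unfolding exp_gap_eq[OF regular_qdag V] diff[OF regular_qdag] uqf using mean_gap_lower[of s] by simp
qed

end

theorem theorem1:
  fixes blk :: "'n::finite \<Rightarrow> nat" and K :: nat and C U :: "nat set"
    and Q :: "'n \<Rightarrow> 'n \<Rightarrow> real" and mu :: "'n \<Rightarrow> real"
    and qstar :: "('n \<Rightarrow> real) \<Rightarrow> real"
  assumes blocks: "blk ` UNIV = {0..K}"
    and partition: "C \<union> U = {0..K}" "C \<inter> U = {}" "U \<noteq> {}"
    and posdef: "pos_def_mat Q"
    and qstar_in: "qstar \<in> famQ blk U"
    and qstar_max: "\<forall>q\<in>famQ blk U. Vfun (gauss Q mu) q \<le> Vfun (gauss Q mu) qstar"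
  shows "(\<forall>qf0. valid_factors blk U qf0
            \<and> Vfun (gauss Q mu) (qjoint blk U (gauss Q mu) qf0) > -\<infinity> \<longrightarrow>
           (\<forall>s::nat. exp_gap blk U (gauss Q mu) qstar qf0 s
              \<le> ereal ((1 - UQF qstar (gauss Q mu) / real (card U)) ^ s)
                 * (Vfun (gauss Q mu) qstar - Vfun (gauss Q mu) (qjoint blk U (gauss Q mu) qf0))))
       \<and> (\<exists>qf0. valid_factors blk U qf0
            \<and> Vfun (gauss Q mu) (qjoint blk U (gauss Q mu) qf0) > -\<infinity>
            \<and> Vfun (gauss Q mu) (qjoint blk U (gauss Q mu) qf0) < Vfun (gauss Q mu) qstar
            \<and> (\<forall>s::nat. exp_gap blk U (gauss Q mu) qstar qf0 s
                 \<ge> ereal ((1 - UQF qstar (gauss Q mu) / real (card U)) ^ (2 * s))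
                    * (Vfun (gauss Q mu) qstar - Vfun (gauss Q mu) (qjoint blk U (gauss Q mu) qf0))))"
proof -
  have pd: "pd_on UNIV Q" using posdef by (simp add: pos_def_mat_pd_on)
  obtain L where L: "(\<forall>i j. j \<notin> blockset blk U \<longrightarrow> L i j = 0)
      \<and> (\<forall>i j. i \<in> blockset blk U \<longrightarrow> L i j = (if i = j then 1 else 0))
      \<and> (\<forall>i j. i \<notin> blockset blk U \<longrightarrow> (\<Sum>a\<in>UNIV. Q i a * L a j) = 0)"
    using pd_lift_exists[OF pd, of "blockset blk U"] ..
  have sub: "U \<subseteq> {0..K}" using partition by blast
  interpret gauss_cavi blk U Q mu L
  proof
    show "finite U" using sub by (rule finite_subset) simp
    \<comment> \<open>\<open>blk\<close> hits every index up to \<open>K\<close>, so no block in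
      \<open>U\<close> is empty.\<close>
    show "\<exists>i. blk i = k" if "k \<in> U" for k
    proof -
      have "k \<in> blk ` UNIV" unfolding blocks using sub that by blast
      then show ?thesis by auto
    qed
  qed (use L pd partition in blast)+
  note rates = cavi_rates[OF qstar_in qstar_max]
  show ?thesis
    by (intro conjI allI impI exI[of _ qdag] rates) simp_all
qed

end
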